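(* Let $L$ be an $\mathbb{F}_2$H-thin knot whose $\mathbb{F}_2$-Khovanov homology is concentrated on the diagonals $j=s-1+2i$ and $j=s+1+2i$ (that is, $\mathrm{KH}_{\mathbb{F}_2}^{i,j}(L)=0$ unless $j-2i\in\{s-1,s+1\}$), where $s\in\mathbb{Z}$. Then there exists $Kh'(L)$, a Laurent polynomial in $tq^2$ with integer coefficients, such that $$Kh_{\mathbb{F}_2}(L)=q^{s-1}(1+q^2)\big(1+(1+tq^2)\,Kh'(L)\big).$$
   Context: Let $D$ be a diagram of an oriented link $L$ with $n$ ordered crossings, $n_+$ positive and $n_-$ negative. For $\alpha\in\{0,1\}^n$ let $D_\alpha$ be the complete smoothing in which the $r$-th crossing receives its $\alpha_r$-smoothing (the oriented smoothing of a positive crossing is its 0-smoothing and of a negative crossing its 1-smoothing). Let $A=\mathbb{F}_2\{1,x\}$ with $\deg 1=1$, $\deg x=-1$, and $V_\alpha=A^{\otimes(\text{circles of }D_\alpha)}$. Set $\overline{\mathcal C}^{i}(D)=\bigoplus_{|\alpha|-n_-=i}V_\alpha$, where $|\alpha|$ is the number of 1's in $\alpha$, and give homogeneous $v\in V_\alpha\subset\overline{\mathcal C}^{i}(D)$ the $q$-grading $q(v)=\deg(v)+i+n_+-n_-$. The differential $\partial$ is, on $V_\alpha$, the sum over all edges $\alpha\to\alpha'$ of the cube (one entry changed from 0 to 1) of the maps applying $\overline m$ (circles merge) or $\overline\Delta$ (a circle splits), and the identity on other tensor factors, where $\overline m(1,1)=1$, $\overline m(1,x)=\overline m(x,1)=x$,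 $\overline m(x,x)=0$, $\overline\Delta(1)=1\otimes x+x\otimes1$, $\overline\Delta(x)=x\otimes x$. The resulting bigraded homology is the $\mathbb{F}_2$-Khovanov homology $\mathrm{KH}_{\mathbb{F}_2}^{i,j}(L)$ ($i$ homological, $j$ the $q$-grading). The mod 2 Khovanov polynomial is $Kh_{\mathbb{F}_2}(L)=\sum_{i,j\in\mathbb{Z}}t^iq^j\dim_{\mathbb{F}_2}\mathrm{KH}_{\mathbb{F}_2}^{i,j}(L)$. A knot is $\mathbb{F}_2$H-thin if its $\mathbb{F}_2$-Khovanov homology is concentrated on two adjacent diagonals $j=s-1+2i$ and $j=s+1+2i$ for some $s$. *)

theory Defs
  imports
    "HOL-Algebra.AbelCoset"
    "Jordan_Normal_Form.VS_Connect"
    "HOL-Library.Z2"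
    "HOL-Library.FuncSet"
    "HOL-Library.Poly_Mapping"
    "HOL-Library.Product_Plus"
begin

section \<open>Oriented link diagrams\<close>

text \<open>
  Diagrams are given by signed planar diagram (PD) codes. The crossings are \<open>0, ..., ncross D - 1\<close>.
  The four ends (slots) of crossing \<open>r\<close> are numbered \<open>0, 1, 2, 3\<close> counterclockwise, starting with
  the incoming end of the under-strand, and \<open>arc D r p\<close> is the arc of the diagram attached to
  slot \<open>p\<close>. So the under-strand runs from slot 0 to slot 2; the over-strand runs from slot 3 to
  slot 1 at a positive crossing and from slot 1 to slot 3 at a negative one. An element of
  \<open>arcs D\<close> which is attached to no slot is a crossingless circle of the diagram.
\<close>

record link_diagram =
  ncross :: nat
  positive :: "nat \<Rightarrow> bool"
  arc :: "nat \<Rightarrow> nat \<Rightarrow> nat"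
  arcs :: "nat set"

definition n_pos :: "link_diagram \<Rightarrow> nat" where
  "n_pos D = card {r. r < ncross D \<and> positive D r}"

definition n_neg :: "link_diagram \<Rightarrow> nat" where
  "n_neg D = card {r. r < ncross D \<and> \<not> positive D r}"

definition slots :: "link_diagram \<Rightarrow> (nat \<times> nat) set" where
  "slots D = {..<ncross D} \<times> {..<4}"

definition in_slots :: "link_diagram \<Rightarrow> (nat \<times> nat) set" where
  "in_slots D = {(r, p). r < ncross D \<and> p \<in> (if positive D r then {0, 3} else {0, 1})}"

definition out_slots :: "link_diagram \<Rightarrow> (nat \<times> nat) set" where
  "out_slots D = {(r, p). r < ncross D \<and> p \<in> (if positive D r then {2, 1} else {2, 3})}"

definition slot_arc :: "link_diagram \<Rightarrow> nat \<times> nat \<Rightarrow> nat" where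
  "slot_arc D = (\<lambda>(r, p). arc D r p)"

text \<open>Classes of the equivalence relation on \<open>A\<close> generated by \<open>R \<subseteq> A \<times> A\<close>.\<close>

definition generated_classes :: "'a set \<Rightarrow> ('a \<times> 'a) set \<Rightarrow> 'a set set" where
  "generated_classes A R = A // (R \<union> R\<inverse>)\<^sup>*"

text \<open>
  Faces of the 4-valent graph underlying the diagram, as orbits of slots: leave a crossing through
  a slot, follow the arc to its other end, and continue with the counterclockwise next slot there.
\<close>

definition faces :: "link_diagram \<Rightarrow> (nat \<times> nat) set set" where
  "faces D = generated_classes (slots D)
     {((r, p), (r', (p' + 1) mod 4)) | r p r' p'.
        (r, p) \<in> slots D \<and> (r', p') \<in> slots D \<and> (r, p) \<noteq> (r', p') \<and> arc D r p = arc D r' p'}"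

definition pieces :: "link_diagram \<Rightarrow> nat set set" where
  "pieces D = generated_classes {..<ncross D}
     {(r, r') | r p r' p'.
        (r, p) \<in> slots D \<and> (r', p') \<in> slots D \<and> arc D r p = arc D r' p'}"

text \<open>
  Planarity: the connected pieces of the ribbon graph given by the PD code are spherical.
  Since no piece has Euler characteristic above 2, this is \<open>V - E + F = 2 C\<close>.
\<close>

definition planar :: "link_diagram \<Rightarrow> bool" where
  "planar D \<longleftrightarrow>
     int (ncross D) - int (card (slot_arc D ` slots D)) + int (card (faces D))
       = 2 * int (card (pieces D))"

definition link_diagram :: "link_diagram \<Rightarrow> bool" where
  "link_diagram D \<longleftrightarrow>
     finite (arcs D) \<and>
     slot_arc D ` slots D \<subseteq> arcs D \<and>
     inj_on (slot_arc D) (in_slots D) \<and>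
     inj_on (slot_arc D) (out_slots D) \<and>
     slot_arc D ` in_slots D = slot_arc D ` out_slots D \<and>
     planar D"

text \<open>The components of the link: go straight through every crossing.\<close>

definition components :: "link_diagram \<Rightarrow> nat set set" where
  "components D = generated_classes (arcs D)
     {(arc D r p, arc D r (p + 2)) | r p. r < ncross D \<and> p \<in> {0, 1}}"

definition knot_diagram :: "link_diagram \<Rightarrow> bool" where
  "knot_diagram D \<longleftrightarrow> link_diagram D \<and> card (components D) = 1"


section \<open>The cube of smoothings\<close>

text \<open>
  A vertex of the cube is the set \<open>\<alpha> \<subseteq> {..<ncross D}\<close> of crossings receiving the
  1-smoothing. The 0-smoothing joins slots 0, 1 and slots 2, 3; the 1-smoothing joins slots 0, 3
  and slots 1, 2. A circle of the smoothing is represented by its set of arcs.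
\<close>

definition circles :: "link_diagram \<Rightarrow> nat set \<Rightarrow> nat set set" where
  "circles D \<alpha> = generated_classes (arcs D)
     {(arc D r p, arc D r p') | r p p'. r < ncross D \<and>
        (p, p') \<in> (if r \<in> \<alpha> then {(0, 3), (1, 2)} else {(0, 1), (2, 3)})}"

text \<open>The basis \<open>1, x\<close> of \<open>A\<close>; elements of tensor powers of \<open>A\<close> are given by their coefficients.\<close>

datatype label = L1 | LX

fun deg :: "label \<Rightarrow> int" where
  "deg L1 = 1"
| "deg LX = -1"

definition basis_vec :: "label \<Rightarrow> label \<Rightarrow> bit" where
  "basis_vec a c = of_bool (a = c)"

fun mbar :: "label \<Rightarrow> label \<Rightarrow> (label \<Rightarrow> bit)" where
  "mbar L1 L1 = basis_vec L1"
| "mbar L1 LX = basis_vec LX"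
| "mbar LX L1 = basis_vec LX"
| "mbar LX LX = (\<lambda>_. 0)"

fun Deltabar :: "label \<Rightarrow> (label \<Rightarrow> label \<Rightarrow> bit)" where
  "Deltabar L1 = (\<lambda>c d. basis_vec L1 c * basis_vec LX d + basis_vec LX c * basis_vec L1 d)"
| "Deltabar LX = (\<lambda>c d. basis_vec LX c * basis_vec LX d)"

text \<open>
  The basis of \<open>V\<^sub>\<alpha>\<close>: pure tensors of basis elements of \<open>A\<close>, one factor for every circle.
  The pairs \<open>(\<alpha>, v)\<close> form the basis of the whole complex.
\<close>

type_synonym state = "nat set \<times> (nat set \<Rightarrow> label)"

definition states :: "link_diagram \<Rightarrow> state set" where
  "states D = {(\<alpha>, v). \<alpha> \<subseteq> {..<ncross D} \<and> v \<in> circles D \<alpha> \<rightarrow>\<^sub>E UNIV}"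

definition hdeg :: "link_diagram \<Rightarrow> state \<Rightarrow> int" where
  "hdeg D = (\<lambda>(\<alpha>, v). int (card \<alpha>) - int (n_neg D))"

definition qdeg :: "link_diagram \<Rightarrow> state \<Rightarrow> int" where
  "qdeg D = (\<lambda>(\<alpha>, v). (\<Sum>C\<in>circles D \<alpha>. deg (v C))
     + hdeg D (\<alpha>, v) + int (n_pos D) - int (n_neg D))"

text \<open>
  The coefficient of \<open>v'\<close> in the image of \<open>v\<close> under the map \<open>V\<^sub>\<alpha> \<rightarrow> V\<^sub>\<alpha>'\<close> of an edge of the cube.
  As \<^const>\<open>mbar\<close> and \<^const>\<open>Deltabar\<close> are (co)commutative, the order of \<open>a, b\<close> is irrelevant.
\<close>

definition edge_coeff ::
  "link_diagram \<Rightarrow> nat set \<Rightarrow> nat set \<Rightarrow> (nat set \<Rightarrow> label) \<Rightarrow> (nat set \<Rightarrow> label) \<Rightarrow> bit" where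
  "edge_coeff D \<alpha> \<alpha>' v v' = of_bool (
     (\<forall>C \<in> circles D \<alpha> \<inter> circles D \<alpha>'. v C = v' C) \<and>
     ((\<exists>a b c. a \<noteq> b \<and> circles D \<alpha> - circles D \<alpha>' = {a, b} \<and> circles D \<alpha>' - circles D \<alpha> = {c} \<and>
        mbar (v a) (v b) (v' c) = 1) \<or>
      (\<exists>a b c. a \<noteq> b \<and> circles D \<alpha> - circles D \<alpha>' = {c} \<and> circles D \<alpha>' - circles D \<alpha> = {a, b} \<and>
        Deltabar (v c) (v' a) (v' b) = 1)))"

definition cube_edge :: "link_diagram \<Rightarrow> nat set \<Rightarrow> nat set \<Rightarrow> bool" where
  "cube_edge D \<alpha> \<alpha>' \<longleftrightarrow> (\<exists>r < ncross D. r \<notin> \<alpha> \<and> \<alpha>' = insert r \<alpha>)"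


section \<open>The Khovanov complex and its homology\<close>

type_synonym chain = "state \<Rightarrow> bit"

definition boundary :: "link_diagram \<Rightarrow> chain \<Rightarrow> chain" where
  "boundary D c = (\<lambda>(\<alpha>', v').
     if (\<alpha>', v') \<in> states D
     then \<Sum>(\<alpha>, v) \<in> {(\<alpha>, v) \<in> states D. cube_edge D \<alpha> \<alpha>'}. c (\<alpha>, v) * edge_coeff D \<alpha> \<alpha>' v v'
     else 0)"

definition chains :: "link_diagram \<Rightarrow> int \<Rightarrow> int \<Rightarrow> chain set" where
  "chains D i j = {c. \<forall>s. c s \<noteq> 0 \<longrightarrow> s \<in> states D \<and> hdeg D s = i \<and> qdeg D s = j}"

definition cycles :: "link_diagram \<Rightarrow> int \<Rightarrow> int \<Rightarrow> chain set" where
  "cycles D i j = {c \<in> chains D i j. boundary D c = (\<lambda>_. 0)}"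

definition boundaries :: "link_diagram \<Rightarrow> int \<Rightarrow> int \<Rightarrow> chain set" where
  "boundaries D i j = boundary D ` chains D (i - 1) j"

text \<open>
  The record fields \<open>mult\<close> and \<open>one\<close> exist only because \<^typ>\<open>('k, 'v) module\<close> extends rings.
\<close>

definition cycle_space :: "link_diagram \<Rightarrow> int \<Rightarrow> int \<Rightarrow> (bit, chain) module" where
  "cycle_space D i j =
     \<lparr>carrier = cycles D i j,
      mult = (\<lambda>_ _ _. 0),
      one = (\<lambda>_. 0),
      zero = (\<lambda>_. 0),
      add = (\<lambda>c d s. c s + d s),
      smult = (\<lambda>k c s. k * c s)\<rparr>"

definition quotient_space :: "('k, 'v) module \<Rightarrow> 'v set \<Rightarrow> ('k, 'v set) module" where
  "quotient_space V W =
     \<lparr>carrier = a_rcosets\<^bsub>V\<^esub> W,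
      mult = (\<lambda>_ _. W),
      one = W,
      zero = W,
      add = (\<lambda>S T. S <+>\<^bsub>V\<^esub> T),
      smult = (\<lambda>k S. W <+>\<^bsub>V\<^esub> ((\<lambda>v. k \<odot>\<^bsub>V\<^esub> v) ` S))\<rparr>"

definition KH :: "link_diagram \<Rightarrow> int \<Rightarrow> int \<Rightarrow> (bit, chain set) module" where
  "KH D i j = quotient_space (cycle_space D i j) (boundaries D i j)"

definition dim_KH :: "link_diagram \<Rightarrow> int \<Rightarrow> int \<Rightarrow> nat" where
  "dim_KH D i j = vectorspace.dim (class_ring :: bit ring) (KH D i j)"

definition KH_concentrated :: "link_diagram \<Rightarrow> int \<Rightarrow> bool" where
  "KH_concentrated D s \<longleftrightarrow>
     (\<forall>i j. j - 2 * i \<notin> {s - 1, s + 1} \<longrightarrow> carrier (KH D i j) = {\<zero>\<^bsub>KH D i j\<^esub>})"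


section \<open>The Khovanov polynomial\<close>

text \<open>
  Laurent polynomials over the integers in \<open>t, q\<close> form the group ring of \<open>int \<times> int\<close>, with
  \<open>(i, j)\<close> standing for \<open>t\<^sup>i q\<^sup>j\<close>.
\<close>

type_synonym laurent_tq = "(int \<times> int) \<Rightarrow>\<^sub>0 int"

definition tq :: "int \<Rightarrow> int \<Rightarrow> laurent_tq" where
  "tq i j = Poly_Mapping.single (i, j) 1"

definition Kh :: "link_diagram \<Rightarrow> laurent_tq" where
  "Kh D = (\<Sum>(i, j). tq i j * of_nat (dim_KH D i j))"

text \<open>The substitution \<open>u = t q\<^sup>2\<close> in the one-variable Laurent polynomial \<open>\<Sum>k. P\<^sub>k u\<^sup>k\<close>.\<close>

definition subst_tq2 :: "(int \<Rightarrow>\<^sub>0 int) \<Rightarrow> laurent_tq" where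
  "subst_tq2 P = (\<Sum>k \<in> Poly_Mapping.keys P. of_int (Poly_Mapping.lookup P k) * tq k (2 * k))"

end

theory Submission
  imports Defs
begin

text \<open>
  Write \<open>a\<^sub>i\<close> for the dimension of the homology in bidegree \<open>(i, s - 1 + 2i)\<close> and \<open>u\<close> for
  \<open>t q\<^sup>2\<close>. The statement follows from two facts.

  First, the homology has the same dimension \<open>a\<^sub>i\<close> in bidegree \<open>(i, s + 1 + 2i)\<close>, so that
  \<open>Kh = q\<^bsup>s - 1\<^esup> (1 + q\<^sup>2) \<Sum>\<^sub>i a\<^sub>i u\<^sup>i\<close>. Over the field with two elements there are
  two chain maps: \<open>X\<close>, multiplication by \<open>x\<close> on the circle through a fixed arc, which lowers the
  \<open>q\<close>-grading by 2, and \<open>N\<close>, which turns one label \<open>x\<close> into \<open>1\<close> in all possible ways and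
  raises the \<open>q\<close>-grading by 2. They satisfy \<open>N X + X N = 1\<close>. When the homology lives on two
  adjacent diagonals, \<open>N\<close> vanishes on the upper and \<open>X\<close> on the lower one, so they are mutually
  inverse between the two diagonals (\<open>dim_KH_thin\<close>).

  Second, \<open>\<Sum>\<^sub>i (-1)\<^sup>i a\<^sub>i = 1\<close>. Since \<open>u\<^sup>i - (-1)\<^sup>i\<close> is a multiple of \<open>1 + u\<close>, this gives
  \<open>\<Sum>\<^sub>i a\<^sub>i u\<^sup>i = 1 + (1 + u) P\<close> for a Laurent polynomial \<open>P\<close> over the integers
  (\<open>ex_quotient_by_1_plus_u\<close>). By the first fact \<open>2 \<Sum>\<^sub>i (-1)\<^sup>i a\<^sub>i\<close> is the Euler
  characteristic of the complex, which is the state sum \<open>\<Sum>\<^sub>\<alpha> (-1)\<^bsup>|\<alpha>| - n\<^sub>-\<^esup> 2\<^bsup>c(\<alpha>)\<^esup>\<close>, where \<open>c(\<alpha>)\<close> is the number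
  of circles. It is the value of the unnormalized Jones polynomial at \<open>q = 1\<close>, which has to be
  shown to be 2 for a knot (\<open>state_sum_knot\<close>). To this end, \<open>2\<^bsup>c(\<alpha>)\<^esup>\<close> is read as the number of
  labellings of the arcs by two labels which are constant on the circles, and the sums over smoothings
  and over labellings are exchanged. For a fixed labelling the sum over the smoothings is a product
  over the crossings, and a factor vanishes unless both strands change their label there. On a knot
  the labellings which alternate in this way along the whole knot are two in number, as the knot
  passes crossings an even number of times, and each of them contributes 1.

  That the boundary map squares to zero, and that it commutes with \<open>X\<close> and \<open>N\<close>, is proved in a
  model of the cube inside a single commutative algebra: the algebra over the field with two elements generated by
  an element \<open>x\<^sub>a\<close> of square zero for every arc \<open>a\<close>. There \<open>V\<^sub>\<alpha>\<close> becomes the set of elements which are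
  annihilated by \<open>x\<^sub>a + x\<^sub>b\<close> for all arcs \<open>a, b\<close> on a common circle, a merge becomes
  multiplication by \<open>x\<^sub>a + x\<^sub>b\<close>, a split becomes an inclusion, \<open>X\<close> becomes multiplication by
  a generator and \<open>N\<close> becomes the derivation sending all generators to 1
  (\<open>lift_boundary\<close>, \<open>lift_mult_x\<close>, \<open>lift_erase_x\<close>). Commutativity of the squares of the cube
  (\<open>edge_map_commute_square\<close>) then is a matter of how the partitions of the arcs into circles are
  related to each other.
\<close>

section \<open>Generated equivalence relations\<close>

text \<open>
  The relation whose classes are formed by \<open>generated_classes\<close>.
\<close>

definition eqv :: "('a \<times> 'a) set \<Rightarrow> ('a \<times> 'a) set" where
  "eqv R = (R \<union> R\<inverse>)\<^sup>*"

text \<open>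
  The relation \<open>E\<close> with the classes of \<open>a\<close> and \<open>b\<close> united.
\<close>

definition glue :: "('a \<times> 'a) set \<Rightarrow> 'a \<Rightarrow> 'a \<Rightarrow> ('a \<times> 'a) set" where
  "glue E a b = E \<union> {(x, y). (x, a) \<in> E \<and> (b, y) \<in> E} \<union> {(x, y). (x, b) \<in> E \<and> (a, y) \<in> E}"

lemma equiv_eqv: "equiv UNIV (eqv R)"
proof (rule equivI)
  show "sym (eqv R)"
    unfolding eqv_def by (intro sym_rtrancl sym_Un_converse)
qed (auto simp: eqv_def refl_rtrancl trans_rtrancl)

lemma eqv_refl [simp]: "(x, x) \<in> eqv R"
  by (simp add: eqv_def)

lemma eqv_sym: "(x, y) \<in> eqv R \<Longrightarrow> (y, x) \<in> eqv R"
  using equiv_eqv[of R] by (meson equiv_def symD)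

lemma eqv_trans: "(x, y) \<in> eqv R \<Longrightarrow> (y, z) \<in> eqv R \<Longrightarrow> (x, z) \<in> eqv R"
  by (auto simp: eqv_def)

lemma eqv_base: "(x, y) \<in> R \<Longrightarrow> (x, y) \<in> eqv R"
  by (auto simp: eqv_def)

lemma eqv_least:
  assumes "R \<subseteq> E" "equiv UNIV E"
  shows "eqv R \<subseteq> E"
proof -
  have "R \<union> R\<inverse> \<subseteq> E" using assms by (auto simp: equiv_def sym_def)
  moreover have "E\<^sup>* = E" using assms by (simp add: equiv_def rtrancl_trancl_reflcl Un_absorb2
        trancl_id refl_on_def subset_iff)
  ultimately show ?thesis unfolding eqv_def by (metis rtrancl_mono)
qed

lemma eqv_mono: "R \<subseteq> S \<Longrightarrow> eqv R \<subseteq> eqv S"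
  by (rule eqv_least) (auto intro: eqv_base equiv_eqv)

lemma equiv_UNIV_refl: "equiv UNIV E \<Longrightarrow> (x, x) \<in> E"
  by (simp add: equiv_def refl_on_def)

lemma equiv_UNIV_sym: "equiv UNIV E \<Longrightarrow> (x, y) \<in> E \<Longrightarrow> (y, x) \<in> E"
  by (meson equiv_def symD)

lemma equiv_UNIV_trans: "equiv UNIV E \<Longrightarrow> (x, y) \<in> E \<Longrightarrow> (y, z) \<in> E \<Longrightarrow> (x, z) \<in> E"
  by (meson equiv_def transD)

lemma equiv_glue:
  assumes "equiv UNIV E"
  shows "equiv UNIV (glue E a b)"
proof -
  note r = equiv_UNIV_refl[OF assms] and s = equiv_UNIV_sym[OF assms] and t = equiv_UNIV_trans[OF assms]
  show ?thesis
  proof (rule equivI)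
    show "sym (glue E a b)" by (rule symI) (auto simp: glue_def intro: s)
    show "trans (glue E a b)"
    proof (rule transI)
      fix x y z assume "(x, y) \<in> glue E a b" "(y, z) \<in> glue E a b"
      then show "(x, z) \<in> glue E a b"
        unfolding glue_def mem_Collect_eq Un_iff case_prod_conv
        by (elim disjE conjE) (blast intro: s t)+
    qed
  qed (use r in \<open>auto simp: refl_on_def glue_def\<close>)
qed

text \<open>
  Adding one generating pair unites two classes, so changes of the circles can be computed one
  joint at a time.
\<close>

lemma eqv_insert: "eqv (insert (a, b) R) = glue (eqv R) a b"
proof
  show "eqv (insert (a, b) R) \<subseteq> glue (eqv R) a b"
    by (rule eqv_least) (auto simp: equiv_glue equiv_eqv, auto simp: glue_def intro: eqv_base)
  have "eqv R \<subseteq> eqv (insert (a, b) R)" by (rule eqv_mono) auto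
  moreover have "(a, b) \<in> eqv (insert (a, b) R)" by (rule eqv_base) auto
  ultimately show "glue (eqv R) a b \<subseteq> eqv (insert (a, b) R)"
    unfolding glue_def by (clarsimp simp: subset_iff) (meson eqv_sym eqv_trans)
qed

lemma glue_same: "equiv UNIV E \<Longrightarrow> (a, b) \<in> E \<Longrightarrow> glue E a b = E"
  unfolding glue_def by (auto intro: equiv_UNIV_trans) (meson equiv_UNIV_sym equiv_UNIV_trans)+

lemma glue_cong:
  assumes "equiv UNIV E" "(a, a') \<in> E" "(b, b') \<in> E"
  shows "glue E a b = glue E a' b'"
proof -
  have "(x, a) \<in> E \<longleftrightarrow> (x, a') \<in> E" "(x, b) \<in> E \<longleftrightarrow> (x, b') \<in> E"
    "(a, x) \<in> E \<longleftrightarrow> (a', x) \<in> E" "(b, x) \<in> E \<longleftrightarrow> (b', x) \<in> E" for x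
    using assms by (meson equiv_UNIV_sym equiv_UNIV_trans)+
  then show ?thesis by (simp add: glue_def)
qed

lemma glue_commute: "glue E a b = glue E b a"
  by (auto simp: glue_def)

text \<open>
  On the level of classes, gluing removes two classes and adds their union. This is the shape in
  which merges and splits enter the definition of the cube maps.
\<close>

lemma quotient_glue:
  assumes E: "equiv UNIV E" and ab: "a \<in> A" "b \<in> A" "(a, b) \<notin> E"
    and closed: "\<And>x y. (x, y) \<in> E \<Longrightarrow> x \<in> A \<longleftrightarrow> y \<in> A"
  shows "A // E - A // glue E a b = {E `` {a}, E `` {b}}" (is ?T1)
    and "A // glue E a b - A // E = {E `` {a} \<union> E `` {b}}" (is ?T2)
    and "E `` {a} \<inter> E `` {b} = {}" (is ?T3)
proof -
  note r = equiv_UNIV_refl[OF E] and s = equiv_UNIV_sym[OF E] and t = equiv_UNIV_trans[OF E]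
  show disj: ?T3 using ab s t by blast
  have cls: "E `` {x} = E `` {y} \<longleftrightarrow> (x, y) \<in> E" for x y
    using r s t by blast
  have g: "glue E a b `` {x} = (if (a, x) \<in> E \<or> (b, x) \<in> E then E `` {a} \<union> E `` {b} else E `` {x})" for x
  proof -
    have *: "(x, y) \<in> E \<longleftrightarrow> (z, y) \<in> E" if "(z, x) \<in> E" for y z
      using that s t by blast
    have "\<not> ((a, x) \<in> E \<and> (b, x) \<in> E)" using ab s t by blast
    moreover have "(x, a) \<in> E \<longleftrightarrow> (a, x) \<in> E" "(x, b) \<in> E \<longleftrightarrow> (b, x) \<in> E" using s by blast+
    ultimately show ?thesis
      by (auto simp: glue_def *[of a] *[of b] Image_def)
  qed
  have Q: "A // glue E a b = (A // E - {E `` {a}, E `` {b}}) \<union> {E `` {a} \<union> E `` {b}}"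
  proof (intro equalityI subsetI)
    fix C assume "C \<in> A // glue E a b"
    then obtain x where x: "x \<in> A" "C = glue E a b `` {x}" by (auto simp: quotient_def)
    show "C \<in> (A // E - {E `` {a}, E `` {b}}) \<union> {E `` {a} \<union> E `` {b}}"
    proof (cases "(a, x) \<in> E \<or> (b, x) \<in> E")
      case False
      then have "C = E `` {x}" "C \<noteq> E `` {a}" "C \<noteq> E `` {b}" using x g cls s by auto
      then show ?thesis using x by (auto simp: quotient_def)
    qed (use x g in auto)
  next
    fix C assume "C \<in> (A // E - {E `` {a}, E `` {b}}) \<union> {E `` {a} \<union> E `` {b}}"
    then consider "C = E `` {a} \<union> E `` {b}" | x where "x \<in> A" "C = E `` {x}" "C \<noteq> E `` {a}" "C \<noteq> E `` {b}"
      by (auto simp: quotient_def)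
    then show "C \<in> A // glue E a b"
    proof cases
      case 1
      then have "C = glue E a b `` {a}" using g[of a] r by simp
      then show ?thesis using ab by (auto simp: quotient_def)
    next
      case 2
      then have "C = glue E a b `` {x}" using g[of x] cls s by auto
      then show ?thesis using 2 by (auto simp: quotient_def)
    qed
  qed
  have "E `` {a} \<union> E `` {b} \<notin> A // E"
  proof
    assume "E `` {a} \<union> E `` {b} \<in> A // E"
    then obtain x where "E `` {a} \<union> E `` {b} = E `` {x}" by (auto simp: quotient_def)
    then have "(x, a) \<in> E" "(x, b) \<in> E" using r by blast+
    then show False using ab s t by blast
  qed
  moreover have "E `` {a} \<in> A // E" "E `` {b} \<in> A // E" using ab by (auto simp: quotient_def)
  ultimately show ?T1 ?T2 unfolding Q by auto
qed

section \<open>Merging, keeping and splitting classes\<close>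

text \<open>
  The class of \<open>a\<close> and \<open>b\<close> under \<open>E\<close> falls into two under \<open>F\<close>: going from \<open>E\<close> to \<open>F\<close>
  is a split, going from \<open>F\<close> to \<open>E\<close> is a merge.
\<close>

definition cuts :: "('a \<times> 'a) set \<Rightarrow> ('a \<times> 'a) set \<Rightarrow> 'a \<Rightarrow> 'a \<Rightarrow> bool" where
  "cuts E F a b \<longleftrightarrow>  (a, b) \<notin> F \<and> E = glue F a b"

text \<open>
  For the circles of smoothings: a merge, no change at all, or a split.
\<close>

definition elementary :: "('a \<times> 'a) set \<Rightarrow> ('a \<times> 'a) set \<Rightarrow> 'a \<Rightarrow> 'a \<Rightarrow> bool" where
  "elementary E F a b \<longleftrightarrow> cuts F E a b \<or> (E = F \<and> (a, b) \<in> E) \<or> cuts E F a b"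

text \<open>
  Think of the ends \<open>a\<^sub>0, ..., a\<^sub>3\<close> of a crossing, connected in pairs by the rest
  of the smoothing. If the rest pairs \<open>0\<close> with \<open>1\<close> and \<open>2\<close> with \<open>3\<close>, the 0-smoothing
  closes two circles which the 1-smoothing unites; for the pairing of \<open>0\<close> with \<open>3\<close> and \<open>1\<close>
  with \<open>2\<close> the roles are exchanged; for the pairing of opposite ends both smoothings unite the
  two strands.
\<close>

lemma elementary_of_matching:
  fixes E :: "('a \<times> 'a) set"
  assumes eq: "equiv UNIV E"
    and matching: "((a0, a1) \<in> E \<and> (a2, a3) \<in> E) \<or> ((a0, a3) \<in> E \<and> (a1, a2) \<in> E)
                 \<or> ((a0, a2) \<in> E \<and> (a1, a3) \<in> E)"
  shows "elementary (glue (glue E a0 a1) a2 a3) (glue (glue E a0 a3) a1 a2) a0 a2"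
proof -
  have s: "\<And>x y. (x, y) \<in> E \<Longrightarrow> (y, x) \<in> E" and r: "\<And>x. (x, x) \<in> E"
    using eq by (auto simp: equiv_def sym_def refl_on_def)
  note eg = equiv_glue[OF eq]
  have in_glue: "(x, y) \<in> glue E x' y'"
    if "(x, x') \<in> E \<and> (y', y) \<in> E \<or> (x, y') \<in> E \<and> (x', y) \<in> E \<or> (x, y) \<in> E" for x y x' y'
    using that by (auto simp: glue_def)
  consider "(a0, a1) \<in> E" "(a2, a3) \<in> E" | "(a0, a3) \<in> E" "(a1, a2) \<in> E"
    | "(a0, a2) \<in> E" "(a1, a3) \<in> E" using matching by blast
  then show ?thesis
  proof cases
    case 1
    have L: "glue (glue E a0 a1) a2 a3 = E" using 1 by (simp add: glue_same eq)
    have "glue E a0 a3 = glue E a0 a2" by (intro glue_cong eq) (use 1 r s in auto)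
    moreover have "(a1, a2) \<in> glue E a0 a2" by (rule in_glue) (use 1 r s in auto)
    ultimately have R: "glue (glue E a0 a3) a1 a2 = glue E a0 a2" by (simp add: glue_same eg)
    show ?thesis unfolding L R elementary_def cuts_def by (metis eq glue_same)
  next
    case 2
    have R: "glue (glue E a0 a3) a1 a2 = E" using 2 by (simp add: glue_same eq)
    have "glue E a0 a1 = glue E a0 a2" by (intro glue_cong eq) (use 2 r s in auto)
    moreover have "(a2, a3) \<in> glue E a0 a2" by (rule in_glue) (use 2 r s in auto)
    ultimately have L: "glue (glue E a0 a1) a2 a3 = glue E a0 a2" by (simp add: glue_same eg)
    show ?thesis unfolding L R elementary_def cuts_def by (metis eq glue_same)
  next
    case 3
    have "glue E a0 a3 = glue E a0 a1" by (intro glue_cong eq) (use 3 r s in auto)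
    moreover have "(a2, a3) \<in> glue E a0 a1" "(a1, a2) \<in> glue E a0 a1"
      by (rule in_glue; use 3 r s in auto)+
    ultimately have "glue (glue E a0 a1) a2 a3 = glue E a0 a1"
      "glue (glue E a0 a3) a1 a2 = glue E a0 a1" by (simp_all add: glue_same eg)
    moreover have "(a0, a2) \<in> glue E a0 a1" by (rule in_glue) (use 3 in auto)
    ultimately show ?thesis unfolding elementary_def by simp
  qed
qed

section \<open>The circles of neighbouring smoothings\<close>

definition smoothing_pairs :: "nat set \<Rightarrow> nat \<Rightarrow> (nat \<times> nat) set" where
  "smoothing_pairs \<alpha> r = (if r \<in> \<alpha> then {(0, 3), (1, 2)} else {(0, 1), (2, 3)})"

definition joined_arcs :: "link_diagram \<Rightarrow> nat set \<Rightarrow> nat set \<Rightarrow> (nat \<times> nat) set" where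
  "joined_arcs D S \<alpha> = {(arc D r p, arc D r p') | r p p'. r \<in> S \<and> (p, p') \<in> smoothing_pairs \<alpha> r}"

definition same_circle :: "link_diagram \<Rightarrow> nat set \<Rightarrow> (nat \<times> nat) set" where
  "same_circle D \<alpha> = eqv (joined_arcs D {..<ncross D} \<alpha>)"

lemma circles_eq: "circles D \<alpha> = arcs D // same_circle D \<alpha>"
proof -
  have "{(arc D r p, arc D r p') | r p p'. r < ncross D \<and>
        (p, p') \<in> (if r \<in> \<alpha> then {(0, 3), (1, 2)} else {(0, 1), (2, 3)})} = joined_arcs D {..<ncross D} \<alpha>"
    by (auto simp: joined_arcs_def smoothing_pairs_def)
  then show ?thesis
    by (simp add: circles_def generated_classes_def same_circle_def eqv_def)
qed

lemma arc_in_arcs: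
  "link_diagram D \<Longrightarrow> r < ncross D \<Longrightarrow> p < 4 \<Longrightarrow> arc D r p \<in> arcs D"
  by (auto simp: link_diagram_def slots_def slot_arc_def image_subset_iff)

lemma smoothing_pairs_less: "(p, p') \<in> smoothing_pairs \<alpha> r \<Longrightarrow> p < 4 \<and> p' < 4"
  by (auto simp: smoothing_pairs_def split: if_splits)

lemma equiv_same_circle: "equiv UNIV (same_circle D \<alpha>)"
  by (simp add: same_circle_def equiv_eqv)

lemma same_circle_arcs:
  assumes "link_diagram D" "(a, b) \<in> same_circle D \<alpha>"
  shows "a \<in> arcs D \<longleftrightarrow> b \<in> arcs D"
proof -
  have "same_circle D \<alpha> \<subseteq> {(a, b). a \<in> arcs D \<longleftrightarrow> b \<in> arcs D}"
    unfolding same_circle_def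
  proof (rule eqv_least)
    show "joined_arcs D {..<ncross D} \<alpha> \<subseteq> {(a, b). (a \<in> arcs D) = (b \<in> arcs D)}"
      using arc_in_arcs[OF assms(1)] smoothing_pairs_less by (fastforce simp: joined_arcs_def)
  qed (auto simp: equiv_def refl_on_def sym_def trans_def)
  with assms(2) show ?thesis by auto
qed

lemma in_out_slots:
  "in_slots D \<union> out_slots D = slots D" "in_slots D \<inter> out_slots D = {}"
  by (auto simp: in_slots_def out_slots_def slots_def split: if_splits)

text \<open>
  Every arc attached to a crossing begins in exactly one out-slot and ends in exactly one
  in-slot, so it has two ends.
\<close>

lemma even_card_slots:
  assumes D: "link_diagram D"
  shows "even (card {x \<in> slots D. slot_arc D x \<in> K})"
proof -
  have fin: "finite (slots D)" by (simp add: slots_def)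
  have inj: "inj_on (slot_arc D) (in_slots D)" "inj_on (slot_arc D) (out_slots D)"
    and im: "slot_arc D ` in_slots D = slot_arc D ` out_slots D"
    using D by (auto simp: link_diagram_def)
  let ?I = "{x \<in> in_slots D. slot_arc D x \<in> K}" and ?O = "{x \<in> out_slots D. slot_arc D x \<in> K}"
  have "card ?I = card (slot_arc D ` ?I)"
    by (rule card_image[symmetric]) (rule inj_on_subset[OF inj(1)], auto)
  also have "slot_arc D ` ?I = slot_arc D ` in_slots D \<inter> K" by auto
  also have "\<dots> = slot_arc D ` ?O" unfolding im by auto
  also have "card \<dots> = card ?O"
    by (rule card_image) (rule inj_on_subset[OF inj(2)], auto)
  finally have "card ?I = card ?O" .
  moreover have "{x \<in> slots D. slot_arc D x \<in> K} = ?I \<union> ?O" "?I \<inter> ?O = {}"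
    using in_out_slots[of D] by auto
  moreover have "finite ?I" "finite ?O"
    using fin in_out_slots[of D] by (auto intro: finite_subset)
  ultimately show ?thesis by (simp add: card_Un_disjoint)
qed

lemma even_card_slots_in:
  fixes arc :: "nat \<Rightarrow> 'a"
  shows "even (card {p. p < 4 \<and> arc p \<in> K})
    \<longleftrightarrow> (arc 0 \<in> K \<longleftrightarrow> arc 1 \<in> K) = (arc 2 \<in> K \<longleftrightarrow> arc 3 \<in> K)"
proof -
  have "{p. p < 4 \<and> arc p \<in> K} = {p \<in> {..<4}. arc p \<in> K}" by auto
  then have "card {p. p < 4 \<and> arc p \<in> K} = (\<Sum>p<4. if arc p \<in> K then 1 else 0)"
    by (simp add: sum.If_cases Int_def)
  also have "\<dots> = of_bool (arc 0 \<in> K) + of_bool (arc 1 \<in> K) + of_bool (arc 2 \<in> K) + of_bool (arc 3 \<in> K)"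
    by (simp add: numeral_eq_Suc)
  finally show ?thesis by auto
qed

text \<open>
  Count the slots with arc in \<open>K\<close>. Their total number is even, and at every crossing other
  than \<open>r\<close> they come in pairs, since the smoothing joins the slots in pairs and \<open>K\<close> respects
  these joints. What remains at \<open>r\<close> is even.
\<close>

lemma even_card_slots_at:
  assumes D: "link_diagram D" and r: "r < ncross D"
    and K: "\<And>a b. (a, b) \<in> joined_arcs D ({..<ncross D} - {r}) \<alpha> \<Longrightarrow> a \<in> K \<longleftrightarrow> b \<in> K"
  shows "even (card {p. p < 4 \<and> arc D r p \<in> K})"
proof -
  let ?at = "\<lambda>r. {p. p < (4::nat) \<and> arc D r p \<in> K}"
  have other: "even (card (?at r'))" if "r' \<in> {..<ncross D} - {r}" for r'
  proof -
    have *: "arc D r' p \<in> K \<longleftrightarrow> arc D r' p' \<in> K" if "(p, p') \<in> smoothing_pairs \<alpha> r'" for p p'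
      by (rule K) (use that \<open>r' \<in> _\<close> in \<open>auto simp: joined_arcs_def\<close>)
    show ?thesis
    proof (cases "r' \<in> \<alpha>")
      case True
      then have "arc D r' 0 \<in> K \<longleftrightarrow> arc D r' 3 \<in> K" "arc D r' 1 \<in> K \<longleftrightarrow> arc D r' 2 \<in> K"
        using * by (auto simp: smoothing_pairs_def)
      then show ?thesis unfolding even_card_slots_in by blast
    next
      case False
      then have "arc D r' 0 \<in> K \<longleftrightarrow> arc D r' 1 \<in> K" "arc D r' 2 \<in> K \<longleftrightarrow> arc D r' 3 \<in> K"
        using * by (auto simp: smoothing_pairs_def)
      then show ?thesis unfolding even_card_slots_in by blast
    qed
  qed
  have "{x \<in> slots D. slot_arc D x \<in> K} = (SIGMA r:{..<ncross D}. ?at r)"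
    by (auto simp: slots_def slot_arc_def)
  then have "even (\<Sum>r<ncross D. card (?at r))"
    using even_card_slots[OF D, of K] by (simp add: card_SigmaI)
  also have "(\<Sum>r<ncross D. card (?at r)) = card (?at r) + (\<Sum>r'\<in>{..<ncross D} - {r}. card (?at r'))"
    using r by (simp add: sum.remove)
  finally show ?thesis
    using other dvd_sum[of "{..<ncross D} - {r}" 2 "\<lambda>r'. card (?at r')"] by (simp add: even_add)
qed

text \<open>
  When crossing \<open>r\<close> is taken out, every class contains an even number of its four slots, so
  these slots are connected in pairs in one of the three possible ways.
\<close>

lemma slot_matching:
  fixes r :: nat and \<alpha> :: "nat set"
  assumes D: "link_diagram D" and r: "r < ncross D"
  defines "E \<equiv> eqv (joined_arcs D ({..<ncross D} - {r}) \<alpha>)"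
  shows "((arc D r 0, arc D r 1) \<in> E \<and> (arc D r 2, arc D r 3) \<in> E)
       \<or> ((arc D r 0, arc D r 3) \<in> E \<and> (arc D r 1, arc D r 2) \<in> E)
       \<or> ((arc D r 0, arc D r 2) \<in> E \<and> (arc D r 1, arc D r 3) \<in> E)"
proof -
  have ev: "even (card {p. p < 4 \<and> arc D r p \<in> E `` {x}})" for x
    by (rule even_card_slots_at[OF D r, of \<alpha>]) (simp add: E_def, meson eqv_base eqv_trans eqv_sym)
  have s: "\<And>x y. (x, y) \<in> E \<Longrightarrow> (y, x) \<in> E" and t: "\<And>x y z. (x, y) \<in> E \<Longrightarrow> (y, z) \<in> E \<Longrightarrow> (x, z) \<in> E"
    and refl: "\<And>x. (x, x) \<in> E"
    unfolding E_def by (rule eqv_sym, assumption, rule eqv_trans, assumption+, simp)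
  have parity: "((x, arc D r 0) \<in> E \<longleftrightarrow> (x, arc D r 1) \<in> E) = ((x, arc D r 2) \<in> E \<longleftrightarrow> (x, arc D r 3) \<in> E)" for x
    using ev[of x] unfolding even_card_slots_in by simp
  show ?thesis
  proof (cases "(arc D r 0, arc D r 1) \<in> E")
    case True
    then show ?thesis using parity[of "arc D r 2"] refl s t by metis
  next
    case False
    then have "(arc D r 0, arc D r 2) \<in> E \<longleftrightarrow> (arc D r 0, arc D r 3) \<notin> E"
      using parity[of "arc D r 0"] refl by blast
    then show ?thesis using False parity[of "arc D r 1"] refl s t by metis
  qed
qed

lemma joined_arcs_remove:
  assumes "r < ncross D"
  shows "joined_arcs D {..<ncross D} \<alpha> = (if r \<in> \<alpha>
    then insert (arc D r 1, arc D r 2) (insert (arc D r 0, arc D r 3) (joined_arcs D ({..<ncross D} - {r}) \<alpha>))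
    else insert (arc D r 2, arc D r 3) (insert (arc D r 0, arc D r 1) (joined_arcs D ({..<ncross D} - {r}) \<alpha>)))"
  using assms by (auto simp: joined_arcs_def smoothing_pairs_def split: if_splits)

text \<open>
  Slots 0 and 2 are joined to each other by neither smoothing of the crossing, and each of the
  two smoothings joins slot 0 with one of the remaining slots and slot 2 with the other. Hence
  their arcs tell apart the two circles involved, both before a merge and after a split.
\<close>

proposition edge_elementary:
  assumes D: "link_diagram D" and r: "r < ncross D" "r \<notin> \<alpha>"
  shows "elementary (same_circle D \<alpha>) (same_circle D (insert r \<alpha>)) (arc D r 0) (arc D r 2)"
proof -
  let ?J = "joined_arcs D ({..<ncross D} - {r}) \<alpha>"
  have J: "joined_arcs D ({..<ncross D} - {r}) (insert r \<alpha>) = ?J"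
    by (auto simp: joined_arcs_def smoothing_pairs_def split: if_splits)
  show ?thesis
    using elementary_of_matching[OF equiv_eqv slot_matching[OF D r(1), of \<alpha>]] r
    by (simp add: same_circle_def joined_arcs_remove[OF r(1)] J eqv_insert)
qed


section \<open>A commutative algebra on the arcs\<close>

type_synonym arc_fun = "nat set \<Rightarrow> bit"

text \<open>
  A function \<open>\<Phi>\<close> on sets of arcs stands for the element of the algebra generated by the
  square-zero elements \<open>x\<^sub>a\<close> whose coefficient at the product of all \<open>x\<^sub>a\<close> with
  \<open>a \<notin> U\<close> is \<open>\<Phi> U\<close>. Then \<open>contr a\<close> is multiplication by \<open>x\<^sub>a\<close>.
\<close>

definition contr :: "nat \<Rightarrow> arc_fun \<Rightarrow> arc_fun" where
  "contr a \<Phi> U = (if a \<in> U then 0 else \<Phi> (insert a U))"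

text \<open>
  The derivation sending every generator \<open>x\<^sub>a\<close> to 1.
\<close>

definition erase :: "arc_fun \<Rightarrow> arc_fun" where
  "erase \<Phi> U = (\<Sum>u\<in>U. \<Phi> (U - {u}))"

text \<open>
  Multiplication by \<open>x\<^sub>a + x\<^sub>b\<close> for a merge, inclusion for a split. When the
  circles stay the same, \<open>x\<^sub>a + x\<^sub>b\<close> acts as zero, which is the prescribed map.
\<close>

definition edge_map :: "(nat \<times> nat) set \<Rightarrow> nat \<Rightarrow> nat \<Rightarrow> arc_fun \<Rightarrow> arc_fun" where
  "edge_map F a b \<Phi> U = (if (a, b) \<in> F then contr a \<Phi> U + contr b \<Phi> U else \<Phi> U)"

text \<open>
  Annihilation by \<open>x\<^sub>a + x\<^sub>b\<close> whenever \<open>a\<close> and \<open>b\<close> lie on the same circle. The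
  annihilator of these elements is a copy of the algebra modulo the relations \<open>x\<^sub>a =
  x\<^sub>b\<close>, which is the tensor power of \<open>A\<close> over the circles.
\<close>

definition balanced :: "(nat \<times> nat) set \<Rightarrow> arc_fun \<Rightarrow> bool" where
  "balanced E \<Phi> \<longleftrightarrow> (\<forall>(a, b) \<in> E. contr a \<Phi> = contr b \<Phi>)"

text \<open>
  These rules replace the ring operations on \<open>bit\<close> by bit operations, which hides sums and products
  from the general rules for rings.
\<close>

declare add_bit_eq_xor [simp del] mult_bit_eq_and [simp del]

lemma bit_double [simp]: "(x::bit) + x = 0"
  by (cases x) simp_all

lemma bit_cancel: "((x::bit) + y) + (x + z) = y + z"
  by (cases x) (simp_all add: ac_simps)

lemma contr_commute: "contr a (contr b \<Phi>) = contr b (contr a \<Phi>)"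
  by (auto simp: contr_def fun_eq_iff insert_commute)

lemma contr_add: "contr a (\<lambda>U. \<Phi> U + \<Psi> U) = (\<lambda>U. contr a \<Phi> U + contr a \<Psi> U)"
  by (auto simp: contr_def fun_eq_iff)

lemma contr_zero: "contr a (\<lambda>U. 0) = (\<lambda>U. 0)"
  by (auto simp: contr_def fun_eq_iff)

text \<open>
  The product rule for the derivation applied to \<open>x\<^sub>a \<Phi>\<close>, with signs immaterial.
\<close>

lemma contr_erase:
  assumes "finite U"
  shows "contr a (erase \<Phi>) U = \<Phi> U + erase (contr a \<Phi>) U"
proof (cases "a \<in> U")
  case True
  have "erase (contr a \<Phi>) U = (\<Sum>u\<in>U. if u = a then \<Phi> U else 0)"
    unfolding erase_def by (rule sum.cong) (auto simp: contr_def insert_absorb True)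
  then show ?thesis using True assms by (simp add: contr_def)
next
  case False
  have "contr a (erase \<Phi>) U = \<Phi> U + (\<Sum>u\<in>U. \<Phi> (insert a U - {u}))"
    using False assms by (simp add: contr_def erase_def)
  also have "(\<Sum>u\<in>U. \<Phi> (insert a U - {u})) = erase (contr a \<Phi>) U"
    unfolding erase_def by (rule sum.cong) (use False in \<open>auto simp: contr_def insert_Diff_if\<close>)
  finally show ?thesis .
qed

lemma erase_add: "erase (\<lambda>U. \<Phi> U + \<Psi> U) = (\<lambda>U. erase \<Phi> U + erase \<Psi> U)"
  by (simp add: erase_def fun_eq_iff sum.distrib)

text \<open>
  The derivation kills \<open>x\<^sub>a + x\<^sub>b\<close>, hence commutes with multiplication by it.
\<close>

lemma edge_map_erase:
  assumes "finite U"
  shows "edge_map F a b (erase \<Phi>) U = erase (edge_map F a b \<Phi>) U"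
proof (cases "(a, b) \<in> F")
  case True
  then have "edge_map F a b \<Phi> = (\<lambda>U. contr a \<Phi> U + contr b \<Phi> U)"
    by (simp add: edge_map_def fun_eq_iff)
  then show ?thesis using True contr_erase[OF assms]
    by (simp add: edge_map_def erase_add bit_cancel)
qed (simp add: edge_map_def erase_def)

lemma edge_map_contr: "edge_map F a b (contr p \<Phi>) = contr p (edge_map F a b \<Phi>)"
  unfolding fun_eq_iff
proof
  fix U
  show "edge_map F a b (contr p \<Phi>) U = contr p (edge_map F a b \<Phi>) U"
    by (simp add: edge_map_def contr_commute[of _ p]) (simp add: contr_def edge_map_def)
qed

lemma edge_map_add: "edge_map F a b (\<lambda>U. \<Phi> U + \<Psi> U) = (\<lambda>U. edge_map F a b \<Phi> U + edge_map F a b \<Psi> U)"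
  by (simp add: edge_map_def contr_add fun_eq_iff ac_simps)

lemma edge_map_zero: "edge_map F a b (\<lambda>U. 0) = (\<lambda>U. 0)"
  by (simp add: edge_map_def contr_zero fun_eq_iff)

lemma edge_map_sum: "edge_map F a b (\<lambda>U. \<Sum>i\<in>I. \<Phi> i U) = (\<lambda>U. \<Sum>i\<in>I. edge_map F a b (\<Phi> i) U)"
  by (induction I rule: infinite_finite_induct) (simp_all add: edge_map_zero edge_map_add)

text \<open>
  Both composites multiply by those of the factors \<open>x\<^sub>a + x\<^sub>b\<close> and \<open>x\<^sub>c +
  x\<^sub>d\<close> whose edge is not a split. So only squares matter in which the two paths have
  different splits. In these, either the two factors agree on \<open>\<Phi>\<close>, as both merges unite
  the same two circles, or each side contains a factor that annihilates \<open>\<Phi>\<close>, since its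
  two arcs lie on one circle from the start. Which combinations of merges and splits can occur
  is decided by comparing the four relations.
\<close>

lemma edge_map_commute_square:
  assumes eq: "equiv UNIV E00" "equiv UNIV E10" "equiv UNIV E01" "equiv UNIV E11"
    and e1: "elementary E00 E10 a b" and e2: "elementary E00 E01 c d"
    and e3: "elementary E10 E11 c d" and e4: "elementary E01 E11 a b"
    and bal: "balanced E00 \<Phi>"
  shows "edge_map E11 c d (edge_map E10 a b \<Phi>) = edge_map E11 a b (edge_map E01 c d \<Phi>)"
proof -
  have split: "edge_map F x y \<Psi> = \<Psi>" if "(x, y) \<notin> F" for F x y \<Psi>
    using that by (simp add: edge_map_def fun_eq_iff)
  have merge: "edge_map F x y \<Psi> = (\<lambda>U. contr x \<Psi> U + contr y \<Psi> U)" if "(x, y) \<in> F" for F x y \<Psi>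
    using that by (simp add: edge_map_def fun_eq_iff)
  have bal': "contr x \<Phi> = contr y \<Phi>" if "(x, y) \<in> E00" for x y
    using bal that by (auto simp: balanced_def)
  have null: "edge_map F x y \<Phi> = (\<lambda>U. 0)" if "(x, y) \<in> E00" "(x, y) \<in> F" for F x y
    using merge[OF that(2)] bal'[OF that(1)] by simp
  have gl: "(x, y) \<in> glue E x y" if "equiv UNIV E" for E :: "(nat \<times> nat) set" and x y
    using equiv_UNIV_refl[OF that] by (auto simp: glue_def)
  note glues = eq[THEN gl]
  have swap: "glue E x y = glue E z w" if eqE: "equiv UNIV E" and zw: "(z, w) \<in> glue E x y" "(z, w) \<notin> E"
    for E :: "(nat \<times> nat) set" and x y z w
  proof -
    consider "(z, x) \<in> E" "(y, w) \<in> E" | "(z, y) \<in> E" "(x, w) \<in> E"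
      using zw by (auto simp: glue_def)
    then show ?thesis
      by cases (metis eqE equiv_UNIV_sym glue_cong glue_commute)+
  qed
  have sub: "E \<subseteq> glue E x y" for E :: "(nat \<times> nat) set" and x y
    by (auto simp: glue_def)
  have both: ?thesis if "(a, b) \<in> E10" "(c, d) \<in> E01" "(a, b) \<in> E11" "(c, d) \<in> E11"
    unfolding merge[OF that(1)] merge[OF that(2)] merge[OF that(3)] merge[OF that(4)] contr_add
    by (simp add: fun_eq_iff contr_commute[of c a] contr_commute[of c b] contr_commute[of d a] contr_commute[of d b] ac_simps)
  show ?thesis
  proof (cases "(a, b) \<in> E00"; cases "(c, d) \<in> E00")
    assume ab: "(a, b) \<notin> E00" and cd: "(c, d) \<notin> E00"
    then have E: "E10 = glue E00 a b" "E01 = glue E00 c d"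
      using e1 e2 gl eq by (auto simp: elementary_def cuts_def)
    then have i: "(a, b) \<in> E10" "(c, d) \<in> E01" using gl eq by auto
    show ?thesis
    proof (cases "(c, d) \<in> E10")
      case True
      \<comment> \<open>The two merges unite the same two circles, so \<open>a, b\<close> and \<open>c, d\<close> lie on these in some order.\<close>
      then have same: "E10 = E01" using swap[OF eq(1) _ cd, of a b] E by simp
      show ?thesis
      proof (cases "(c, d) \<in> E11")
        case True
        then have "E11 = E10" using e3 \<open>(c, d) \<in> E10\<close> by (auto simp: elementary_def cuts_def)
        then show ?thesis using both i True by simp
      next
        case False
        have ab11: "(a, b) \<notin> E11"
        proof
          assume "(a, b) \<in> E11"
          then have "E11 = E01" using e4 i(1) same by (auto simp: elementary_def cuts_def)
          then show False using False i by simp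
        qed
        have "(c, a) \<in> E00 \<and> (b, d) \<in> E00 \<or> (c, b) \<in> E00 \<and> (a, d) \<in> E00"
          using True cd unfolding E glue_def by auto
        then have "contr a \<Phi> = contr c \<Phi> \<and> contr b \<Phi> = contr d \<Phi> \<or> contr a \<Phi> = contr d \<Phi> \<and> contr b \<Phi> = contr c \<Phi>"
          using bal' by metis
        then show ?thesis
          unfolding split[OF False] split[OF ab11] merge[OF i(1)] merge[OF i(2)] by (auto simp: add.commute)
      qed
    next
      case False
      then have E11: "E11 = glue E10 c d" using e3 gl eq by (auto simp: elementary_def cuts_def)
      then have "(c, d) \<in> E11" "(a, b) \<in> E11" using gl eq i by (auto simp: glue_def)
      then show ?thesis using both i by simp
    qed
  next
    assume ab: "(a, b) \<notin> E00" and cd: "(c, d) \<in> E00"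
    then have E10: "E10 = glue E00 a b" using e1 using glues by (auto simp: elementary_def cuts_def)
    have in10: "(a, b) \<in> E10" unfolding E10 by (rule gl[OF eq(1)])
    show ?thesis
    proof (cases "(c, d) \<in> E01")
      case True
      then have "E01 = E00" using e2 cd using glues by (auto simp: elementary_def cuts_def)
      moreover from this have "E11 = E10" using e4 ab E10 using glues by (auto simp: elementary_def cuts_def)
      ultimately show ?thesis using both in10 True sub cd E10 by auto
    next
      case False
      then have E00: "E00 = glue E01 c d" using e2 cd using glues by (auto simp: elementary_def cuts_def)
      then have "(a, b) \<notin> E01" using ab sub by auto
      then have E11: "E11 = glue E01 a b" using e4 using glues by (auto simp: elementary_def cuts_def)
      have in11: "(a, b) \<in> E11" unfolding E11 by (rule gl[OF eq(3)])
      \<comment> \<open>Otherwise \<open>c, d\<close> and \<open>a, b\<close> would join the same classes of \<open>E01\<close>, so \<open>a, b\<close> would be related in \<open>E00\<close>.\<close>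
      have "(c, d) \<notin> E11"
        using swap[OF eq(3) _ False, of a b] in11 ab E11 E00 by auto
      then show ?thesis
        unfolding split[OF False] split[OF \<open>(c, d) \<notin> E11\<close>] merge[OF in10] merge[OF in11] by simp
    qed
  next
    assume ab: "(a, b) \<in> E00" and cd: "(c, d) \<notin> E00"
    then have E01: "E01 = glue E00 c d" using e2 using glues by (auto simp: elementary_def cuts_def)
    have in01: "(c, d) \<in> E01" unfolding E01 by (rule gl[OF eq(1)])
    show ?thesis
    proof (cases "(a, b) \<in> E10")
      case True
      then have "E10 = E00" using e1 ab using glues by (auto simp: elementary_def cuts_def)
      moreover from this have "E11 = E01" using e3 cd E01 using glues by (auto simp: elementary_def cuts_def)
      ultimately show ?thesis using both in01 True sub ab E01 by auto
    next
      case False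
      then have E00: "E00 = glue E10 a b" using e1 ab using glues by (auto simp: elementary_def cuts_def)
      then have "(c, d) \<notin> E10" using cd sub by auto
      then have E11: "E11 = glue E10 c d" using e3 using glues by (auto simp: elementary_def cuts_def)
      have in11: "(c, d) \<in> E11" unfolding E11 by (rule gl[OF eq(2)])
      have "(a, b) \<notin> E11"
        using swap[OF eq(2) _ False, of c d] in11 cd E11 E00 by auto
      then show ?thesis
        unfolding split[OF False] split[OF \<open>(a, b) \<notin> E11\<close>] merge[OF in01] merge[OF in11] by simp
    qed
  next
    assume ab: "(a, b) \<in> E00" and cd: "(c, d) \<in> E00"
    have cut3: "E10 = glue E11 c d" if "(c, d) \<notin> E11"
      using that e3 gl[OF eq(2)] using glues by (auto simp: elementary_def cuts_def)
    have cut4: "E01 = glue E11 a b" if "(a, b) \<notin> E11"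
      using that e4 gl[OF eq(3)] using glues by (auto simp: elementary_def cuts_def)
    show ?thesis
    proof (cases "(a, b) \<in> E10"; cases "(c, d) \<in> E01")
      assume "(a, b) \<in> E10" "(c, d) \<in> E01"
      then show ?thesis using ab cd by (simp add: null edge_map_zero)
    next
      assume in10: "(a, b) \<in> E10" and ni: "(c, d) \<notin> E01"
      have "E10 = E00" using e1 ab in10 using glues by (auto simp: elementary_def cuts_def)
      have "(a, b) \<in> E11"
      proof (rule ccontr)
        assume n11: "(a, b) \<notin> E11"
        have "(c, d) \<notin> E11" using ni sub cut4[OF n11] by auto
        then have "E10 = glue E11 c d" by (rule cut3)
        then show False using swap[OF eq(4) _ n11, of c d] in10 cut4[OF n11] ni gl[OF eq(4)] by auto
      qed
      then show ?thesis
        using ab cd in10 split[OF ni] by (simp add: null edge_map_zero)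
    next
      assume ni: "(a, b) \<notin> E10" and in01: "(c, d) \<in> E01"
      have "(c, d) \<in> E11"
      proof (rule ccontr)
        assume n11: "(c, d) \<notin> E11"
        have "(a, b) \<notin> E11" using ni sub cut3[OF n11] by auto
        then have "E01 = glue E11 a b" by (rule cut4)
        then show False using swap[OF eq(4) _ n11, of a b] in01 cut3[OF n11] ni gl[OF eq(4)] by auto
      qed
      then show ?thesis
        using ab cd in01 split[OF ni] by (simp add: null edge_map_zero)
    next
      assume n: "(a, b) \<notin> E10" "(c, d) \<notin> E01"
      show ?thesis
      proof (cases "(c, d) \<in> E11")
        case True
        then have "(a, b) \<in> E11" using cut4 n(2) sub by auto
        then show ?thesis using True ab cd by (simp add: split n null)
      next
        case False
        then have "(a, b) \<notin> E11" using cut3 n(1) sub by auto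
        then show ?thesis using False by (simp add: split n)
      qed
    qed
  qed
qed


section \<open>Chains as functions on sets of arcs\<close>

definition one_per_circle :: "link_diagram \<Rightarrow> nat set \<Rightarrow> nat set \<Rightarrow> bool" where
  "one_per_circle D \<alpha> U \<longleftrightarrow> U \<subseteq> arcs D \<and> (\<forall>a\<in>U. \<forall>b\<in>U. (a, b) \<in> same_circle D \<alpha> \<longrightarrow> a = b)"

text \<open>
  Sets of arcs serve as names of basis vectors. Several sets name the same one.
\<close>

definition labelling :: "link_diagram \<Rightarrow> nat set \<Rightarrow> nat set \<Rightarrow> nat set \<Rightarrow> label" where
  "labelling D \<alpha> U = (\<lambda>C\<in>circles D \<alpha>. if C \<inter> U = {} then LX else L1)"

text \<open>
  The element of the algebra that represents the component of \<open>c\<close> at \<open>\<alpha>\<close>. A basis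
  vector \<open>v\<close> is represented by the product over all circles of \<open>\<Prod>\<^sub>a x\<^sub>a\<close>
  for a circle labelled \<open>x\<close> and of \<open>\<Sum>\<^sub>b \<Prod>\<^bsub>a \<noteq> b\<^esub>
  x\<^sub>a\<close> for a circle labelled \<open>1\<close>, with \<open>a, b\<close> ranging over the arcs of the circle.
  Its monomials omit one arc of every circle labelled \<open>1\<close> and no other arc.
\<close>

definition lift :: "link_diagram \<Rightarrow> chain \<Rightarrow> nat set \<Rightarrow> arc_fun" where
  "lift D c \<alpha> U = (if one_per_circle D \<alpha> U then c (\<alpha>, labelling D \<alpha> U) else 0)"

lemma labelling_PiE: "labelling D \<alpha> U \<in> circles D \<alpha> \<rightarrow>\<^sub>E UNIV"
  by (auto simp: labelling_def)

lemma circle_closed: "C \<in> circles D \<alpha> \<Longrightarrow> (a, b) \<in> same_circle D \<alpha> \<Longrightarrow> a \<in> C \<longleftrightarrow> b \<in> C"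
  unfolding circles_eq quotient_def
  using equiv_UNIV_sym[OF equiv_same_circle] equiv_UNIV_trans[OF equiv_same_circle] by fast

lemma circle_connected: "C \<in> circles D \<alpha> \<Longrightarrow> a \<in> C \<Longrightarrow> b \<in> C \<Longrightarrow> (a, b) \<in> same_circle D \<alpha>"
  unfolding circles_eq quotient_def
  using equiv_UNIV_sym[OF equiv_same_circle] equiv_UNIV_trans[OF equiv_same_circle] by fast

lemma circle_of_arc: "a \<in> arcs D \<Longrightarrow> same_circle D \<alpha> `` {a} \<in> circles D \<alpha>"
  unfolding circles_eq by (rule quotientI)

lemma circle_nonempty: "C \<in> circles D \<alpha> \<Longrightarrow> C \<noteq> {}"
  unfolding circles_eq using equiv_UNIV_refl[OF equiv_same_circle] by (fastforce simp: quotient_def)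

lemma circle_subset_arcs: "link_diagram D \<Longrightarrow> C \<in> circles D \<alpha> \<Longrightarrow> C \<subseteq> arcs D"
  unfolding circles_eq quotient_def using same_circle_arcs by blast

lemma finite_circles: "link_diagram D \<Longrightarrow> finite (circles D \<alpha>)"
  unfolding circles_eq by (simp add: quotient_def link_diagram_def)

lemma circles_eq_class: "C \<in> circles D \<alpha> \<Longrightarrow> a \<in> C \<Longrightarrow> C = same_circle D \<alpha> `` {a}"
  using circle_closed circle_connected by (metis Image_singleton_iff equalityI subsetI)

text \<open>
  A set \<open>U\<close> can be moved along the circles without changing the labelling which it names.
\<close>

lemma balanced_lift:
  assumes D: "link_diagram D"
  shows "balanced (same_circle D \<alpha>) (lift D c \<alpha>)"
proof -
  note r = equiv_UNIV_refl[OF equiv_same_circle] and s = equiv_UNIV_sym[OF equiv_same_circle]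
    and t = equiv_UNIV_trans[OF equiv_same_circle]
  \<comment> \<open>A set with two arcs of the same circle names nothing.\<close>
  have zero: "contr a (lift D c \<alpha>) U = 0" if "(a, b) \<in> same_circle D \<alpha>" "b \<in> U" for a b U
  proof (cases "a \<in> U")
    case False
    then have "\<not> one_per_circle D \<alpha> (insert a U)" using that by (auto simp: one_per_circle_def)
    then show ?thesis by (simp add: contr_def lift_def)
  qed (simp add: contr_def)
  have "contr a (lift D c \<alpha>) U = contr b (lift D c \<alpha>) U" if ab: "(a, b) \<in> same_circle D \<alpha>" for a b U
  proof (cases "a \<in> U \<or> b \<in> U")
    case True
    then show ?thesis using zero[OF ab] zero[OF s[OF ab]] zero[OF r] by metis
  next
    case False
    have "one_per_circle D \<alpha> (insert x U) \<Longrightarrow> one_per_circle D \<alpha> (insert y U)"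
      if xy: "(x, y) \<in> same_circle D \<alpha>" and x: "x \<notin> U" for x y
    proof -
      assume L: "one_per_circle D \<alpha> (insert x U)"
      have "(y, u) \<notin> same_circle D \<alpha> \<and> (u, y) \<notin> same_circle D \<alpha>" if "u \<in> U" for u
        using L x that t[OF xy, of u] t[OF _ s[OF xy], of u] by (auto simp: one_per_circle_def)
      then show "one_per_circle D \<alpha> (insert y U)"
        using L same_circle_arcs[OF D xy] by (auto simp: one_per_circle_def)
    qed
    then have "one_per_circle D \<alpha> (insert a U) = one_per_circle D \<alpha> (insert b U)"
      using ab s False by blast
    moreover have "labelling D \<alpha> (insert a U) = labelling D \<alpha> (insert b U)"
      unfolding labelling_def using circle_closed[OF _ ab] by (intro restrict_ext) auto
    ultimately show ?thesis using False by (simp add: contr_def lift_def)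
  qed
  then show ?thesis by (auto simp: balanced_def fun_eq_iff)
qed

lemma mbar_eq_1: "mbar x y z = 1 \<longleftrightarrow> (if z = L1 then x = L1 \<and> y = L1 else x \<noteq> y)"
  by (cases x; cases y; cases z) (auto simp: basis_vec_def)

lemma Deltabar_eq_1: "Deltabar x y z = 1 \<longleftrightarrow> (if x = L1 then y \<noteq> z else y = LX \<and> z = LX)"
  by (cases x; cases y; cases z) (auto simp: basis_vec_def)

lemma edge_coeff_merge:
  assumes "circles D \<alpha> - circles D \<alpha>' = {A, B}" "circles D \<alpha>' - circles D \<alpha> = {C}" "A \<noteq> B"
  shows "edge_coeff D \<alpha> \<alpha>' v v' = of_bool ((\<forall>C \<in> circles D \<alpha> \<inter> circles D \<alpha>'. v C = v' C) \<and> mbar (v A) (v B) (v' C) = 1)"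
proof -
  have "(\<exists>a b c. a \<noteq> b \<and> {A, B} = {a, b} \<and> {C} = {c} \<and> mbar (v a) (v b) (v' c) = 1)
      \<longleftrightarrow> mbar (v A) (v B) (v' C) = 1"
    using assms(3) by (auto simp: doubleton_eq_iff mbar_eq_1)
  moreover have "\<not> (\<exists>a b c. a \<noteq> b \<and> {A, B} = {c} \<and> {C} = {a, b} \<and> Deltabar (v c) (v' a) (v' b) = 1)"
    using assms(3) by auto
  ultimately show ?thesis unfolding edge_coeff_def assms(1,2) by simp
qed

lemma edge_coeff_split:
  assumes "circles D \<alpha>' - circles D \<alpha> = {A, B}" "circles D \<alpha> - circles D \<alpha>' = {C}" "A \<noteq> B"
  shows "edge_coeff D \<alpha> \<alpha>' v v' = of_bool ((\<forall>C \<in> circles D \<alpha> \<inter> circles D \<alpha>'. v C = v' C) \<and> Deltabar (v C) (v' A) (v' B) = 1)"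
proof -
  have "(\<exists>a b c. a \<noteq> b \<and> {C} = {c} \<and> {A, B} = {a, b} \<and> Deltabar (v c) (v' a) (v' b) = 1)
      \<longleftrightarrow> Deltabar (v C) (v' A) (v' B) = 1"
    using assms(3) by (auto simp: doubleton_eq_iff Deltabar_eq_1)
  moreover have "\<not> (\<exists>a b c. a \<noteq> b \<and> {C} = {a, b} \<and> {A, B} = {c} \<and> mbar (v a) (v b) (v' c) = 1)"
    using assms(3) by auto
  ultimately show ?thesis unfolding edge_coeff_def assms(1,2) by simp
qed

lemma edge_coeff_same:
  assumes "circles D \<alpha> = circles D \<alpha>'"
  shows "edge_coeff D \<alpha> \<alpha>' v v' = 0"
  by (simp add: edge_coeff_def assms)


text \<open>
  Enlarging \<open>U\<close> by \<open>a\<close> is possible if the circle of \<open>a\<close> is not met by \<open>U\<close>, that is,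
  labelled \<open>x\<close>, and it turns the label of this circle into \<open>1\<close>.
\<close>

lemma labelling_contr_eq:
  assumes a: "a \<in> arcs D" and v: "v \<in> circles D \<alpha> \<rightarrow>\<^sub>E UNIV"
    and one: "one_per_circle D \<alpha> U"
  shows "a \<notin> U \<and> one_per_circle D \<alpha> (insert a U) \<and> v = labelling D \<alpha> (insert a U)
    \<longleftrightarrow> same_circle D \<alpha> `` {a} \<inter> U = {} \<and> v (same_circle D \<alpha> `` {a}) = L1
      \<and> (\<forall>C \<in> circles D \<alpha> - {same_circle D \<alpha> `` {a}}. v C = (if C \<inter> U = {} then LX else L1))"
proof -
  let ?A = "same_circle D \<alpha> `` {a}"
  note r = equiv_UNIV_refl[OF equiv_same_circle, of _ D \<alpha>]
    and s = equiv_UNIV_sym[OF equiv_same_circle, of _ _ D \<alpha>]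
  have "a \<notin> U \<and> one_per_circle D \<alpha> (insert a U) \<longleftrightarrow> ?A \<inter> U = {}"
    using one a r s unfolding one_per_circle_def by blast
  moreover have "v = labelling D \<alpha> (insert a U) \<longleftrightarrow>
     v ?A = L1 \<and> (\<forall>C \<in> circles D \<alpha> - {?A}. v C = (if C \<inter> U = {} then LX else L1))"
  proof -
    have "v = labelling D \<alpha> (insert a U) \<longleftrightarrow> (\<forall>C\<in>circles D \<alpha>. v C = (if C \<inter> insert a U = {} then LX else L1))"
    proof
      assume "\<forall>C\<in>circles D \<alpha>. v C = (if C \<inter> insert a U = {} then LX else L1)"
      then show "v = labelling D \<alpha> (insert a U)"
        by (intro PiE_ext[OF v labelling_PiE]) (simp add: labelling_def)
    qed (simp add: labelling_def)
    also have "\<dots> \<longleftrightarrow> (\<forall>C\<in>circles D \<alpha>. v C = (if C = ?A then L1 else if C \<inter> U = {} then LX else L1))"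
    proof (rule ball_cong[OF refl])
      fix C assume C: "C \<in> circles D \<alpha>"
      have "a \<in> C \<longleftrightarrow> C = ?A" using circles_eq_class[OF C] r by auto
      then show "v C = (if C \<inter> insert a U = {} then LX else L1)
          \<longleftrightarrow> v C = (if C = ?A then L1 else if C \<inter> U = {} then LX else L1)"
        by auto
    qed
    also have "\<dots> \<longleftrightarrow> v ?A = L1 \<and> (\<forall>C \<in> circles D \<alpha> - {?A}. v C = (if C \<inter> U = {} then LX else L1))"
    proof -
      have pick: "(\<forall>C\<in>S. v C = (if C = A then L1 else f C)) \<longleftrightarrow> v A = L1 \<and> (\<forall>C\<in>S - {A}. v C = f C)"
        if "A \<in> S" for A S f
      proof (intro iffI conjI ballI)
        assume all: "\<forall>C\<in>S. v C = (if C = A then L1 else f C)"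
        show "v A = L1" using bspec[OF all that] by simp
        fix C assume "C \<in> S - {A}"
        then show "v C = f C" using bspec[OF all, of C] by simp
      next
        fix C assume h: "v A = L1 \<and> (\<forall>C\<in>S - {A}. v C = f C)" and C: "C \<in> S"
        show "v C = (if C = A then L1 else f C)"
          by (cases "C = A") (use h C in simp_all)
      qed
      show ?thesis by (rule pick[OF circle_of_arc[OF a]])
    qed
    finally show ?thesis .
  qed
  ultimately show ?thesis by blast
qed

lemma UNIV_label: "UNIV = {L1, LX}"
  using label.exhaust by auto

lemma sum_PiE_single:
  assumes "finite P" "w \<in> P \<rightarrow>\<^sub>E (UNIV::label set)"
  shows "(\<Sum>v \<in> P \<rightarrow>\<^sub>E UNIV. f v * of_bool (Q \<and> v = w)) = (if Q then f w else (0::bit))"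
proof -
  have "finite (P \<rightarrow>\<^sub>E (UNIV::label set))"
    using assms(1) by (rule finite_PiE) (simp add: UNIV_label)
  moreover have "(\<Sum>v \<in> P \<rightarrow>\<^sub>E UNIV. f v * of_bool (Q \<and> v = w)) = (\<Sum>v \<in> P \<rightarrow>\<^sub>E UNIV. if w = v then (if Q then f w else 0) else 0)"
    by (rule sum.cong) auto
  ultimately show ?thesis using assms(2) by simp
qed


lemma one_per_circle_mono:
  "one_per_circle D \<alpha>' U \<Longrightarrow> same_circle D \<alpha> \<subseteq> same_circle D \<alpha>' \<Longrightarrow> one_per_circle D \<alpha> U"
  by (auto simp: one_per_circle_def)

text \<open>
  Compare coefficients at a set \<open>U\<close> naming a labelling after the merge. If the united circle
  is labelled \<open>x\<close>, the contributing labellings are \<open>(1, x)\<close> and \<open>(x, 1)\<close>, named by \<open>U\<close>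
  with \<open>a\<close> or with \<open>b\<close> added. If it is labelled \<open>1\<close>, the only one is \<open>(1, 1)\<close>; one of
  the two circles is met by \<open>U\<close> already, so that only the arc on the other circle can be
  added. All other sets \<open>U\<close> give zero on both sides.
\<close>

lemma edge_lift_merge:
  assumes D: "link_diagram D" and a: "a \<in> arcs D" and b: "b \<in> arcs D"
    and cut: "cuts (same_circle D \<alpha>') (same_circle D \<alpha>) a b"
  shows "(if one_per_circle D \<alpha>' U
      then \<Sum>v \<in> circles D \<alpha> \<rightarrow>\<^sub>E UNIV. c (\<alpha>, v) * edge_coeff D \<alpha> \<alpha>' v (labelling D \<alpha>' U) else 0)
    = contr a (lift D c \<alpha>) U + contr b (lift D c \<alpha>) U"
proof -
  let ?E = "same_circle D \<alpha>" and ?E' = "same_circle D \<alpha>'"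
  define A B where "A = ?E `` {a}" and "B = ?E `` {b}"
  have ab: "(a, b) \<notin> ?E" and E': "?E' = glue ?E a b" using cut by (auto simp: cuts_def)
  have "?E \<subseteq> ?E'" unfolding E' by (auto simp: glue_def)
  have P: "circles D \<alpha> - circles D \<alpha>' = {A, B}" "circles D \<alpha>' - circles D \<alpha> = {A \<union> B}" "A \<inter> B = {}"
    unfolding circles_eq E' A_def B_def
    by (rule quotient_glue[OF equiv_same_circle a b ab]; use same_circle_arcs[OF D] in blast)+
  have "a \<in> A" "b \<in> B" unfolding A_def B_def using equiv_UNIV_refl[OF equiv_same_circle] by auto
  then have "A \<noteq> B" using P(3) by auto
  have in_P: "A \<in> circles D \<alpha>" "B \<in> circles D \<alpha>" "A \<union> B \<in> circles D \<alpha>'" using P by auto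
  show ?thesis
  proof (cases "one_per_circle D \<alpha>' U")
    case False
    have "contr x (lift D c \<alpha>) U = 0" if x: "x = a \<or> x = b" for x
    proof (rule ccontr)
      assume "contr x (lift D c \<alpha>) U \<noteq> 0"
      then have n: "x \<notin> U" "one_per_circle D \<alpha> (insert x U)" by (auto simp: contr_def lift_def split: if_splits)
      then obtain u w where uw: "u \<in> U" "w \<in> U" "u \<noteq> w" "(u, w) \<in> ?E'" "(u, w) \<notin> ?E"
        using False unfolding one_per_circle_def by blast
      then have "(u, a) \<in> ?E \<and> (b, w) \<in> ?E \<or> (u, b) \<in> ?E \<and> (a, w) \<in> ?E"
        unfolding E' by (auto simp: glue_def)
      then show False
        using x n uw equiv_UNIV_sym[OF equiv_same_circle, of _ _ D \<alpha>] unfolding one_per_circle_def by blast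
    qed
    then show ?thesis using False by simp
  next
    case one': True
    then have one: "one_per_circle D \<alpha> U" using \<open>?E \<subseteq> ?E'\<close> one_per_circle_mono by blast
    have no_two: "A \<inter> U = {} \<or> B \<inter> U = {}"
    proof (rule ccontr)
      assume "\<not> ?thesis"
      then obtain u w where uw: "u \<in> A" "w \<in> B" "u \<in> U" "w \<in> U" by blast
      then have "(u, w) \<in> ?E'" using in_P(3) circle_connected by blast
      then have "u = w" using one' uw by (auto simp: one_per_circle_def)
      then show False using uw P(3) by auto
    qed
    have lab: "labelling D \<alpha>' U C = (if C \<inter> U = {} then LX else L1)" if "C \<in> circles D \<alpha>'" for C
      using that by (simp add: labelling_def)
    let ?w = "\<lambda>x. labelling D \<alpha> (insert x U)" and ?ok = "\<lambda>x. x \<notin> U \<and> one_per_circle D \<alpha> (insert x U)"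
    have coeff: "edge_coeff D \<alpha> \<alpha>' v (labelling D \<alpha>' U)
      = of_bool (?ok a \<and> v = ?w a) + of_bool (?ok b \<and> v = ?w b)" if v: "v \<in> circles D \<alpha> \<rightarrow>\<^sub>E UNIV" for v
    proof -
      let ?K = "\<forall>C\<in>circles D \<alpha> \<inter> circles D \<alpha>'. v C = (if C \<inter> U = {} then LX else L1)"
      have set: "circles D \<alpha> - {A} = insert B (circles D \<alpha> \<inter> circles D \<alpha>')"
          "circles D \<alpha> - {B} = insert A (circles D \<alpha> \<inter> circles D \<alpha>')"
        using P(1) \<open>A \<noteq> B\<close> by auto
      have "?ok a \<and> v = ?w a \<longleftrightarrow> A \<inter> U = {} \<and> v A = L1 \<and> v B = (if B \<inter> U = {} then LX else L1) \<and> ?K"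
        using labelling_contr_eq[OF a v one] unfolding A_def[symmetric] set by auto
      moreover have "?ok b \<and> v = ?w b \<longleftrightarrow> B \<inter> U = {} \<and> v B = L1 \<and> v A = (if A \<inter> U = {} then LX else L1) \<and> ?K"
        using labelling_contr_eq[OF b v one] unfolding B_def[symmetric] set by auto
      moreover have "edge_coeff D \<alpha> \<alpha>' v (labelling D \<alpha>' U) = of_bool (?K \<and>
          (if A \<inter> U = {} \<and> B \<inter> U = {} then v A \<noteq> v B else v A = L1 \<and> v B = L1))"
        unfolding edge_coeff_merge[OF P(1,2) \<open>A \<noteq> B\<close>] mbar_eq_1 using in_P(3) lab by (auto simp: Int_Un_distrib2)
      ultimately show ?thesis
        using no_two by (cases "v A"; cases "v B") (auto split: if_splits)
    qed
    have "(\<Sum>v \<in> circles D \<alpha> \<rightarrow>\<^sub>E UNIV. c (\<alpha>, v) * edge_coeff D \<alpha> \<alpha>' v (labelling D \<alpha>' U))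
      = (\<Sum>v \<in> circles D \<alpha> \<rightarrow>\<^sub>E UNIV. c (\<alpha>, v) * of_bool (?ok a \<and> v = ?w a))
      + (\<Sum>v \<in> circles D \<alpha> \<rightarrow>\<^sub>E UNIV. c (\<alpha>, v) * of_bool (?ok b \<and> v = ?w b))"
      unfolding sum.distrib[symmetric] by (rule sum.cong) (simp_all add: coeff distrib_left)
    also have "\<dots> = contr a (lift D c \<alpha>) U + contr b (lift D c \<alpha>) U"
      unfolding sum_PiE_single[OF finite_circles[OF D] labelling_PiE] by (simp add: contr_def lift_def)
    finally show ?thesis using one' by simp
  qed
qed

text \<open>
  A set \<open>U\<close> meeting at most one of the two new circles names labellings both before and after
  the split, and these correspond under \<open>Deltabar\<close>. If \<open>U\<close> meets both, it names \<open>(1, 1)\<close>,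
  which does not occur in the image of \<open>Deltabar\<close>, and it names nothing before the split.
\<close>

lemma edge_lift_split:
  assumes D: "link_diagram D" and a: "a \<in> arcs D" and b: "b \<in> arcs D"
    and cut: "cuts (same_circle D \<alpha>) (same_circle D \<alpha>') a b"
  shows "(if one_per_circle D \<alpha>' U
      then \<Sum>v \<in> circles D \<alpha> \<rightarrow>\<^sub>E UNIV. c (\<alpha>, v) * edge_coeff D \<alpha> \<alpha>' v (labelling D \<alpha>' U) else 0)
    = lift D c \<alpha> U"
proof -
  let ?E = "same_circle D \<alpha>" and ?E' = "same_circle D \<alpha>'"
  define A B where "A = ?E' `` {a}" and "B = ?E' `` {b}"
  have ab: "(a, b) \<notin> ?E'" and E: "?E = glue ?E' a b" using cut by (auto simp: cuts_def)
  have sub: "?E' \<subseteq> ?E" unfolding E by (auto simp: glue_def)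
  have P: "circles D \<alpha>' - circles D \<alpha> = {A, B}" "circles D \<alpha> - circles D \<alpha>' = {A \<union> B}" "A \<inter> B = {}"
    unfolding circles_eq E A_def B_def
    by (rule quotient_glue[OF equiv_same_circle a b ab]; use same_circle_arcs[OF D] in blast)+
  have "a \<in> A" "b \<in> B" unfolding A_def B_def using equiv_UNIV_refl[OF equiv_same_circle] by auto
  then have "A \<noteq> B" using P(3) by auto
  have in_P: "A \<in> circles D \<alpha>'" "B \<in> circles D \<alpha>'" "A \<union> B \<in> circles D \<alpha>" using P by auto
  show ?thesis
  proof (cases "one_per_circle D \<alpha>' U")
    case False
    then have "\<not> one_per_circle D \<alpha> U" using one_per_circle_mono sub by blast
    then show ?thesis using False by (simp add: lift_def)
  next
    case one': True
    have one: "one_per_circle D \<alpha> U \<longleftrightarrow> A \<inter> U = {} \<or> B \<inter> U = {}"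
    proof
      assume one: "one_per_circle D \<alpha> U"
      show "A \<inter> U = {} \<or> B \<inter> U = {}"
      proof (rule ccontr)
        assume "\<not> ?thesis"
        then obtain u w where uw: "u \<in> A" "w \<in> B" "u \<in> U" "w \<in> U" by blast
        then have "(u, w) \<in> ?E" using in_P(3) circle_connected by blast
        then have "u = w" using one uw by (auto simp: one_per_circle_def)
        then show False using uw P(3) by auto
      qed
    next
      assume no: "A \<inter> U = {} \<or> B \<inter> U = {}"
      have "(u, w) \<in> ?E'" if "u \<in> U" "w \<in> U" "(u, w) \<in> ?E" for u w
        using that no equiv_UNIV_sym[OF equiv_same_circle, of _ _ D \<alpha>'] unfolding E A_def B_def glue_def by blast
      then show "one_per_circle D \<alpha> U" using one' by (auto simp: one_per_circle_def)
    qed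
    have lab: "labelling D \<alpha>' U C = (if C \<inter> U = {} then LX else L1)" if "C \<in> circles D \<alpha>'" for C
      using that by (simp add: labelling_def)
    have coeff: "edge_coeff D \<alpha> \<alpha>' v (labelling D \<alpha>' U)
      = of_bool (one_per_circle D \<alpha> U \<and> v = labelling D \<alpha> U)" if v: "v \<in> circles D \<alpha> \<rightarrow>\<^sub>E UNIV" for v
    proof -
      let ?K = "\<forall>C\<in>circles D \<alpha> \<inter> circles D \<alpha>'. v C = (if C \<inter> U = {} then LX else L1)"
      have set: "circles D \<alpha> = insert (A \<union> B) (circles D \<alpha> \<inter> circles D \<alpha>')"
        using P(2) by auto
      have "v = labelling D \<alpha> U \<longleftrightarrow> (\<forall>C\<in>circles D \<alpha>. v C = (if C \<inter> U = {} then LX else L1))"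
      proof
        assume "\<forall>C\<in>circles D \<alpha>. v C = (if C \<inter> U = {} then LX else L1)"
        then show "v = labelling D \<alpha> U"
          by (intro PiE_ext[OF v labelling_PiE]) (simp add: labelling_def)
      qed (simp add: labelling_def)
      also have "\<dots> \<longleftrightarrow> v (A \<union> B) = (if (A \<union> B) \<inter> U = {} then LX else L1) \<and> ?K"
        by (subst set) simp
      finally show ?thesis
        unfolding edge_coeff_split[OF P(1,2) \<open>A \<noteq> B\<close>] Deltabar_eq_1 one using in_P lab
        by (cases "v (A \<union> B)") (auto simp: Int_Un_distrib2)
    qed
    have "(\<Sum>v \<in> circles D \<alpha> \<rightarrow>\<^sub>E UNIV. c (\<alpha>, v) * edge_coeff D \<alpha> \<alpha>' v (labelling D \<alpha>' U))
      = (\<Sum>v \<in> circles D \<alpha> \<rightarrow>\<^sub>E UNIV. c (\<alpha>, v) * of_bool (one_per_circle D \<alpha> U \<and> v = labelling D \<alpha> U))"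
      by (rule sum.cong) (simp_all add: coeff)
    also have "\<dots> = lift D c \<alpha> U"
      unfolding sum_PiE_single[OF finite_circles[OF D] labelling_PiE] by (simp add: lift_def)
    finally show ?thesis using one' by simp
  qed
qed

proposition edge_lift:
  assumes D: "link_diagram D" and r: "r < ncross D" "r \<notin> \<alpha>"
  shows "(if one_per_circle D (insert r \<alpha>) U
      then \<Sum>v \<in> circles D \<alpha> \<rightarrow>\<^sub>E UNIV. c (\<alpha>, v) * edge_coeff D \<alpha> (insert r \<alpha>) v (labelling D (insert r \<alpha>) U) else 0)
    = edge_map (same_circle D (insert r \<alpha>)) (arc D r 0) (arc D r 2) (lift D c \<alpha>) U"
proof -
  let ?E = "same_circle D \<alpha>" and ?E' = "same_circle D (insert r \<alpha>)" and ?a = "arc D r 0" and ?b = "arc D r 2"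
  have ab: "?a \<in> arcs D" "?b \<in> arcs D" using arc_in_arcs[OF D r(1)] by auto
  consider "cuts ?E' ?E ?a ?b" | "?E = ?E'" "(?a, ?b) \<in> ?E" | "cuts ?E ?E' ?a ?b"
    using edge_elementary[OF D r] by (auto simp: elementary_def)
  then show ?thesis
  proof cases
    case 1
    then have "(?a, ?b) \<in> ?E'"
      using equiv_UNIV_refl[OF equiv_same_circle] by (auto simp: cuts_def glue_def)
    then show ?thesis using edge_lift_merge[OF D ab 1] by (simp add: edge_map_def)
  next
    case 2
    then have "contr ?a (lift D c \<alpha>) = contr ?b (lift D c \<alpha>)"
      using balanced_lift[OF D, of \<alpha> c] by (auto simp: balanced_def)
    moreover have "circles D \<alpha> = circles D (insert r \<alpha>)" using 2 by (simp add: circles_eq)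
    ultimately show ?thesis using 2 by (simp add: edge_map_def edge_coeff_same)
  next
    case 3
    then have "(?a, ?b) \<notin> ?E'" by (simp add: cuts_def)
    then show ?thesis using edge_lift_split[OF D ab 3] by (simp add: edge_map_def)
  qed
qed


section \<open>The boundary map squares to zero\<close>

definition supported :: "link_diagram \<Rightarrow> chain \<Rightarrow> bool" where
  "supported D c \<longleftrightarrow> (\<forall>s. c s \<noteq> 0 \<longrightarrow> s \<in> states D)"

lemma boundary_eq:
  assumes D: "link_diagram D" and s: "(\<alpha>', v') \<in> states D"
  shows "boundary D c (\<alpha>', v') = (\<Sum>r\<in>\<alpha>'. \<Sum>v \<in> circles D (\<alpha>' - {r}) \<rightarrow>\<^sub>E UNIV.
     c (\<alpha>' - {r}, v) * edge_coeff D (\<alpha>' - {r}) \<alpha>' v v')"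
proof -
  have sub: "\<alpha>' \<subseteq> {..<ncross D}" using s by (simp add: states_def)
  let ?S = "SIGMA r:\<alpha>'. circles D (\<alpha>' - {r}) \<rightarrow>\<^sub>E (UNIV::label set)"
  have "bij_betw (\<lambda>(r, v). (\<alpha>' - {r}, v)) ?S {(\<alpha>, v) \<in> states D. cube_edge D \<alpha> \<alpha>'}"
  proof (rule bij_betwI')
    fix x y assume "x \<in> ?S" "y \<in> ?S"
    then show "(case x of (r, v) \<Rightarrow> (\<alpha>' - {r}, v)) = (case y of (r, v) \<Rightarrow> (\<alpha>' - {r}, v)) \<longleftrightarrow> x = y"
      by (auto simp: split_beta)
  next
    fix x assume "x \<in> ?S"
    then show "(case x of (r, v) \<Rightarrow> (\<alpha>' - {r}, v)) \<in> {(\<alpha>, v) \<in> states D. cube_edge D \<alpha> \<alpha>'}"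
      using sub by (force simp: states_def cube_edge_def)
  next
    fix y assume "y \<in> {(\<alpha>, v) \<in> states D. cube_edge D \<alpha> \<alpha>'}"
    then obtain \<alpha> v r where y: "y = (\<alpha>, v)" "(\<alpha>, v) \<in> states D" "r \<notin> \<alpha>" "\<alpha>' = insert r \<alpha>"
      by (auto simp: cube_edge_def)
    then have "(r, v) \<in> ?S" "y = (case (r, v) of (r, v) \<Rightarrow> (\<alpha>' - {r}, v))" by (auto simp: states_def)
    then show "\<exists>x\<in>?S. y = (case x of (r, v) \<Rightarrow> (\<alpha>' - {r}, v))" by blast
  qed
  then have "boundary D c (\<alpha>', v') = (\<Sum>(r, v)\<in>?S. c (\<alpha>' - {r}, v) * edge_coeff D (\<alpha>' - {r}) \<alpha>' v v')"
    using s by (simp add: boundary_def sum.reindex_bij_betw[symmetric] split_beta)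
  also have "\<dots> = (\<Sum>r\<in>\<alpha>'. \<Sum>v \<in> circles D (\<alpha>' - {r}) \<rightarrow>\<^sub>E UNIV.
     c (\<alpha>' - {r}, v) * edge_coeff D (\<alpha>' - {r}) \<alpha>' v v')"
    using finite_subset[OF sub] finite_circles[OF D]
    by (subst sum.Sigma) (auto intro!: finite_PiE simp: UNIV_label)
  finally show ?thesis .
qed

proposition lift_boundary:
  assumes D: "link_diagram D" and \<alpha>': "\<alpha>' \<subseteq> {..<ncross D}"
  shows "lift D (boundary D c) \<alpha>' U
    = (\<Sum>r\<in>\<alpha>'. edge_map (same_circle D \<alpha>') (arc D r 0) (arc D r 2) (lift D c (\<alpha>' - {r})) U)"
proof -
  have "(\<alpha>', labelling D \<alpha>' U) \<in> states D" using \<alpha>' labelling_PiE by (auto simp: states_def)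
  then have "lift D (boundary D c) \<alpha>' U = (\<Sum>r\<in>\<alpha>'. if one_per_circle D \<alpha>' U
      then \<Sum>v \<in> circles D (\<alpha>' - {r}) \<rightarrow>\<^sub>E UNIV. c (\<alpha>' - {r}, v) * edge_coeff D (\<alpha>' - {r}) \<alpha>' v (labelling D \<alpha>' U) else 0)"
    by (simp add: lift_def boundary_eq[OF D])
  also have "\<dots> = (\<Sum>r\<in>\<alpha>'. edge_map (same_circle D \<alpha>') (arc D r 0) (arc D r 2) (lift D c (\<alpha>' - {r})) U)"
  proof (rule sum.cong[OF refl])
    fix r assume r: "r \<in> \<alpha>'"
    then have ins: "insert r (\<alpha>' - {r}) = \<alpha>'" and lt: "r < ncross D" using \<alpha>' by auto
    show "(if one_per_circle D \<alpha>' U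
      then \<Sum>v \<in> circles D (\<alpha>' - {r}) \<rightarrow>\<^sub>E UNIV. c (\<alpha>' - {r}, v) * edge_coeff D (\<alpha>' - {r}) \<alpha>' v (labelling D \<alpha>' U) else 0)
      = edge_map (same_circle D \<alpha>') (arc D r 0) (arc D r 2) (lift D c (\<alpha>' - {r})) U"
      by (rule edge_lift[OF D lt, of "\<alpha>' - {r}" U c, unfolded ins]) simp
  qed
  finally show ?thesis .
qed

text \<open>
  A name of \<open>v\<close> is obtained by choosing an arc on every circle labelled \<open>1\<close>.
\<close>

lemma labelling_surj:
  assumes D: "link_diagram D" and v: "v \<in> circles D \<alpha> \<rightarrow>\<^sub>E UNIV"
  obtains U where "one_per_circle D \<alpha> U" "labelling D \<alpha> U = v"
proof -
  define rep where "rep = (\<lambda>C :: nat set. SOME a. a \<in> C)"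
  have rep: "rep C \<in> C" if "C \<in> circles D \<alpha>" for C
    unfolding rep_def using circle_nonempty[OF that] by (simp add: some_in_eq)
  define U where "U = rep ` {C \<in> circles D \<alpha>. v C = L1}"
  have cls: "C = C'" if "C \<in> circles D \<alpha>" "C' \<in> circles D \<alpha>" "a \<in> C" "a' \<in> C'" "(a, a') \<in> same_circle D \<alpha>" for C C' a a'
    using that circle_closed[OF that(2,5)] circles_eq_class by metis
  have "one_per_circle D \<alpha> U"
    unfolding one_per_circle_def
  proof (intro conjI ballI impI)
    show "U \<subseteq> arcs D" using rep circle_subset_arcs[OF D] by (auto simp: U_def)
    fix a b assume "a \<in> U" "b \<in> U" "(a, b) \<in> same_circle D \<alpha>"
    then show "a = b" unfolding U_def using cls rep by blast
  qed
  moreover have "labelling D \<alpha> U = v"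
  proof (rule PiE_ext[OF labelling_PiE v])
    fix C assume C: "C \<in> circles D \<alpha>"
    have "C \<inter> U = {} \<longleftrightarrow> v C \<noteq> L1"
    proof
      assume "C \<inter> U = {}"
      then show "v C \<noteq> L1" using rep[OF C] C by (auto simp: U_def)
    next
      assume "v C \<noteq> L1"
      then show "C \<inter> U = {}"
        using cls[OF C] rep equiv_UNIV_refl[OF equiv_same_circle] by (fastforce simp: U_def)
    qed
    then show "labelling D \<alpha> U C = v C" using C by (cases "v C") (auto simp: labelling_def)
  qed
  ultimately show thesis by (rule that)
qed

text \<open>
  Therefore identities between chains can be verified for their representatives in the algebra.
\<close>

lemma lift_inject:
  assumes D: "link_diagram D" and "supported D c" "supported D c'"
    and eq: "\<And>\<alpha> U. \<alpha> \<subseteq> {..<ncross D} \<Longrightarrow> U \<subseteq> arcs D \<Longrightarrow> lift D c \<alpha> U = lift D c' \<alpha> U"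
  shows "c = c'"
proof
  fix s
  show "c s = c' s"
  proof (cases "s \<in> states D")
    case True
    then obtain \<alpha> v where s: "s = (\<alpha>, v)" "\<alpha> \<subseteq> {..<ncross D}" "v \<in> circles D \<alpha> \<rightarrow>\<^sub>E UNIV"
      by (auto simp: states_def)
    obtain U where U: "one_per_circle D \<alpha> U" "labelling D \<alpha> U = v" by (rule labelling_surj[OF D s(3)])
    then have "U \<subseteq> arcs D" by (simp add: one_per_circle_def)
    then show ?thesis using eq[OF s(2), of U] U s(1) by (simp add: lift_def)
  next
    case False
    then have "c s = 0" "c' s = 0" using assms(2,3) unfolding supported_def by blast+
    then show ?thesis by simp
  qed
qed

lemma supported_boundary: "supported D (boundary D c)"
  by (auto simp: supported_def boundary_def split: if_splits)

text \<open>
  In characteristic 2 the terms of \<open>(x, y)\<close> and \<open>(y, x)\<close> cancel.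
\<close>

lemma sum_symmetric_pairs:
  assumes "finite A" "\<And>x y. x \<in> A \<Longrightarrow> y \<in> A \<Longrightarrow> x \<noteq> y \<Longrightarrow> f x y = f y x"
  shows "(\<Sum>x\<in>A. \<Sum>y\<in>A - {x}. f x y) = (0 :: bit)"
  using assms
proof (induction A rule: finite_induct)
  case (insert z A)
  have "(\<Sum>x\<in>A. \<Sum>y\<in>insert z A - {x}. f x y) = (\<Sum>x\<in>A. f x z + (\<Sum>y\<in>A - {x}. f x y))"
  proof (rule sum.cong[OF refl])
    fix x assume "x \<in> A"
    then have "insert z A - {x} = insert z (A - {x})" "z \<notin> A - {x}" using insert.hyps by auto
    then show "(\<Sum>y\<in>insert z A - {x}. f x y) = f x z + (\<Sum>y\<in>A - {x}. f x y)"
      using insert.hyps by simp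
  qed
  also have "\<dots> = (\<Sum>x\<in>A. f z x)"
    using insert by (simp add: sum.distrib insert.IH) (auto intro!: sum.cong)
  finally show ?case using insert.hyps by simp
qed simp

theorem boundary_boundary:
  assumes D: "link_diagram D"
  shows "boundary D (boundary D c) = (\<lambda>_. 0)"
proof (rule lift_inject[OF D supported_boundary])
  fix \<alpha> U assume \<alpha>: "\<alpha> \<subseteq> {..<ncross D}"
  let ?e = "\<lambda>\<alpha> r. edge_map (same_circle D \<alpha>) (arc D r 0) (arc D r 2)"
  let ?f = "\<lambda>r r'. ?e \<alpha> r (?e (\<alpha> - {r}) r' (lift D c (\<alpha> - {r} - {r'}))) U"
  have "lift D (boundary D (boundary D c)) \<alpha> U = (\<Sum>r\<in>\<alpha>. ?e \<alpha> r (lift D (boundary D c) (\<alpha> - {r})) U)"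
    by (rule lift_boundary[OF D \<alpha>])
  also have "\<dots> = (\<Sum>r\<in>\<alpha>. \<Sum>r'\<in>\<alpha> - {r}. ?f r r')"
  proof (rule sum.cong[OF refl])
    fix r assume "r \<in> \<alpha>"
    have "lift D (boundary D c) (\<alpha> - {r}) = (\<lambda>U. \<Sum>r'\<in>\<alpha> - {r}. ?e (\<alpha> - {r}) r' (lift D c (\<alpha> - {r} - {r'})) U)"
      using lift_boundary[OF D, of "\<alpha> - {r}" c] \<alpha> by auto
    then show "?e \<alpha> r (lift D (boundary D c) (\<alpha> - {r})) U = (\<Sum>r'\<in>\<alpha> - {r}. ?f r r')"
      by (simp add: edge_map_sum)
  qed
  also have "\<dots> = 0"
  proof (rule sum_symmetric_pairs)
    show "finite \<alpha>" using \<alpha> by (rule finite_subset) simp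
    fix r r' assume r: "r \<in> \<alpha>" "r' \<in> \<alpha>" "r \<noteq> r'"
    let ?\<beta> = "\<alpha> - {r} - {r'}"
    have ins: "insert r' ?\<beta> = \<alpha> - {r}" "insert r ?\<beta> = \<alpha> - {r'}" "insert r (\<alpha> - {r}) = \<alpha>" "insert r' (\<alpha> - {r'}) = \<alpha>"
      "\<alpha> - {r'} - {r} = ?\<beta>"
      using r by auto
    have lt: "r < ncross D" "r' < ncross D" using r \<alpha> by auto
    show "?f r r' = ?f r' r"
      using edge_map_commute_square[OF equiv_same_circle equiv_same_circle equiv_same_circle equiv_same_circle,
          of D ?\<beta> D "\<alpha> - {r'}" "arc D r 0" "arc D r 2" D "\<alpha> - {r}" "arc D r' 0" "arc D r' 2" D \<alpha> "lift D c ?\<beta>"]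
        edge_elementary[OF D lt(1), of ?\<beta>] edge_elementary[OF D lt(2), of ?\<beta>]
        edge_elementary[OF D lt(1), of "\<alpha> - {r}"] edge_elementary[OF D lt(2), of "\<alpha> - {r'}"] balanced_lift[OF D, of ?\<beta> c]
      unfolding ins by (simp add: fun_eq_iff)
  qed
  finally show "lift D (boundary D (boundary D c)) \<alpha> U = lift D (\<lambda>_. 0) \<alpha> U"
    by (simp add: lift_def)
qed (simp add: supported_def)


section \<open>Multiplication by x at a base arc, and erasing x\<close>

text \<open>
  Both this map and the next one are given by the coefficient of the image at \<open>(\<alpha>, v)\<close>,
  which collects the labellings that are sent to \<open>v\<close>.
\<close>

definition mult_x :: "link_diagram \<Rightarrow> nat \<Rightarrow> chain \<Rightarrow> chain" where
  "mult_x D p c = (\<lambda>(\<alpha>, v). let B = same_circle D \<alpha> `` {p} in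
     if (\<alpha>, v) \<in> states D \<and> v B = LX then c (\<alpha>, v(B := L1)) else 0)"

text \<open>
  The sum over all circles of the map \<open>x \<mapsto> 1\<close>, \<open>1 \<mapsto> 0\<close> on the corresponding
  tensor factor.
\<close>

definition erase_x :: "link_diagram \<Rightarrow> chain \<Rightarrow> chain" where
  "erase_x D c = (\<lambda>(\<alpha>, v).
     if (\<alpha>, v) \<in> states D then \<Sum>C | C \<in> circles D \<alpha> \<and> v C = L1. c (\<alpha>, v(C := LX)) else 0)"

lemma supported_mult_x: "supported D (mult_x D p c)"
  by (auto simp: supported_def mult_x_def Let_def split: if_splits)

lemma supported_erase_x: "supported D (erase_x D c)"
  by (auto simp: supported_def erase_x_def split: if_splits)

lemma one_per_circle_subset: "one_per_circle D \<alpha> V \<Longrightarrow> U \<subseteq> V \<Longrightarrow> one_per_circle D \<alpha> U"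
  by (auto simp: one_per_circle_def)

text \<open>
  Multiplication by \<open>x\<close> on the circle through \<open>p\<close> is multiplication by \<open>x\<^sub>p\<close> in the
  algebra.
\<close>

lemma lift_mult_x:
  assumes D: "link_diagram D" and p: "p \<in> arcs D" and \<alpha>: "\<alpha> \<subseteq> {..<ncross D}"
  shows "lift D (mult_x D p c) \<alpha> U = contr p (lift D c \<alpha>) U"
proof (cases "one_per_circle D \<alpha> U")
  case False
  then have "\<not> one_per_circle D \<alpha> (insert p U)" using one_per_circle_subset by blast
  then show ?thesis using False by (simp add: lift_def contr_def)
next
  case True
  define B v where "B = same_circle D \<alpha> `` {p}" and "v = labelling D \<alpha> U"
  have B: "B \<in> circles D \<alpha>" unfolding B_def by (rule circle_of_arc[OF p])
  have v: "v \<in> circles D \<alpha> \<rightarrow>\<^sub>E UNIV" unfolding v_def by (rule labelling_PiE)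
  then have vB: "v(B := L1) \<in> circles D \<alpha> \<rightarrow>\<^sub>E UNIV" using B by (auto simp: PiE_def extensional_def)
  have st: "(\<alpha>, v) \<in> states D" using \<alpha> v by (simp add: states_def)
  have empty: "v B = LX \<longleftrightarrow> B \<inter> U = {}" using B by (simp add: v_def labelling_def)
  have new: "p \<notin> U \<and> one_per_circle D \<alpha> (insert p U) \<and> v(B := L1) = labelling D \<alpha> (insert p U) \<longleftrightarrow> B \<inter> U = {}"
    using labelling_contr_eq[OF p vB True] by (simp add: B_def[symmetric]) (auto simp: v_def labelling_def)
  have old: "B \<inter> U = {}" if "p \<notin> U" "one_per_circle D \<alpha> (insert p U)"
    using that labelling_contr_eq[OF p labelling_PiE True, of "insert p U"] by (simp add: B_def)
  have "lift D (mult_x D p c) \<alpha> U = (if B \<inter> U = {} then c (\<alpha>, v(B := L1)) else 0)"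
    using True st empty by (simp add: lift_def mult_x_def v_def[symmetric] B_def[symmetric])
  also have "\<dots> = contr p (lift D c \<alpha>) U"
    using new old by (auto simp: contr_def lift_def)
  finally show ?thesis .
qed

text \<open>
  If \<open>U\<close> contains one arc of every circle labelled \<open>1\<close>, removing an arc from \<open>U\<close> changes
  the label of its circle to \<open>x\<close>. If \<open>U\<close> contains two arcs \<open>a, b\<close> of a circle, only
  \<open>U - {a}\<close> and \<open>U - {b}\<close> can name a labelling; they name the same one and cancel.
\<close>

lemma lift_erase_x:
  assumes D: "link_diagram D" and \<alpha>: "\<alpha> \<subseteq> {..<ncross D}" and U: "U \<subseteq> arcs D"
  shows "lift D (erase_x D c) \<alpha> U = erase (lift D c \<alpha>) U"
proof (cases "one_per_circle D \<alpha> U")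
  case False
  then obtain a b where ab: "a \<in> U" "b \<in> U" "a \<noteq> b" "(a, b) \<in> same_circle D \<alpha>"
    using U by (auto simp: one_per_circle_def)
  have fin: "finite U" using U D by (auto simp: link_diagram_def intro: finite_subset)
  have zero: "lift D c \<alpha> (U - {u}) = 0" if "u \<in> U - {a} - {b}" for u
    using that ab by (auto simp: lift_def one_per_circle_def)
  have "erase (lift D c \<alpha>) U = lift D c \<alpha> (U - {a}) + (lift D c \<alpha> (U - {b}) + (\<Sum>u\<in>U - {a} - {b}. lift D c \<alpha> (U - {u})))"
    unfolding erase_def using fin ab by (simp add: sum.remove[of U a] sum.remove[of "U - {a}" b])
  also have "(\<Sum>u\<in>U - {a} - {b}. lift D c \<alpha> (U - {u})) = 0" using zero by simp
  also have "lift D c \<alpha> (U - {a}) = contr b (lift D c \<alpha>) (U - {a} - {b})"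
    using ab by (auto simp: contr_def insert_absorb)
  also have "\<dots> = contr a (lift D c \<alpha>) (U - {a} - {b})"
    using balanced_lift[OF D, of \<alpha> c] ab(4) by (auto simp: balanced_def)
  also have "\<dots> = lift D c \<alpha> (U - {b})"
  proof -
    have "insert a (U - {a} - {b}) = U - {b}" using ab by auto
    then show ?thesis by (simp add: contr_def)
  qed
  finally have "erase (lift D c \<alpha>) U = 0" by simp
  then show ?thesis using False by (simp only: lift_def[of D "erase_x D c"] if_False)
next
  case True
  define v where "v = labelling D \<alpha> U"
  have v: "(\<alpha>, v) \<in> states D" using \<alpha> labelling_PiE by (simp add: states_def v_def)
  let ?c = "\<lambda>u. same_circle D \<alpha> `` {u}"
  have self: "u \<in> ?c u" for u using equiv_UNIV_refl[OF equiv_same_circle] by simp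
  have bij: "bij_betw ?c U {C \<in> circles D \<alpha>. v C = L1}"
  proof (rule bij_betwI')
    fix u w assume uw: "u \<in> U" "w \<in> U"
    show "?c u = ?c w \<longleftrightarrow> u = w"
      using True uw self[of w] unfolding one_per_circle_def by blast
  next
    fix u assume u: "u \<in> U"
    then have "?c u \<in> circles D \<alpha>" using U circle_of_arc by blast
    moreover have "?c u \<inter> U \<noteq> {}" using u self by blast
    ultimately show "?c u \<in> {C \<in> circles D \<alpha>. v C = L1}" by (simp add: v_def labelling_def)
  next
    fix C assume "C \<in> {C \<in> circles D \<alpha>. v C = L1}"
    then have C: "C \<in> circles D \<alpha>" "C \<inter> U \<noteq> {}" by (auto simp: v_def labelling_def split: if_splits)
    then show "\<exists>u\<in>U. C = ?c u" using circles_eq_class by blast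
  qed
  have lab: "labelling D \<alpha> (U - {u}) = v(?c u := LX)" if u: "u \<in> U" for u
  proof (rule PiE_ext[OF labelling_PiE])
    have cu: "?c u \<in> circles D \<alpha>" using u U circle_of_arc by blast
    show "v(?c u := LX) \<in> circles D \<alpha> \<rightarrow>\<^sub>E UNIV"
      using cu by (auto simp: v_def labelling_def PiE_def extensional_def)
    fix C assume C: "C \<in> circles D \<alpha>"
    show "labelling D \<alpha> (U - {u}) C = (v(?c u := LX)) C"
    proof (cases "C = ?c u")
      case eq: True
      have "C \<inter> (U - {u}) = {}" using True u unfolding eq one_per_circle_def by blast
      then show ?thesis using eq C by (simp add: labelling_def)
    next
      case False
      then have "u \<notin> C" using circles_eq_class[OF C] by blast
      then have "C \<inter> (U - {u}) = C \<inter> U" by blast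
      then show ?thesis using False C by (simp add: v_def labelling_def)
    qed
  qed
  have "lift D (erase_x D c) \<alpha> U = (\<Sum>C | C \<in> circles D \<alpha> \<and> v C = L1. c (\<alpha>, v(C := LX)))"
    using True v by (simp add: lift_def erase_x_def v_def)
  also have "\<dots> = (\<Sum>u\<in>U. c (\<alpha>, v(?c u := LX)))"
    using sum.reindex_bij_betw[OF bij, of "\<lambda>C. c (\<alpha>, v(C := LX))"] by simp
  also have "\<dots> = erase (lift D c \<alpha>) U"
    unfolding erase_def
  proof (rule sum.cong[OF refl])
    fix u assume u: "u \<in> U"
    have "one_per_circle D \<alpha> (U - {u})" using True by (rule one_per_circle_subset) auto
    then show "c (\<alpha>, v(?c u := LX)) = lift D c \<alpha> (U - {u})" using lab[OF u] by (simp add: lift_def)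
  qed
  finally show ?thesis .
qed

lemma lift_add: "lift D (\<lambda>s. c s + d s) \<alpha> U = lift D c \<alpha> U + lift D d \<alpha> U"
  by (simp add: lift_def)

lemma contr_sum: "contr a (\<lambda>U. \<Sum>i\<in>I. \<Phi> i U) = (\<lambda>U. \<Sum>i\<in>I. contr a (\<Phi> i) U)"
  by (auto simp: contr_def fun_eq_iff)

proposition mult_x_boundary:
  assumes D: "link_diagram D" and p: "p \<in> arcs D"
  shows "mult_x D p (boundary D c) = boundary D (mult_x D p c)"
proof (rule lift_inject[OF D supported_mult_x supported_boundary])
  fix \<alpha> U assume \<alpha>: "\<alpha> \<subseteq> {..<ncross D}"
  have sub: "\<alpha> - {r} \<subseteq> {..<ncross D}" for r using \<alpha> by blast
  have "lift D (mult_x D p c) (\<alpha> - {r}) = contr p (lift D c (\<alpha> - {r}))" for r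
    using lift_mult_x[OF D p sub] by blast
  moreover have "lift D (boundary D c) \<alpha>
      = (\<lambda>U. \<Sum>r\<in>\<alpha>. edge_map (same_circle D \<alpha>) (arc D r 0) (arc D r 2) (lift D c (\<alpha> - {r})) U)"
    using lift_boundary[OF D \<alpha>] by blast
  ultimately show "lift D (mult_x D p (boundary D c)) \<alpha> U = lift D (boundary D (mult_x D p c)) \<alpha> U"
    by (simp add: lift_mult_x[OF D p \<alpha>] lift_boundary[OF D \<alpha>] contr_sum edge_map_contr)
qed

proposition erase_x_boundary:
  assumes D: "link_diagram D"
  shows "erase_x D (boundary D c) = boundary D (erase_x D c)"
proof (rule lift_inject[OF D supported_erase_x supported_boundary])
  fix \<alpha> U assume \<alpha>: "\<alpha> \<subseteq> {..<ncross D}" and U: "U \<subseteq> arcs D"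
  have fin: "finite U" using U D by (auto simp: link_diagram_def intro: finite_subset)
  have sub: "\<alpha> - {r} \<subseteq> {..<ncross D}" for r using \<alpha> by blast
  let ?e = "\<lambda>r. edge_map (same_circle D \<alpha>) (arc D r 0) (arc D r 2)"
  have "?e r (lift D (erase_x D c) (\<alpha> - {r})) U = ?e r (erase (lift D c (\<alpha> - {r}))) U" if r: "r \<in> \<alpha>" for r
  proof -
    have "arc D r 0 \<in> arcs D" "arc D r 2 \<in> arcs D" using arc_in_arcs[OF D] r \<alpha> by auto
    then show ?thesis
      using lift_erase_x[OF D sub] U by (simp add: edge_map_def contr_def)
  qed
  then have "lift D (boundary D (erase_x D c)) \<alpha> U = (\<Sum>r\<in>\<alpha>. ?e r (erase (lift D c (\<alpha> - {r}))) U)"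
    by (simp add: lift_boundary[OF D \<alpha>])
  also have "\<dots> = (\<Sum>r\<in>\<alpha>. \<Sum>u\<in>U. ?e r (lift D c (\<alpha> - {r})) (U - {u}))"
    by (simp add: edge_map_erase[OF fin] erase_def)
  also have "\<dots> = erase (lift D (boundary D c) \<alpha>) U"
    by (simp add: erase_def lift_boundary[OF D \<alpha>] sum.swap[of _ \<alpha> U])
  finally show "lift D (erase_x D (boundary D c)) \<alpha> U = lift D (boundary D (erase_x D c)) \<alpha> U"
    by (simp add: lift_erase_x[OF D \<alpha> U])
qed

text \<open>
  This is the product rule \<open>contr_erase\<close>. It makes each of the two maps a contracting homotopy
  for the other.
\<close>

proposition erase_x_mult_x:
  assumes D: "link_diagram D" and p: "p \<in> arcs D" and c: "supported D c"
  shows "(\<lambda>s. erase_x D (mult_x D p c) s + mult_x D p (erase_x D c) s) = c"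
proof (rule lift_inject[OF D _ c])
  have "mult_x D p (erase_x D c) s = 0 \<and> erase_x D (mult_x D p c) s = 0" if "s \<notin> states D" for s
    using that supported_mult_x supported_erase_x unfolding supported_def by blast
  then show "supported D (\<lambda>s. erase_x D (mult_x D p c) s + mult_x D p (erase_x D c) s)"
    unfolding supported_def by force
  fix \<alpha> U assume \<alpha>: "\<alpha> \<subseteq> {..<ncross D}" and U: "U \<subseteq> arcs D"
  have fin: "finite U" using U D by (auto simp: link_diagram_def intro: finite_subset)
  have "lift D (mult_x D p c) \<alpha> = contr p (lift D c \<alpha>)"
    using lift_mult_x[OF D p \<alpha>] by blast
  moreover have "contr p (lift D (erase_x D c) \<alpha>) U = contr p (erase (lift D c \<alpha>)) U"
    using lift_erase_x[OF D \<alpha>] U p by (simp add: contr_def)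
  ultimately show "lift D (\<lambda>s. erase_x D (mult_x D p c) s + mult_x D p (erase_x D c) s) \<alpha> U = lift D c \<alpha> U"
    by (simp add: lift_add lift_mult_x[OF D p \<alpha>] lift_erase_x[OF D \<alpha> U] contr_erase[OF fin])
qed

lemma qdeg_upd:
  assumes D: "link_diagram D" and C: "C \<in> circles D \<alpha>" and v: "v C = LX"
  shows "qdeg D (\<alpha>, v(C := L1)) = qdeg D (\<alpha>, v) + 2"
  using finite_circles[OF D, of \<alpha>] C v by (simp add: qdeg_def hdeg_def sum.remove)

lemma mult_x_chains:
  assumes D: "link_diagram D" and p: "p \<in> arcs D" and c: "c \<in> chains D i j"
  shows "mult_x D p c \<in> chains D i (j - 2)"
  unfolding chains_def
proof (intro CollectI allI impI)
  fix s assume nz: "mult_x D p c s \<noteq> 0"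
  obtain \<alpha> v where s: "s = (\<alpha>, v)" by fastforce
  let ?B = "same_circle D \<alpha> `` {p}"
  have st: "s \<in> states D" "v ?B = LX" "c (\<alpha>, v(?B := L1)) \<noteq> 0"
    using nz by (auto simp: s mult_x_def Let_def split: if_splits)
  then have "hdeg D (\<alpha>, v(?B := L1)) = i" "qdeg D (\<alpha>, v(?B := L1)) = j" using c unfolding chains_def by blast+
  then show "s \<in> states D \<and> hdeg D s = i \<and> qdeg D s = j - 2"
    using st qdeg_upd[OF D circle_of_arc[OF p, of \<alpha>], of v] st(2) by (simp add: s hdeg_def)
qed

lemma erase_x_chains:
  assumes D: "link_diagram D" and c: "c \<in> chains D i j"
  shows "erase_x D c \<in> chains D i (j + 2)"
  unfolding chains_def
proof (intro CollectI allI impI)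
  fix s assume nz: "erase_x D c s \<noteq> 0"
  obtain \<alpha> v where s: "s = (\<alpha>, v)" by fastforce
  have st: "s \<in> states D" and "(\<Sum>C | C \<in> circles D \<alpha> \<and> v C = L1. c (\<alpha>, v(C := LX))) \<noteq> 0"
    using nz by (auto simp: s erase_x_def split: if_splits)
  then obtain C where C: "C \<in> circles D \<alpha>" "v C = L1" "c (\<alpha>, v(C := LX)) \<noteq> 0"
    by (metis (mono_tags, lifting) mem_Collect_eq sum.neutral)
  then have "hdeg D (\<alpha>, v(C := LX)) = i" "qdeg D (\<alpha>, v(C := LX)) = j" using c unfolding chains_def by blast+
  moreover have "v(C := L1) = v" using C by auto
  ultimately show "s \<in> states D \<and> hdeg D s = i \<and> qdeg D s = j + 2"
    using st qdeg_upd[OF D C(1), of "v(C := LX)"] by (simp add: s hdeg_def)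
qed


section \<open>Counting chains, cycles and boundaries\<close>

lemma boundary_add: "boundary D (\<lambda>s. c s + d s) = (\<lambda>s. boundary D c s + boundary D d s)"
  by (auto simp: boundary_def fun_eq_iff distrib_right sum.distrib split_beta)

lemma mult_x_add: "mult_x D p (\<lambda>s. c s + d s) = (\<lambda>s. mult_x D p c s + mult_x D p d s)"
  by (auto simp: mult_x_def fun_eq_iff Let_def)

lemma erase_x_add: "erase_x D (\<lambda>s. c s + d s) = (\<lambda>s. erase_x D c s + erase_x D d s)"
  by (auto simp: erase_x_def fun_eq_iff sum.distrib)

lemma boundary_zero: "boundary D (\<lambda>_. 0) = (\<lambda>_. 0)"
  by (auto simp: boundary_def fun_eq_iff split_beta)

lemma chains_add: "c \<in> chains D i j \<Longrightarrow> d \<in> chains D i j \<Longrightarrow> (\<lambda>s. c s + d s) \<in> chains D i j"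
  unfolding chains_def mem_Collect_eq by (metis add.left_neutral)

lemma chains_zero: "(\<lambda>_. 0) \<in> chains D i j"
  by (simp add: chains_def)

lemma finite_states: "link_diagram D \<Longrightarrow> finite (states D)"
proof -
  assume D: "link_diagram D"
  have "states D = (SIGMA \<alpha>:Pow {..<ncross D}. circles D \<alpha> \<rightarrow>\<^sub>E UNIV)" by (auto simp: states_def)
  then show ?thesis using finite_circles[OF D] by (auto intro!: finite_PiE simp: UNIV_label)
qed

lemma deg_mbar: "mbar x y z = 1 \<Longrightarrow> deg x + deg y = deg z + 1"
  by (cases x; cases y; cases z) (auto simp: basis_vec_def)

lemma deg_Deltabar: "Deltabar x y z = 1 \<Longrightarrow> deg x = deg y + deg z + 1"
  by (cases x; cases y; cases z) (auto simp: basis_vec_def)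

text \<open>
  Both \<open>mbar\<close> and \<open>Deltabar\<close> lower the degree by 1, which the shift by the homological
  degree in the \<open>q\<close>-grading compensates.
\<close>

lemma edge_coeff_deg:
  assumes D: "link_diagram D" and e: "edge_coeff D \<alpha> \<alpha>' v v' \<noteq> 0"
  shows "(\<Sum>C\<in>circles D \<alpha>. deg (v C)) = (\<Sum>C\<in>circles D \<alpha>'. deg (v' C)) + 1"
proof -
  let ?P = "circles D \<alpha>" and ?Q = "circles D \<alpha>'"
  have fin: "finite ?P" "finite ?Q" using finite_circles[OF D] by auto
  have common: "(\<Sum>C\<in>?P \<inter> ?Q. deg (v C)) = (\<Sum>C\<in>?P \<inter> ?Q. deg (v' C))"
    by (rule sum.cong) (use e in \<open>auto simp: edge_coeff_def split: if_splits\<close>)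
  have P: "(\<Sum>C\<in>?P. deg (v C)) = (\<Sum>C\<in>?P \<inter> ?Q. deg (v C)) + (\<Sum>C\<in>?P - ?Q. deg (v C))"
    using fin by (subst sum.union_disjoint[symmetric]) (auto intro: sum.cong)
  have Q: "(\<Sum>C\<in>?Q. deg (v' C)) = (\<Sum>C\<in>?P \<inter> ?Q. deg (v' C)) + (\<Sum>C\<in>?Q - ?P. deg (v' C))"
    using fin by (subst sum.union_disjoint[symmetric]) (auto intro: sum.cong)
  have "(\<exists>a b c. a \<noteq> b \<and> ?P - ?Q = {a, b} \<and> ?Q - ?P = {c} \<and> mbar (v a) (v b) (v' c) = 1) \<or>
      (\<exists>a b c. a \<noteq> b \<and> ?P - ?Q = {c} \<and> ?Q - ?P = {a, b} \<and> Deltabar (v c) (v' a) (v' b) = 1)"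
    using e unfolding edge_coeff_def of_bool_eq_0_iff not_not by (rule conjunct2)
  then have "(\<Sum>C\<in>?P - ?Q. deg (v C)) = (\<Sum>C\<in>?Q - ?P. deg (v' C)) + 1"
    by (elim disjE exE conjE) (simp_all add: deg_mbar deg_Deltabar)
  then show ?thesis using P Q common by simp
qed

lemma boundary_chains:
  assumes D: "link_diagram D" and c: "c \<in> chains D i j"
  shows "boundary D c \<in> chains D (i + 1) j"
  unfolding chains_def
proof (intro CollectI allI impI)
  fix s assume nz: "boundary D c s \<noteq> 0"
  obtain \<alpha>' v' where s: "s = (\<alpha>', v')" by fastforce
  have st: "s \<in> states D"
    and "(\<Sum>(\<alpha>, v) \<in> {(\<alpha>, v) \<in> states D. cube_edge D \<alpha> \<alpha>'}. c (\<alpha>, v) * edge_coeff D \<alpha> \<alpha>' v v') \<noteq> 0"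
    using nz by (auto simp: s boundary_def split: if_splits)
  then obtain x where "x \<in> {(\<alpha>, v) \<in> states D. cube_edge D \<alpha> \<alpha>'}"
      "(case x of (\<alpha>, v) \<Rightarrow> c (\<alpha>, v) * edge_coeff D \<alpha> \<alpha>' v v') \<noteq> 0"
    by (meson sum.neutral)
  then obtain \<alpha> v where x: "(\<alpha>, v) \<in> states D" "cube_edge D \<alpha> \<alpha>'"
    and prod: "c (\<alpha>, v) * edge_coeff D \<alpha> \<alpha>' v v' \<noteq> 0"
    by (cases x) auto
  have nz': "c (\<alpha>, v) \<noteq> 0" "edge_coeff D \<alpha> \<alpha>' v v' \<noteq> 0"
    using mult_not_zero[OF prod] by blast+
  have "hdeg D (\<alpha>, v) = i" "qdeg D (\<alpha>, v) = j" using c nz'(1) unfolding chains_def by blast+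
  moreover have "finite \<alpha>" using x(1) by (auto simp: states_def intro: finite_subset)
  moreover obtain r where "r \<notin> \<alpha>" "\<alpha>' = insert r \<alpha>" using x(2) by (auto simp: cube_edge_def)
  ultimately show "s \<in> states D \<and> hdeg D s = i + 1 \<and> qdeg D s = j"
    using st edge_coeff_deg[OF D nz'(2)] by (simp add: s hdeg_def qdeg_def)
qed

lemma supported_chains: "c \<in> chains D i j \<Longrightarrow> supported D c"
  unfolding chains_def supported_def by blast

text \<open>
  The subspaces of a space of functions over the field with two elements: closure under scalar
  multiples is automatic.
\<close>

definition closed_add :: "('a \<Rightarrow> bit) set \<Rightarrow> bool" where
  "closed_add G \<longleftrightarrow> (\<lambda>_. 0) \<in> G \<and> (\<forall>c\<in>G. \<forall>d\<in>G. (\<lambda>s. c s + d s) \<in> G)"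

lemma closed_add_chains: "closed_add (chains D i j)"
  by (simp add: closed_add_def chains_add chains_zero)

lemma closed_add_cycles: "closed_add (cycles D i j)"
  by (simp add: closed_add_def cycles_def chains_add chains_zero boundary_add boundary_zero)

lemma closed_add_boundaries: "closed_add (boundaries D i j)"
  unfolding closed_add_def boundaries_def
proof (intro conjI ballI)
  show "(\<lambda>_. 0) \<in> boundary D ` chains D (i - 1) j"
    using boundary_zero chains_zero by (metis imageI)
  fix c d assume "c \<in> boundary D ` chains D (i - 1) j" "d \<in> boundary D ` chains D (i - 1) j"
  then obtain c' d' where "c' \<in> chains D (i - 1) j" "c = boundary D c'" "d' \<in> chains D (i - 1) j" "d = boundary D d'"
    by blast
  then show "(\<lambda>s. c s + d s) \<in> boundary D ` chains D (i - 1) j"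
    by (simp add: boundary_add[symmetric] chains_add)
qed

lemma boundaries_subset_cycles:
  assumes "link_diagram D"
  shows "boundaries D i j \<subseteq> cycles D i j"
  using boundary_chains[OF assms, of _ "i - 1" j] boundary_boundary[OF assms]
  by (auto simp: boundaries_def cycles_def)

lemma bij_betw_chains:
  "bij_betw (\<lambda>T s. of_bool (s \<in> T)) (Pow {s \<in> states D. hdeg D s = i \<and> qdeg D s = j}) (chains D i j)"
proof (rule bij_betwI')
  fix S T :: "state set"
  show "(\<lambda>s. of_bool (s \<in> S) :: bit) = (\<lambda>s. of_bool (s \<in> T)) \<longleftrightarrow> S = T"
    by (auto simp: fun_eq_iff)
next
  fix S assume "S \<in> Pow {s \<in> states D. hdeg D s = i \<and> qdeg D s = j}"
  then show "(\<lambda>s. of_bool (s \<in> S)) \<in> chains D i j" by (auto simp: chains_def)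
next
  fix c assume "c \<in> chains D i j"
  then have "{s. c s = 1} \<in> Pow {s \<in> states D. hdeg D s = i \<and> qdeg D s = j}"
    by (auto simp: chains_def)
  moreover have "c = (\<lambda>s. of_bool (s \<in> {s. c s = 1}))" by (auto simp: fun_eq_iff)
  ultimately show "\<exists>S\<in>Pow {s \<in> states D. hdeg D s = i \<and> qdeg D s = j}. c = (\<lambda>s. of_bool (s \<in> S))" by blast
qed

lemma card_chains:
  assumes "link_diagram D"
  shows "finite (chains D i j)" "card (chains D i j) = 2 ^ card {s \<in> states D. hdeg D s = i \<and> qdeg D s = j}"
proof -
  have "finite {s \<in> states D. hdeg D s = i \<and> qdeg D s = j}" using finite_states[OF assms] by simp
  then show "finite (chains D i j)" "card (chains D i j) = 2 ^ card {s \<in> states D. hdeg D s = i \<and> qdeg D s = j}"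
    using bij_betw_finite[OF bij_betw_chains[of D i j]] bij_betw_same_card[OF bij_betw_chains[of D i j]]
    by (simp_all add: card_Pow)
qed

text \<open>
  All nonempty fibres are translates of the kernel.
\<close>

lemma card_kernel_image:
  fixes G :: "('a \<Rightarrow> bit) set" and f :: "('a \<Rightarrow> bit) \<Rightarrow> ('b \<Rightarrow> bit)"
  assumes fin: "finite G" and G: "closed_add G"
    and f: "\<And>c d. f (\<lambda>s. c s + d s) = (\<lambda>s. f c s + f d s)"
  shows "card G = card {c \<in> G. f c = (\<lambda>_. 0)} * card (f ` G)"
proof -
  let ?K = "{c \<in> G. f c = (\<lambda>_. 0)}"
  have fib: "card {c \<in> G. f c = y} = card ?K" if y: "y \<in> f ` G" for y
  proof -
    obtain d where d: "d \<in> G" "y = f d" using y by auto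
    have closed: "(\<lambda>s. c s + d s) \<in> G" if "c \<in> G" for c
      using G that d(1) by (simp add: closed_add_def)
    have "bij_betw (\<lambda>c s. c s + d s) ?K {c \<in> G. f c = y}"
    proof (rule bij_betw_byWitness[where f' = "\<lambda>c s. c s + d s"])
      show "(\<lambda>c s. c s + d s) ` ?K \<subseteq> {c \<in> G. f c = y}"
        by (intro image_subsetI CollectI conjI closed) (simp_all add: f d(2))
      show "(\<lambda>c s. c s + d s) ` {c \<in> G. f c = y} \<subseteq> ?K"
        by (intro image_subsetI CollectI conjI closed) (simp_all add: f d(2))
    qed (simp_all add: add.assoc)
    then show ?thesis by (rule bij_betw_same_card[symmetric])
  qed
  have "card G = card (\<Union>y\<in>f ` G. {c \<in> G. f c = y})" by (rule arg_cong[of _ _ card]) auto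
  also have "\<dots> = (\<Sum>y\<in>f ` G. card {c \<in> G. f c = y})"
    by (rule card_UN_disjoint) (use fin in auto)
  also have "\<dots> = card ?K * card (f ` G)" using fib by simp
  finally show ?thesis .
qed

lemma card_cycles_boundaries:
  assumes "link_diagram D"
  shows "card (chains D i j) = card (cycles D i j) * card (boundaries D (i + 1) j)"
  using card_kernel_image[where f = "boundary D", OF card_chains(1)[OF assms] closed_add_chains boundary_add]
  by (simp add: cycles_def boundaries_def)

section \<open>Homology over the field with two elements\<close>

text \<open>
  The coordinates with respect to a basis put the vectors in bijection with the functions from
  the basis to the field.
\<close>

lemma (in vectorspace) card_carrier:
  assumes fin: "finite (carrier V)"
  shows "card (carrier V) = card (carrier K) ^ dim"
proof -
  have "span (carrier V) = carrier V"
    using span_is_subset2[of "carrier V"] in_own_span[of "carrier V"] by auto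
  then have "fin_dim" unfolding fin_dim_def using fin by blast
  then obtain B where B: "finite B" "basis B" using finite_basis_exists by blast
  then have sub: "B \<subseteq> carrier V" by (simp add: basis_def)
  have uniq: "\<exists>!a. a \<in> B \<rightarrow>\<^sub>E carrier K \<and> lincomb a B = v" if "v \<in> carrier V" for v
    using basis_criterion[OF B(1) sub] B(2) that by blast
  have "bij_betw (\<lambda>a. lincomb a B) (B \<rightarrow>\<^sub>E carrier K) (carrier V)"
    unfolding bij_betw_def
  proof (intro conjI inj_onI equalityI subsetI)
    have closed: "lincomb a B \<in> carrier V" if "a \<in> B \<rightarrow>\<^sub>E carrier K" for a
      using that B(1) sub by (intro lincomb_closed) auto
    then show "v \<in> carrier V" if "v \<in> (\<lambda>a. lincomb a B) ` (B \<rightarrow>\<^sub>E carrier K)" for v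
      using that by auto
    show "a = b" if "a \<in> B \<rightarrow>\<^sub>E carrier K" "b \<in> B \<rightarrow>\<^sub>E carrier K" "lincomb a B = lincomb b B" for a b
      using uniq[OF closed[OF that(1)]] that by metis
    show "v \<in> (\<lambda>a. lincomb a B) ` (B \<rightarrow>\<^sub>E carrier K)" if "v \<in> carrier V" for v
      using uniq[OF that] by blast
  qed
  then have "card (carrier V) = card (B \<rightarrow>\<^sub>E carrier K)" by (metis bij_betw_same_card)
  also have "\<dots> = card (carrier K) ^ card B" using B(1) by (simp add: card_PiE)
  finally show ?thesis using dim_basis[OF B] by simp
qed

text \<open>
  The only scalars are 0 and 1, so the laws for scalar multiples reduce to the group laws of the
  quotient and to \<open>S + S = 0\<close>.
\<close>

lemma quotient_space_vectorspace:
  fixes V :: "(bit, 'v) module" and W :: "'v set"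
  assumes W: "abelian_subgroup W V"
    and double: "\<And>v. v \<in> carrier V \<Longrightarrow> v \<oplus>\<^bsub>V\<^esub> v = \<zero>\<^bsub>V\<^esub>"
    and zero: "\<And>v. v \<in> carrier V \<Longrightarrow> 0 \<odot>\<^bsub>V\<^esub> v = \<zero>\<^bsub>V\<^esub>"
    and one: "\<And>v. v \<in> carrier V \<Longrightarrow> 1 \<odot>\<^bsub>V\<^esub> v = v"
  shows "vectorspace (class_ring :: bit ring) (quotient_space V W)"
proof -
  interpret abelian_subgroup W V by (rule W)
  let ?c = "\<lambda>v. W +>\<^bsub>V\<^esub> v"
  have ex: "\<exists>v \<in> carrier V. S = ?c v" if "S \<in> a_rcosets\<^bsub>V\<^esub> W" for S
    using that by (auto simp: A_RCOSETS_def')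
  have mem: "?c v \<in> a_rcosets\<^bsub>V\<^esub> W" if "v \<in> carrier V" for v
    using that by (auto simp: A_RCOSETS_def')
  have W0: "W = ?c \<zero>\<^bsub>V\<^esub>" using a_subset by simp
  have s1: "W <+>\<^bsub>V\<^esub> ((\<lambda>v. 1 \<odot>\<^bsub>V\<^esub> v) ` S) = S" if S: "S \<in> a_rcosets\<^bsub>V\<^esub> W" for S
  proof -
    have "S \<subseteq> carrier V" using a_rcosets_part_G S by blast
    then have "(\<lambda>v. 1 \<odot>\<^bsub>V\<^esub> v) ` S = (\<lambda>v. v) ` S" by (intro image_cong) (use one in auto)
    then show ?thesis using rcosets_add_eq[OF S] by simp
  qed
  have s0: "W <+>\<^bsub>V\<^esub> ((\<lambda>v. 0 \<odot>\<^bsub>V\<^esub> v) ` S) = W" if S: "S \<in> a_rcosets\<^bsub>V\<^esub> W" for S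
  proof -
    have "S \<subseteq> carrier V" using a_rcosets_part_G S by blast
    moreover obtain v where "v \<in> carrier V" "S = ?c v" using ex[OF S] by blast
    ultimately have "(\<lambda>v. 0 \<odot>\<^bsub>V\<^esub> v) ` S = (\<lambda>_. \<zero>\<^bsub>V\<^esub>) ` S" "S \<noteq> {}"
      using zero a_rcos_self by (auto intro!: image_cong)
    then have "(\<lambda>v. 0 \<odot>\<^bsub>V\<^esub> v) ` S = {\<zero>\<^bsub>V\<^esub>}" by auto
    then show ?thesis using a_subset by (auto simp: set_add_def') 
  qed
  have smult: "W <+>\<^bsub>V\<^esub> ((\<lambda>v. k \<odot>\<^bsub>V\<^esub> v) ` S) = (if k = 0 then W else S)" if "S \<in> a_rcosets\<^bsub>V\<^esub> W" for k S
    using s0[OF that] s1[OF that] by (cases k) simp_all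
  have closed: "S <+>\<^bsub>V\<^esub> T \<in> a_rcosets\<^bsub>V\<^esub> W" if "S \<in> a_rcosets\<^bsub>V\<^esub> W" "T \<in> a_rcosets\<^bsub>V\<^esub> W" for S T
    by (rule a_setmult_closed[OF that])
  have comm: "S <+>\<^bsub>V\<^esub> T = T <+>\<^bsub>V\<^esub> S" if "S \<in> a_rcosets\<^bsub>V\<^esub> W" "T \<in> a_rcosets\<^bsub>V\<^esub> W" for S T
    using ex[OF that(1)] ex[OF that(2)] by (auto simp: a_rcos_sum a_comm)
  have assoc: "(S <+>\<^bsub>V\<^esub> T) <+>\<^bsub>V\<^esub> R = S <+>\<^bsub>V\<^esub> (T <+>\<^bsub>V\<^esub> R)"
    if "S \<in> a_rcosets\<^bsub>V\<^esub> W" "T \<in> a_rcosets\<^bsub>V\<^esub> W" "R \<in> a_rcosets\<^bsub>V\<^esub> W" for S T R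
    by (rule a_rcosets_assoc[OF that])
  have W: "W \<in> a_rcosets\<^bsub>V\<^esub> W" using mem[of "\<zero>\<^bsub>V\<^esub>"] W0 by simp
  have self: "S <+>\<^bsub>V\<^esub> S = W" if S: "S \<in> a_rcosets\<^bsub>V\<^esub> W" for S
  proof -
    obtain v where "v \<in> carrier V" "S = ?c v" using ex[OF S] by blast
    then show ?thesis using a_rcos_sum[of v v] double[of v] W0 by simp
  qed
  have unit: "S <+>\<^bsub>V\<^esub> W = S" if "S \<in> a_rcosets\<^bsub>V\<^esub> W" for S
    using rcosets_add_eq[OF that] comm[OF that W] by simp
  show ?thesis
  proof (rule vs_criteria)
    show "field (class_ring :: bit ring)" by (rule class_field)
    show "\<forall>v\<in>carrier (quotient_space V W). \<exists>neg_v\<in>carrier (quotient_space V W).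
        v \<oplus>\<^bsub>quotient_space V W\<^esub> neg_v = \<zero>\<^bsub>quotient_space V W\<^esub>"
      using self by (auto simp: quotient_space_def)
    show "\<forall>a b v. a \<in> carrier class_ring \<and> b \<in> carrier class_ring \<and> v \<in> carrier (quotient_space V W) \<longrightarrow>
        (a \<oplus>\<^bsub>class_ring\<^esub> b) \<odot>\<^bsub>quotient_space V W\<^esub> v
          = a \<odot>\<^bsub>quotient_space V W\<^esub> v \<oplus>\<^bsub>quotient_space V W\<^esub> b \<odot>\<^bsub>quotient_space V W\<^esub> v"
    proof (intro allI impI, elim conjE)
      fix a b v assume "v \<in> carrier (quotient_space V W)"
      then show "(a \<oplus>\<^bsub>class_ring\<^esub> b) \<odot>\<^bsub>quotient_space V W\<^esub> v
          = a \<odot>\<^bsub>quotient_space V W\<^esub> v \<oplus>\<^bsub>quotient_space V W\<^esub> b \<odot>\<^bsub>quotient_space V W\<^esub> v"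
        by (cases a; cases b) (simp_all add: quotient_space_def smult W self unit comm[OF W])
    qed
  qed (simp_all add: quotient_space_def smult closed assoc W unit self, simp add: comm)
qed


lemma abelian_group_cycle_space: "abelian_group (cycle_space D i j)"
proof (rule abelian_groupI)
  fix x assume "x \<in> carrier (cycle_space D i j)"
  then show "\<exists>y\<in>carrier (cycle_space D i j). y \<oplus>\<^bsub>cycle_space D i j\<^esub> x = \<zero>\<^bsub>cycle_space D i j\<^esub>"
    by (intro bexI[of _ x]) (simp_all add: cycle_space_def)
qed (use closed_add_cycles[of D i j] in \<open>auto simp: cycle_space_def closed_add_def ac_simps\<close>)

lemma abelian_subgroup_boundaries:
  assumes "link_diagram D"
  shows "abelian_subgroup (boundaries D i j) (cycle_space D i j)"
proof (rule abelian_subgroupI3)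
  interpret abelian_group "cycle_space D i j" by (rule abelian_group_cycle_space)
  show "additive_subgroup (boundaries D i j) (cycle_space D i j)"
  proof (rule additive_subgroupI, rule add.subgroupI)
    show "boundaries D i j \<subseteq> carrier (cycle_space D i j)"
      using boundaries_subset_cycles[OF assms] by (simp add: cycle_space_def)
    show "boundaries D i j \<noteq> {}" using closed_add_boundaries[of D i j] by (auto simp: closed_add_def)
    show "a \<oplus>\<^bsub>cycle_space D i j\<^esub> b \<in> boundaries D i j" if "a \<in> boundaries D i j" "b \<in> boundaries D i j" for a b
      using closed_add_boundaries[of D i j] that by (simp add: closed_add_def cycle_space_def)
    fix a assume a: "a \<in> boundaries D i j"
    have "\<ominus>\<^bsub>cycle_space D i j\<^esub> a = a"
    proof (rule minus_equality)
      show "a \<oplus>\<^bsub>cycle_space D i j\<^esub> a = \<zero>\<^bsub>cycle_space D i j\<^esub>" by (simp add: cycle_space_def)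
    qed (use a boundaries_subset_cycles[OF assms] in \<open>auto simp: cycle_space_def\<close>)
    then show "\<ominus>\<^bsub>cycle_space D i j\<^esub> a \<in> boundaries D i j" using a by simp
  qed
qed (rule abelian_group_cycle_space)

lemma finite_cycles: "link_diagram D \<Longrightarrow> finite (cycles D i j)"
  using card_chains(1)[of D i j] by (auto simp: cycles_def)

lemma vectorspace_KH:
  assumes "link_diagram D"
  shows "vectorspace (class_ring :: bit ring) (KH D i j)"
  unfolding KH_def
  by (rule quotient_space_vectorspace[OF abelian_subgroup_boundaries[OF assms]])
    (simp_all add: cycle_space_def)

lemma carrier_KH: "carrier (KH D i j) = (\<lambda>z. (\<lambda>b s. b s + z s) ` boundaries D i j) ` cycles D i j"
  by (auto simp: KH_def quotient_space_def A_RCOSETS_def' a_r_coset_def' cycle_space_def)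

text \<open>
  Over a finite field dimensions can be read off from cardinalities. This turns rank
  computations into the theorem of Lagrange.
\<close>

lemma card_KH:
  assumes D: "link_diagram D"
  shows "card (carrier (KH D i j)) = 2 ^ dim_KH D i j"
    and "card (cycles D i j) = 2 ^ dim_KH D i j * card (boundaries D i j)"
proof -
  interpret abelian_subgroup "boundaries D i j" "cycle_space D i j"
    by (rule abelian_subgroup_boundaries[OF D])
  have fin: "finite (carrier (KH D i j))" using finite_cycles[OF D] by (simp add: carrier_KH)
  have "card (UNIV :: bit set) = card {0 :: bit, 1}"
    by (rule arg_cong[of _ _ card]) (auto intro: bit.exhaust)
  then have "card (UNIV :: bit set) = 2" by simp
  then show card: "card (carrier (KH D i j)) = 2 ^ dim_KH D i j"
    using vectorspace.card_carrier[OF vectorspace_KH[OF D] fin] by (simp add: dim_KH_def)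
  have "card (carrier (KH D i j)) * card (boundaries D i j) = card (cycles D i j)"
    using a_lagrange[OF _ additive_subgroup_axioms] finite_cycles[OF D]
    by (simp add: KH_def quotient_space_def Coset.order_def cycle_space_def)
  then show "card (cycles D i j) = 2 ^ dim_KH D i j * card (boundaries D i j)"
    using card by simp
qed

lemma coset_eq_iff:
  fixes B :: "('a \<Rightarrow> bit) set"
  assumes B: "closed_add B"
  shows "(\<lambda>b s. b s + x s) ` B = (\<lambda>b s. b s + y s) ` B \<longleftrightarrow> (\<lambda>s. x s + y s) \<in> B"
proof
  have sub: "(\<lambda>b s. b s + x s) ` B \<subseteq> (\<lambda>b s. b s + y s) ` B" if "(\<lambda>s. x s + y s) \<in> B" for x y
  proof (rule image_subsetI)
    fix b assume "b \<in> B"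
    then have "(\<lambda>s. b s + (x s + y s)) \<in> B" using B that by (simp add: closed_add_def)
    then show "(\<lambda>s. b s + x s) \<in> (\<lambda>b s. b s + y s) ` B"
      by (intro image_eqI[where x = "\<lambda>s. b s + (x s + y s)"]) (simp_all add: add.assoc)
  qed
  assume "(\<lambda>s. x s + y s) \<in> B"
  moreover from this have "(\<lambda>s. y s + x s) \<in> B" by (simp add: add.commute)
  ultimately show "(\<lambda>b s. b s + x s) ` B = (\<lambda>b s. b s + y s) ` B" using sub by blast
next
  assume eq: "(\<lambda>b s. b s + x s) ` B = (\<lambda>b s. b s + y s) ` B"
  have "(\<lambda>s. 0 + x s) \<in> (\<lambda>b s. b s + x s) ` B"
    by (rule imageI[of "\<lambda>_. 0" B "\<lambda>b s. b s + x s"]) (use B in \<open>simp add: closed_add_def\<close>)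
  then obtain b where b: "b \<in> B" "x = (\<lambda>s. b s + y s)" unfolding eq by auto
  then have "(\<lambda>s. x s + y s) = b" by (simp add: add.assoc)
  then show "(\<lambda>s. x s + y s) \<in> B" using b by simp
qed

lemma boundaries_eq_cycles:
  assumes D: "link_diagram D" and "KH_concentrated D s" and "j - 2 * i \<notin> {s - 1, s + 1}"
  shows "boundaries D i j = cycles D i j"
proof
  show "boundaries D i j \<subseteq> cycles D i j" by (rule boundaries_subset_cycles[OF D])
  have "carrier (KH D i j) = {boundaries D i j}"
    using assms by (simp add: KH_concentrated_def KH_def quotient_space_def)
  have coset: "(\<lambda>b s. b s + z s) ` boundaries D i j = boundaries D i j" if "z \<in> cycles D i j" for z
  proof -
    have "(\<lambda>b s. b s + z s) ` boundaries D i j \<in> carrier (KH D i j)"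
      unfolding carrier_KH using that by (rule imageI)
    with \<open>carrier (KH D i j) = {boundaries D i j}\<close> show ?thesis by simp
  qed
  show "cycles D i j \<subseteq> boundaries D i j"
  proof
    fix z assume "z \<in> cycles D i j"
    then have "(\<lambda>b s. b s + z s) ` boundaries D i j = (\<lambda>b s. b s + 0) ` boundaries D i j" using coset by simp
    then show "z \<in> boundaries D i j" using coset_eq_iff[OF closed_add_boundaries, of z D i j "\<lambda>_. 0"] by simp
  qed
qed

lemma dim_KH_eq_0:
  assumes D: "link_diagram D" and "KH_concentrated D s" and "j - 2 * i \<notin> {s - 1, s + 1}"
  shows "dim_KH D i j = 0"
proof -
  have "card (carrier (KH D i j)) = 1" using assms by (simp add: KH_concentrated_def)
  then show ?thesis using card_KH(1)[OF D, of i j] by simp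
qed

text \<open>
  The condition on \<open>f\<close> says that the map induced on homology is injective. It is stated for
  cycles, as two of them are homologous if and only if their sum is a boundary.
\<close>

lemma dim_KH_mono:
  assumes D: "link_diagram D"
    and f: "\<And>c d. f (\<lambda>s. c s + d s) = (\<lambda>s. f c s + f d s)" "f ` cycles D i j \<subseteq> cycles D i' j'"
    and inj: "\<And>z. z \<in> cycles D i j \<Longrightarrow> f z \<in> boundaries D i' j' \<Longrightarrow> z \<in> boundaries D i j"
  shows "dim_KH D i j \<le> dim_KH D i' j'"
proof -
  let ?c = "\<lambda>z. (\<lambda>b s. b s + z s) ` boundaries D i j" and ?c' = "\<lambda>z. (\<lambda>b s. b s + z s) ` boundaries D i' j'"
  define rep where "rep = (\<lambda>S. SOME z. z \<in> cycles D i j \<and> S = ?c z)"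
  have rep: "rep S \<in> cycles D i j \<and> S = ?c (rep S)" if S: "S \<in> carrier (KH D i j)" for S
  proof -
    obtain z where "z \<in> cycles D i j \<and> S = ?c z" using S unfolding carrier_KH by blast
    then show ?thesis unfolding rep_def by (rule someI[of "\<lambda>z. z \<in> cycles D i j \<and> S = ?c z"])
  qed
  have "card (carrier (KH D i j)) \<le> card (carrier (KH D i' j'))"
  proof (rule card_inj_on_le[where f = "\<lambda>S. ?c' (f (rep S))"])
    show "inj_on (\<lambda>S. ?c' (f (rep S))) (carrier (KH D i j))"
    proof (rule inj_onI)
      fix S T assume S: "S \<in> carrier (KH D i j)" and T: "T \<in> carrier (KH D i j)"
        and "?c' (f (rep S)) = ?c' (f (rep T))"
      then have "f (\<lambda>s. rep S s + rep T s) \<in> boundaries D i' j'"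
        using coset_eq_iff[OF closed_add_boundaries] by (simp add: f(1))
      moreover have "(\<lambda>s. rep S s + rep T s) \<in> cycles D i j"
        using rep[OF S] rep[OF T] closed_add_cycles[of D i j] by (simp add: closed_add_def)
      ultimately have "(\<lambda>s. rep S s + rep T s) \<in> boundaries D i j" by (intro inj)
      then have "?c (rep S) = ?c (rep T)" using coset_eq_iff[OF closed_add_boundaries] by blast
      then show "S = T" using rep[OF S] rep[OF T] by metis
    qed
    show "(\<lambda>S. ?c' (f (rep S))) ` carrier (KH D i j) \<subseteq> carrier (KH D i' j')"
      unfolding carrier_KH[of D i' j'] using rep f(2) by (intro image_subsetI imageI) blast
    show "finite (carrier (KH D i' j'))" using finite_cycles[OF D] by (simp add: carrier_KH)
  qed
  then show ?thesis by (simp add: card_KH(1)[OF D])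
qed

text \<open>
  For a cycle \<open>z\<close> on the upper diagonal, \<open>erase_x z\<close> is a boundary, its bidegree lying above
  both diagonals. If \<open>mult_x z\<close> is a boundary as well, the homotopy formula shows that \<open>z\<close>
  is one. So \<open>mult_x\<close> is injective from the upper to the lower diagonal, and for the same
  reason \<open>erase_x\<close> is injective in the other direction.
\<close>

proposition dim_KH_thin:
  assumes D: "link_diagram D" and p: "p \<in> arcs D" and thin: "KH_concentrated D s"
  shows "dim_KH D i (s + 1 + 2 * i) = dim_KH D i (s - 1 + 2 * i)"
proof -
  define j where "j = s - 1 + 2 * i"
  have X_cycles: "mult_x D p z \<in> cycles D i (j - 2)" if "z \<in> cycles D i j" for z j
    using that mult_x_chains[OF D p] by (simp add: cycles_def mult_x_boundary[OF D p, symmetric])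
      (simp add: mult_x_def fun_eq_iff)
  have N_cycles: "erase_x D z \<in> cycles D i (j + 2)" if "z \<in> cycles D i j" for z j
    using that erase_x_chains[OF D] by (simp add: cycles_def erase_x_boundary[OF D, symmetric])
      (simp add: erase_x_def fun_eq_iff)
  have X_bound: "mult_x D p z \<in> boundaries D i (j - 2)" if "z \<in> boundaries D i j" for z j
    using that mult_x_chains[OF D p] by (auto simp: boundaries_def mult_x_boundary[OF D p])
  have N_bound: "erase_x D z \<in> boundaries D i (j + 2)" if "z \<in> boundaries D i j" for z j
    using that erase_x_chains[OF D] by (auto simp: boundaries_def erase_x_boundary[OF D])
  have sum: "z \<in> boundaries D i j"
    if "z \<in> cycles D i j" "erase_x D (mult_x D p z) \<in> boundaries D i j" "mult_x D p (erase_x D z) \<in> boundaries D i j" for z j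
  proof -
    have "supported D z" using that(1) supported_chains by (auto simp: cycles_def)
    moreover have "(\<lambda>s. erase_x D (mult_x D p z) s + mult_x D p (erase_x D z) s) \<in> boundaries D i j"
      using that(2,3) closed_add_boundaries[of D i j] unfolding closed_add_def by blast
    ultimately show ?thesis by (simp only: erase_x_mult_x[OF D p])
  qed
  have "dim_KH D i (j + 2) \<le> dim_KH D i j"
  proof (rule dim_KH_mono[OF D, of "mult_x D p"])
    show "mult_x D p ` cycles D i (j + 2) \<subseteq> cycles D i j" using X_cycles[of _ "j + 2"] by auto
    fix z assume z: "z \<in> cycles D i (j + 2)" and Xz: "mult_x D p z \<in> boundaries D i j"
    have "erase_x D z \<in> boundaries D i (j + 2 + 2)"
      using N_cycles[OF z] boundaries_eq_cycles[OF D thin, of "j + 2 + 2" i] by (simp add: j_def)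
    then have "mult_x D p (erase_x D z) \<in> boundaries D i (j + 2)" using X_bound[of _ "j + 2 + 2"] by (simp add: add.commute)
    then show "z \<in> boundaries D i (j + 2)" using sum[OF z] N_bound[OF Xz] by blast
  qed (rule mult_x_add)
  moreover have "dim_KH D i j \<le> dim_KH D i (j + 2)"
  proof (rule dim_KH_mono[OF D, of "erase_x D"])
    show "erase_x D ` cycles D i j \<subseteq> cycles D i (j + 2)" using N_cycles[of _ j] by auto
    fix z assume z: "z \<in> cycles D i j" and Nz: "erase_x D z \<in> boundaries D i (j + 2)"
    have "mult_x D p z \<in> boundaries D i (j - 2)"
      using X_cycles[OF z] boundaries_eq_cycles[OF D thin, of "j - 2" i] by (simp add: j_def)
    then have "erase_x D (mult_x D p z) \<in> boundaries D i j" using N_bound[of _ "j - 2"] by simp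
    moreover have "mult_x D p (erase_x D z) \<in> boundaries D i j" using X_bound[OF Nz] by simp
    ultimately show "z \<in> boundaries D i j" using sum[OF z] by blast
  qed (rule erase_x_add)
  moreover have "s + 1 + 2 * i = j + 2" by (simp add: j_def)
  ultimately show ?thesis unfolding j_def[symmetric] by (simp only:)
qed


section \<open>The Euler characteristic\<close>

text \<open>
  The power \<open>(-1)\<^sup>i\<close> for an integer exponent, with values in the integers.
\<close>

definition parity_sign :: "int \<Rightarrow> int" where
  "parity_sign i = (if even i then 1 else -1)"

lemma parity_sign_add_1 [simp]: "parity_sign (i + 1) = - parity_sign i"
  by (simp add: parity_sign_def)

lemma hdeg_bounds: "s \<in> states D \<Longrightarrow> hdeg D s \<in> {- int (ncross D)..int (ncross D)}"
proof -
  assume s: "s \<in> states D"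
  then obtain \<alpha> v where *: "s = (\<alpha>, v)" "\<alpha> \<subseteq> {..<ncross D}" by (auto simp: states_def)
  have "card \<alpha> \<le> ncross D" using card_mono[OF _ *(2)] by simp
  moreover have "n_neg D \<le> ncross D"
    using card_mono[of "{..<ncross D}" "{r. r < ncross D \<and> \<not> positive D r}"] by (auto simp: n_neg_def)
  ultimately show ?thesis by (simp add: * hdeg_def)
qed

text \<open>
  The numbers \<open>\<beta> i\<close> are the dimensions of the spaces of boundaries.
\<close>

lemma chain_dimension:
  assumes D: "link_diagram D"
  obtains \<beta> where "\<And>i. card {s \<in> states D. hdeg D s = i \<and> qdeg D s = j} = dim_KH D i j + \<beta> i + \<beta> (i + 1)"
proof -
  have "\<exists>m. card (boundaries D i j) = 2 ^ m" for i
  proof -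
    have "card (boundaries D (i - 1 + 1) j) dvd card (chains D (i - 1) j)"
      using card_cycles_boundaries[OF D, of "i - 1" j] by simp
    then have "card (boundaries D i j) dvd 2 ^ card {s \<in> states D. hdeg D s = i - 1 \<and> qdeg D s = j}"
      by (simp add: card_chains(2)[OF D])
    then show ?thesis using divides_primepow_nat[OF two_is_prime_nat] by blast
  qed
  then obtain \<beta> where \<beta>: "\<And>i. card (boundaries D i j) = 2 ^ \<beta> i" by metis
  show thesis
  proof (rule that)
    fix i
    have "(2::nat) ^ card {s \<in> states D. hdeg D s = i \<and> qdeg D s = j} = 2 ^ (dim_KH D i j + \<beta> i + \<beta> (i + 1))"
      using card_cycles_boundaries[OF D, of i j] card_KH(2)[OF D, of i j] by (simp add: card_chains(2)[OF D] \<beta> power_add)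
    then show "card {s \<in> states D. hdeg D s = i \<and> qdeg D s = j} = dim_KH D i j + \<beta> i + \<beta> (i + 1)"
      by (simp only: power_inject_exp one_less_numeral_iff semiring_norm)
  qed
qed

text \<open>
  The contributions of the boundaries to neighbouring degrees cancel.
\<close>

lemma euler_characteristic_row:
  assumes D: "link_diagram D"
  defines "I \<equiv> {- int (ncross D)..int (ncross D)}"
  shows "(\<Sum>i\<in>I. parity_sign i * int (card {s \<in> states D. hdeg D s = i \<and> qdeg D s = j}))
    = (\<Sum>i\<in>I. parity_sign i * int (dim_KH D i j))"
proof -
  obtain \<beta> where \<beta>: "\<And>i. card {s \<in> states D. hdeg D s = i \<and> qdeg D s = j} = dim_KH D i j + \<beta> i + \<beta> (i + 1)"
    using chain_dimension[OF D] by blast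
  let ?n = "int (ncross D)"
  have none: "{s \<in> states D. hdeg D s = i \<and> qdeg D s = j} = {}" if "i \<notin> I" for i
    using that hdeg_bounds[of _ D] by (auto simp: I_def)
  have out: "\<beta> i = 0 \<and> \<beta> (i + 1) = 0" if "i \<notin> I" for i
    using \<beta>[of i] unfolding none[OF that] by simp
  \<comment> \<open>Boundaries in degree \<open>- n\<close> come from degree \<open>- n - 1\<close>, where there are no states.\<close>
  have ends: "\<beta> (- ?n) = 0" "\<beta> (?n + 1) = 0"
    using out[of "- ?n - 1"] out[of "?n + 1"] by (auto simp: I_def)
  have "(\<Sum>i\<in>I. parity_sign i * int (\<beta> (i + 1))) = (\<Sum>i\<in>(\<lambda>i. i + 1) ` I. - (parity_sign i * int (\<beta> i)))"
    by (subst sum.reindex) (auto simp: inj_on_def intro!: sum.cong)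
  also have "\<dots> = (\<Sum>i\<in>I. - (parity_sign i * int (\<beta> i)))"
  proof (rule sum.mono_neutral_cong)
    show "finite ((\<lambda>i. i + 1) ` I)" "finite I" by (auto simp: I_def)
    fix i assume i: "i \<in> I - (\<lambda>i. i + 1) ` I"
    then have "i - 1 \<notin> I" by (metis DiffD2 diff_add_cancel image_eqI)
    then have "i = - ?n" using i by (auto simp: I_def)
    then show "- (parity_sign i * int (\<beta> i)) = 0" using ends by simp
  qed (use out in auto)
  finally have "(\<Sum>i\<in>I. parity_sign i * int (\<beta> i)) + (\<Sum>i\<in>I. parity_sign i * int (\<beta> (i + 1))) = 0"
    by (simp add: sum_negf)
  then show ?thesis by (simp add: \<beta> distrib_left sum.distrib)
qed

lemma dim_KH_nonzero:
  assumes D: "link_diagram D" and "dim_KH D i j \<noteq> 0"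
  shows "i \<in> {- int (ncross D)..int (ncross D)}" "j \<in> qdeg D ` states D"
proof -
  obtain \<beta> where \<beta>: "\<And>i. card {s \<in> states D. hdeg D s = i \<and> qdeg D s = j} = dim_KH D i j + \<beta> i + \<beta> (i + 1)"
    using chain_dimension[OF D] by blast
  then have "card {s \<in> states D. hdeg D s = i \<and> qdeg D s = j} \<noteq> 0" using assms(2) by simp
  then obtain s where "s \<in> states D" "hdeg D s = i" "qdeg D s = j" by (auto simp: card_eq_0_iff)
  then show "i \<in> {- int (ncross D)..int (ncross D)}" "j \<in> qdeg D ` states D" using hdeg_bounds[of s D] by auto
qed

proposition euler_characteristic:
  assumes D: "link_diagram D"
  shows "(\<Sum>i = - int (ncross D)..int (ncross D). \<Sum>j\<in>qdeg D ` states D. parity_sign i * int (dim_KH D i j))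
    = (\<Sum>s\<in>states D. parity_sign (hdeg D s))"
proof -
  let ?I = "{- int (ncross D)..int (ncross D)}" and ?J = "qdeg D ` states D"
  have fin: "finite (states D)" by (rule finite_states[OF D])
  have "(\<Sum>s\<in>states D. parity_sign (hdeg D s)) = (\<Sum>j\<in>?J. \<Sum>i\<in>?I. \<Sum>s | s \<in> {s \<in> states D. qdeg D s = j} \<and> hdeg D s = i. parity_sign (hdeg D s))"
  proof (subst sum.image_gen[OF fin, of _ "qdeg D"], rule sum.cong[OF refl])
    fix j
    show "(\<Sum>s | s \<in> states D \<and> qdeg D s = j. parity_sign (hdeg D s))
      = (\<Sum>i\<in>?I. \<Sum>s | s \<in> {s \<in> states D. qdeg D s = j} \<and> hdeg D s = i. parity_sign (hdeg D s))"
      using hdeg_bounds fin by (intro sum.group[symmetric]) auto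
  qed
  also have "\<dots> = (\<Sum>j\<in>?J. \<Sum>i\<in>?I. parity_sign i * int (card {s \<in> states D. hdeg D s = i \<and> qdeg D s = j}))"
  proof (intro sum.cong refl)
    fix i j
    have "{s. s \<in> {s \<in> states D. qdeg D s = j} \<and> hdeg D s = i} = {s \<in> states D. hdeg D s = i \<and> qdeg D s = j}" by auto
    then show "(\<Sum>s | s \<in> {s \<in> states D. qdeg D s = j} \<and> hdeg D s = i. parity_sign (hdeg D s))
      = parity_sign i * int (card {s \<in> states D. hdeg D s = i \<and> qdeg D s = j})"
      by simp
  qed
  also have "\<dots> = (\<Sum>j\<in>?J. \<Sum>i\<in>?I. parity_sign i * int (dim_KH D i j))"
    by (simp only: euler_characteristic_row[OF D])
  finally show ?thesis by (subst sum.swap) simp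
qed

section \<open>The state sum as a sum over labellings of the arcs\<close>

text \<open>
  The labelling \<open>f\<close> respects the joints of the 1-smoothing (if \<open>b\<close> holds) or of the
  0-smoothing at crossing \<open>r\<close>.
\<close>

definition agrees :: "link_diagram \<Rightarrow> (nat \<Rightarrow> label) \<Rightarrow> nat \<Rightarrow> bool \<Rightarrow> bool" where
  "agrees D f r b \<longleftrightarrow> (if b then f (arc D r 0) = f (arc D r 3) \<and> f (arc D r 1) = f (arc D r 2)
     else f (arc D r 0) = f (arc D r 1) \<and> f (arc D r 2) = f (arc D r 3))"

lemma bij_betw_circle_labels:
  assumes D: "link_diagram D"
  shows "bij_betw (\<lambda>v. \<lambda>a\<in>arcs D. v (same_circle D \<alpha> `` {a})) (circles D \<alpha> \<rightarrow>\<^sub>E (UNIV :: label set))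
    {f \<in> arcs D \<rightarrow>\<^sub>E UNIV. \<forall>r<ncross D. agrees D f r (r \<in> \<alpha>)}"
proof -
  let ?E = "same_circle D \<alpha>" and ?g = "\<lambda>v :: nat set \<Rightarrow> label. \<lambda>a\<in>arcs D. v (same_circle D \<alpha> `` {a})"
  have joined: "(arc D r p, arc D r p') \<in> ?E" if "r < ncross D" "(p, p') \<in> smoothing_pairs \<alpha> r" for r p p'
    unfolding same_circle_def using that by (intro eqv_base) (auto simp: joined_arcs_def)
  have cls: "?E `` {a} = ?E `` {b}" if "(a, b) \<in> ?E" for a b
    using equiv_class_eq[OF equiv_same_circle that] .
  show ?thesis
  proof (rule bij_betwI')
    fix v w :: "nat set \<Rightarrow> label" assume v: "v \<in> circles D \<alpha> \<rightarrow>\<^sub>E UNIV" and w: "w \<in> circles D \<alpha> \<rightarrow>\<^sub>E UNIV"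
    show "?g v = ?g w \<longleftrightarrow> v = w"
    proof
      assume eq: "?g v = ?g w"
      show "v = w"
      proof (rule PiE_ext[OF v w])
        fix C assume "C \<in> circles D \<alpha>"
        then obtain a where a: "a \<in> arcs D" "C = ?E `` {a}" by (auto simp: circles_eq quotient_def)
        then show "v C = w C" using fun_cong[OF eq, of a] by simp
      qed
    qed simp
  next
    fix v :: "nat set \<Rightarrow> label" assume "v \<in> circles D \<alpha> \<rightarrow>\<^sub>E UNIV"
    have "?g v (arc D r p) = ?g v (arc D r p')" if r: "r < ncross D" "(p, p') \<in> smoothing_pairs \<alpha> r" for r p p'
      using cls[OF joined[OF r]] arc_in_arcs[OF D r(1)] smoothing_pairs_less[OF r(2)] by simp
    then show "?g v \<in> {f \<in> arcs D \<rightarrow>\<^sub>E UNIV. \<forall>r<ncross D. agrees D f r (r \<in> \<alpha>)}"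
      unfolding agrees_def smoothing_pairs_def by (simp del: restrict_apply)
  next
    fix f :: "nat \<Rightarrow> label" assume f: "f \<in> {f \<in> arcs D \<rightarrow>\<^sub>E UNIV. \<forall>r<ncross D. agrees D f r (r \<in> \<alpha>)}"
    have "?E \<subseteq> {(a, b). f a = f b}"
      unfolding same_circle_def
    proof (rule eqv_least)
      show "joined_arcs D {..<ncross D} \<alpha> \<subseteq> {(a, b). f a = f b}"
        using f by (auto simp: joined_arcs_def smoothing_pairs_def agrees_def split: if_splits)
    qed (auto simp: equiv_def refl_on_def sym_def trans_def)
    then have const: "f a = f b" if "(a, b) \<in> ?E" for a b using that by auto
    define v where "v = (\<lambda>C\<in>circles D \<alpha>. f (SOME a. a \<in> C))"
    have "f = ?g v"
    proof
      fix a
      show "f a = ?g v a"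
      proof (cases "a \<in> arcs D")
        case True
        have "(SOME b. b \<in> ?E `` {a}) \<in> ?E `` {a}"
          by (rule someI[of _ a]) (use equiv_UNIV_refl[OF equiv_same_circle] in simp)
        then show ?thesis using True const circle_of_arc[OF True] by (simp add: v_def)
      next
        case False
        then show ?thesis using f by (auto simp: PiE_def extensional_def)
      qed
    qed
    moreover have "v \<in> circles D \<alpha> \<rightarrow>\<^sub>E UNIV" by (simp add: v_def)
    ultimately show "\<exists>v\<in>circles D \<alpha> \<rightarrow>\<^sub>E UNIV. f = ?g v" by blast
  qed
qed

text \<open>
  The difference of the contributions of the two smoothings of crossing \<open>r\<close>. The sign of the
  crossing accounts for the shift by \<open>n_neg\<close> in the homological degree.
\<close>

definition local_weight :: "link_diagram \<Rightarrow> (nat \<Rightarrow> label) \<Rightarrow> nat \<Rightarrow> int" where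
  "local_weight D f r = (if positive D r then 1 else -1) * (of_bool (agrees D f r False) - of_bool (agrees D f r True))"

lemma parity_sign_hdeg:
  assumes "\<alpha> \<subseteq> {..<ncross D}"
  shows "parity_sign (hdeg D (\<alpha>, v)) = (\<Prod>r<ncross D. if positive D r then 1 else -1) * (-1) ^ card \<alpha>"
proof -
  have "(\<Prod>r<ncross D. if positive D r then 1 else -1 :: int) = (-1) ^ n_neg D"
  proof -
    have "{..<ncross D} \<inter> - {r. positive D r} = {r. r < ncross D \<and> \<not> positive D r}" by auto
    then show ?thesis by (simp add: prod.If_cases n_neg_def)
  qed
  then show ?thesis by (simp add: parity_sign_def hdeg_def flip: power_add)
qed

text \<open>
  Replace the labellings of circles by labellings of arcs and exchange the sums. For a fixed
  labelling of the arcs the sum over the subsets \<open>\<alpha>\<close> expands a product over the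
  crossings.
\<close>

proposition state_sum:
  assumes D: "link_diagram D"
  shows "(\<Sum>s\<in>states D. parity_sign (hdeg D s)) = (\<Sum>f \<in> arcs D \<rightarrow>\<^sub>E UNIV. \<Prod>r<ncross D. local_weight D f r)"
proof -
  let ?n = "ncross D" and ?F = "arcs D \<rightarrow>\<^sub>E (UNIV :: label set)" and ?e = "\<Prod>r<ncross D. if positive D r then 1 else -1 :: int"
  have finF: "finite ?F" using D by (auto intro!: finite_PiE simp: UNIV_label link_diagram_def)
  have st: "states D = (SIGMA \<alpha>:Pow {..<?n}. circles D \<alpha> \<rightarrow>\<^sub>E UNIV)" by (auto simp: states_def)
  have all: "(\<Prod>r\<in>\<alpha>. - of_bool (agrees D f r True)) * (\<Prod>r\<in>{..<?n} - \<alpha>. of_bool (agrees D f r False))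
      = (-1) ^ card \<alpha> * (of_bool (\<forall>r<?n. agrees D f r (r \<in> \<alpha>)) :: int)" if \<alpha>: "\<alpha> \<subseteq> {..<?n}" for f \<alpha>
  proof -
    have fin: "finite \<alpha>" using \<alpha> by (rule finite_subset) simp
    have ob: "(\<Prod>r\<in>A. of_bool (P r)) = (of_bool (\<forall>r\<in>A. P r) :: int)" if "finite A" for A and P :: "nat \<Rightarrow> bool"
      using that by (induction A) auto
    have "(\<forall>r<?n. agrees D f r (r \<in> \<alpha>)) \<longleftrightarrow> (\<forall>r\<in>\<alpha>. agrees D f r True) \<and> (\<forall>r\<in>{..<?n} - \<alpha>. agrees D f r False)"
    proof -
      have "agrees D f r (r \<in> \<alpha>) \<longleftrightarrow> (r \<in> \<alpha> \<longrightarrow> agrees D f r True) \<and> (r \<notin> \<alpha> \<longrightarrow> agrees D f r False)" for r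
        by (cases "r \<in> \<alpha>") simp_all
      then show ?thesis using \<alpha> by blast
    qed
    then show ?thesis using fin by (simp add: prod.distrib ob prod_uminus)
  qed
  have "(\<Sum>s\<in>states D. parity_sign (hdeg D s)) = (\<Sum>\<alpha>\<in>Pow {..<?n}. \<Sum>v \<in> circles D \<alpha> \<rightarrow>\<^sub>E UNIV. parity_sign (hdeg D (\<alpha>, v)))"
    unfolding st using finite_circles[OF D]
    by (subst sum.Sigma) (auto intro!: finite_PiE simp: UNIV_label split_beta)
  also have "\<dots> = (\<Sum>\<alpha>\<in>Pow {..<?n}. \<Sum>f\<in>?F. ?e * ((-1) ^ card \<alpha> * of_bool (\<forall>r<?n. agrees D f r (r \<in> \<alpha>))))"
  proof (rule sum.cong[OF refl])
    fix \<alpha> assume \<alpha>: "\<alpha> \<in> Pow {..<?n}"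
    have "(\<Sum>v \<in> circles D \<alpha> \<rightarrow>\<^sub>E (UNIV :: label set). parity_sign (hdeg D (\<alpha>, v)))
        = int (card (circles D \<alpha> \<rightarrow>\<^sub>E (UNIV :: label set))) * (?e * (-1) ^ card \<alpha>)"
      using \<alpha> by (simp add: parity_sign_hdeg)
    also have "card (circles D \<alpha> \<rightarrow>\<^sub>E (UNIV :: label set)) = card {f \<in> ?F. \<forall>r<?n. agrees D f r (r \<in> \<alpha>)}"
      by (rule bij_betw_same_card[OF bij_betw_circle_labels[OF D]])
    also have "int \<dots> * (?e * (-1) ^ card \<alpha>) = (\<Sum>f\<in>?F. of_bool (\<forall>r<?n. agrees D f r (r \<in> \<alpha>)) * (?e * (-1) ^ card \<alpha>))"
      unfolding sum_distrib_right[symmetric] using finF by (simp add: Int_def)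
    finally show "(\<Sum>v \<in> circles D \<alpha> \<rightarrow>\<^sub>E (UNIV :: label set). parity_sign (hdeg D (\<alpha>, v)))
      = (\<Sum>f\<in>?F. ?e * ((-1) ^ card \<alpha> * of_bool (\<forall>r<?n. agrees D f r (r \<in> \<alpha>))))" by (simp add: ac_simps)
  qed
  also have "\<dots> = (\<Sum>f\<in>?F. ?e * (\<Sum>\<alpha>\<in>Pow {..<?n}. (\<Prod>r\<in>\<alpha>. - of_bool (agrees D f r True)) * (\<Prod>r\<in>{..<?n} - \<alpha>. of_bool (agrees D f r False))))"
    by (subst sum.swap, rule sum.cong[OF refl], subst sum_distrib_left, rule sum.cong[OF refl])
      (simp only: all Pow_iff)
  also have "\<dots> = (\<Sum>f\<in>?F. \<Prod>r<?n. local_weight D f r)"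
  proof (rule sum.cong[OF refl])
    fix f
    have "?e * (\<Sum>\<alpha>\<in>Pow {..<?n}. (\<Prod>r\<in>\<alpha>. - of_bool (agrees D f r True)) * (\<Prod>r\<in>{..<?n} - \<alpha>. of_bool (agrees D f r False)))
      = ?e * (\<Prod>r<?n. - of_bool (agrees D f r True) + of_bool (agrees D f r False))"
      by (subst prod_add) simp_all
    also have "\<dots> = (\<Prod>r<?n. local_weight D f r)"
      unfolding prod.distrib[symmetric] by (rule prod.cong) (simp_all add: local_weight_def)
    finally show "?e * (\<Sum>\<alpha>\<in>Pow {..<?n}. (\<Prod>r\<in>\<alpha>. - of_bool (agrees D f r True)) * (\<Prod>r\<in>{..<?n} - \<alpha>. of_bool (agrees D f r False)))
      = (\<Prod>r<?n. local_weight D f r)" .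
  qed
  finally show ?thesis .
qed

text \<open>
  Slots 0 and 2, and likewise slots 1 and 3, are the two ends of a strand at the crossing.
\<close>

definition alternating :: "link_diagram \<Rightarrow> (nat \<Rightarrow> label) set" where
  "alternating D = {f \<in> arcs D \<rightarrow>\<^sub>E UNIV. \<forall>r<ncross D. f (arc D r 2) \<noteq> f (arc D r 0) \<and> f (arc D r 1) \<noteq> f (arc D r 3)}"

text \<open>
  If both strands change their label, exactly one of the smoothings is respected: the one
  joining the two incoming arcs if these have equal labels, and the one along the orientation
  otherwise. In all other cases both smoothings or neither of them are respected, and the weight
  is zero. The labels \<open>1\<close> and \<open>x\<close> are encoded by their degrees 1 and -1.
\<close>

lemma local_weight_eq:
  "local_weight D f r = (if f (arc D r 2) \<noteq> f (arc D r 0) \<and> f (arc D r 1) \<noteq> f (arc D r 3)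
     then - (deg (f (arc D r 0)) * deg (f (arc D r (if positive D r then 3 else 1)))) else 0)"
  by (cases "f (arc D r 0)"; cases "f (arc D r 1)"; cases "f (arc D r 2)"; cases "f (arc D r 3)")
    (simp_all add: local_weight_def agrees_def)


lemma in_slots_Sigma: "in_slots D = (SIGMA r:{..<ncross D}. {0, if positive D r then 3 else 1})"
  by (auto simp: in_slots_def split: if_splits)

lemma out_slots_Sigma: "out_slots D = (SIGMA r:{..<ncross D}. {2, if positive D r then 1 else 3})"
  by (auto simp: out_slots_def split: if_splits)

lemma card_in_slots: "card (in_slots D) = 2 * ncross D"
  unfolding in_slots_Sigma by (subst card_SigmaI) auto

lemma sum_two_slots:
  fixes h :: "nat \<times> nat \<Rightarrow> int"
  assumes "\<And>r. u \<noteq> w r"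
  shows "(\<Sum>x\<in>(SIGMA r:{..<n}. {u, w r}). h x) = (\<Sum>r<n. h (r, u) + h (r, w r))"
  using sum.Sigma[of "{..<n}" "\<lambda>r. {u, w r}" "\<lambda>r p. h (r, p)"] assms by (simp add: split_beta)

lemma prod_two_slots:
  fixes h :: "nat \<times> nat \<Rightarrow> int"
  assumes "\<And>r. u \<noteq> w r"
  shows "(\<Prod>x\<in>(SIGMA r:{..<n}. {u, w r}). h x) = (\<Prod>r<n. h (r, u) * h (r, w r))"
  using prod.Sigma[of "{..<n}" "\<lambda>r. {u, w r}" "\<lambda>r p. h (r, p)"] assms by (simp add: split_beta)

text \<open>
  The sum of \<open>deg\<close> over the in-slots equals the sum over the out-slots, because both run over
  the same arcs, and it is the negative of it, because the labels change at the crossings. Hence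
  the sum is zero, and \<open>x\<close> occurs at half of the \<open>2n\<close> in-slots. The \<open>n\<close> labels \<open>x\<close> and
  the \<open>n\<close> signs in the weights cancel.
\<close>

lemma prod_weight_alternating:
  assumes D: "link_diagram D" and f: "f \<in> alternating D"
  shows "(\<Prod>r<ncross D. local_weight D f r) = 1"
proof -
  let ?n = "ncross D" and ?g = "\<lambda>x. deg (f (slot_arc D x))"
  have flip: "f (arc D r 2) \<noteq> f (arc D r 0)" "f (arc D r 1) \<noteq> f (arc D r 3)" if "r < ?n" for r
    using f that by (auto simp: alternating_def)
  have neg: "deg x = - deg y" if "x \<noteq> y" for x y using that by (cases x; cases y) auto
  have inj: "inj_on (slot_arc D) (in_slots D)" "inj_on (slot_arc D) (out_slots D)"
    and im: "slot_arc D ` in_slots D = slot_arc D ` out_slots D"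
    using D by (auto simp: link_diagram_def)
  have fin: "finite (in_slots D)" unfolding in_slots_Sigma by auto
  have "(\<Sum>x\<in>in_slots D. ?g x) = (\<Sum>a\<in>slot_arc D ` in_slots D. deg (f a))"
    by (simp add: sum.reindex[OF inj(1)])
  also have "\<dots> = (\<Sum>x\<in>out_slots D. ?g x)"
    unfolding im by (simp add: sum.reindex[OF inj(2)])
  also have "\<dots> = (\<Sum>r<?n. ?g (r, 2) + ?g (r, if positive D r then 1 else 3))"
    unfolding out_slots_Sigma by (rule sum_two_slots) simp
  also have "\<dots> = (\<Sum>r<?n. - (?g (r, 0) + ?g (r, if positive D r then 3 else 1)))"
  proof (rule sum.cong[OF refl])
    fix r assume "r \<in> {..<?n}"
    then show "?g (r, 2) + ?g (r, if positive D r then 1 else 3) = - (?g (r, 0) + ?g (r, if positive D r then 3 else 1))"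
      using neg[OF flip(1), of r] neg[OF flip(2), of r] by (simp add: slot_arc_def)
  qed
  also have "\<dots> = - (\<Sum>x\<in>in_slots D. ?g x)"
    unfolding in_slots_Sigma sum_negf by (subst sum_two_slots) simp_all
  finally have zero: "(\<Sum>x\<in>in_slots D. ?g x) = 0" by simp
  let ?N = "{x \<in> in_slots D. f (slot_arc D x) = LX}"
  have "?g x = 1 - 2 * of_bool (x \<in> ?N)" if "x \<in> in_slots D" for x
    using that by (cases "f (slot_arc D x)") auto
  then have "(\<Sum>x\<in>in_slots D. ?g x) = (\<Sum>x\<in>in_slots D. 1 - 2 * of_bool (x \<in> ?N))"
    by (rule sum.cong[OF refl])
  also have "\<dots> = int (card (in_slots D)) - 2 * (\<Sum>x\<in>in_slots D. of_bool (x \<in> ?N))"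
    by (simp only: sum_subtractf sum_distrib_left[symmetric]) simp
  also have "(\<Sum>x\<in>in_slots D. of_bool (x \<in> ?N)) = int (card ?N)"
    using fin by (simp add: Int_def conj_assoc) 
  finally have N: "card ?N = ?n" using zero card_in_slots[of D] by simp
  have "(\<Prod>x\<in>in_slots D. ?g x) = (\<Prod>x\<in>in_slots D. if x \<in> ?N then -1 else 1)"
  proof (rule prod.cong[OF refl])
    fix x assume "x \<in> in_slots D"
    then show "?g x = (if x \<in> ?N then -1 else 1)" by (cases "f (slot_arc D x)") auto
  qed
  also have "\<dots> = (-1) ^ card ?N"
  proof -
    have "in_slots D \<inter> {x. x \<in> ?N} = ?N" by auto
    then show ?thesis using fin by (simp only: prod.If_cases prod_constant power_one mult_1_right)
  qed
  finally have P: "(\<Prod>x\<in>in_slots D. ?g x) = (-1) ^ ?n" unfolding N .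
  have "(\<Prod>r<?n. local_weight D f r) = (\<Prod>r<?n. - 1 * (?g (r, 0) * ?g (r, if positive D r then 3 else 1)))"
    by (rule prod.cong[OF refl]) (use flip in \<open>simp add: local_weight_eq slot_arc_def\<close>)
  also have "\<dots> = (-1) ^ ?n * (\<Prod>r<?n. ?g (r, 0) * ?g (r, if positive D r then 3 else 1))"
    by (simp only: prod.distrib prod_constant card_lessThan)
  also have "(\<Prod>r<?n. ?g (r, 0) * ?g (r, if positive D r then 3 else 1)) = (\<Prod>x\<in>in_slots D. ?g x)"
    unfolding in_slots_Sigma by (subst prod_two_slots) simp_all
  finally show ?thesis unfolding P by (simp flip: power_mult_distrib)
qed

lemma state_sum_alternating:
  assumes D: "link_diagram D"
  shows "(\<Sum>s\<in>states D. parity_sign (hdeg D s)) = int (card (alternating D))"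
proof -
  let ?F = "arcs D \<rightarrow>\<^sub>E (UNIV :: label set)"
  have finF: "finite ?F" using D by (auto intro!: finite_PiE simp: UNIV_label link_diagram_def)
  have "(\<Prod>r<ncross D. local_weight D f r) = 0" if f: "f \<in> ?F - alternating D" for f
  proof -
    obtain r where "r < ncross D" "\<not> (f (arc D r 2) \<noteq> f (arc D r 0) \<and> f (arc D r 1) \<noteq> f (arc D r 3))"
      using f by (auto simp: alternating_def)
    then have "r \<in> {..<ncross D}" "local_weight D f r = 0" by (simp_all only: local_weight_eq if_False lessThan_iff)
    then show ?thesis by (meson finite_lessThan prod_zero)
  qed
  then have "(\<Sum>f\<in>?F. \<Prod>r<ncross D. local_weight D f r) = (\<Sum>f\<in>alternating D. \<Prod>r<ncross D. local_weight D f r)"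
    using finF by (intro sum.mono_neutral_right) (auto simp: alternating_def)
  also have "\<dots> = (\<Sum>f\<in>alternating D. 1)"
    by (rule sum.cong[OF refl]) (rule prod_weight_alternating[OF D])
  finally show ?thesis by (simp add: state_sum[OF D])
qed


section \<open>Alternating labellings of a knot\<close>

definition strand_steps :: "link_diagram \<Rightarrow> (nat \<times> nat) set" where
  "strand_steps D = {(arc D r p, arc D r p') | r p p'. r < ncross D \<and> (p, p') \<in> {(0, 2), (1, 3)}}"

lemma components_eq: "components D = arcs D // eqv (strand_steps D)"
proof -
  have "p \<in> {0, 1} \<and> p' = p + 2 \<longleftrightarrow> (p, p') \<in> {(0, 2), (1, 3)}" for p p' :: nat by auto
  then have "{(arc D r p, arc D r p') | r p p'. r < ncross D \<and> p \<in> {0, 1} \<and> p' = p + 2} = strand_steps D"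
    unfolding strand_steps_def by (simp only:)
  moreover have "{(arc D r p, arc D r (p + 2)) | r p. r < ncross D \<and> p \<in> {0, 1}}
      = {(arc D r p, arc D r p') | r p p'. r < ncross D \<and> p \<in> {0, 1} \<and> p' = p + 2}" by blast
  ultimately have "{(arc D r p, arc D r (p + 2)) | r p. r < ncross D \<and> p \<in> {0, 1}} = strand_steps D" by (rule trans[rotated])
  then show ?thesis by (simp add: components_def generated_classes_def eqv_def)
qed

lemma knot_connected:
  assumes K: "knot_diagram D"
  obtains a0 where "a0 \<in> arcs D" "\<And>a. a \<in> arcs D \<Longrightarrow> (a0, a) \<in> eqv (strand_steps D)"
proof -
  obtain C where C: "arcs D // eqv (strand_steps D) = {C}"
    using K by (auto simp: knot_diagram_def card_1_singleton_iff components_eq)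
  then have "arcs D \<noteq> {}" by (auto simp: quotient_def)
  then obtain a0 where a0: "a0 \<in> arcs D" by auto
  have cls: "eqv (strand_steps D) `` {a} = C" if "a \<in> arcs D" for a
    using quotientI[OF that, of "eqv (strand_steps D)"] C by simp
  have "(a0, a) \<in> eqv (strand_steps D)" if "a \<in> arcs D" for a
    using cls[OF that] cls[OF a0] eqv_refl[of a] by blast
  with a0 show thesis by (rule that)
qed

lemma strand_step_alternating:
  assumes "f \<in> alternating D" "(a, b) \<in> strand_steps D"
  shows "f a \<noteq> f b"
proof -
  obtain r where "r < ncross D" "a = arc D r 0 \<and> b = arc D r 2 \<or> a = arc D r 1 \<and> b = arc D r 3"
    using assms(2) unfolding strand_steps_def by blast
  then show ?thesis using assms(1) by (auto simp: alternating_def)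
qed

text \<open>
  Whether two alternating labellings agree does not change along the knot, so they agree
  everywhere or nowhere.
\<close>

lemma card_alternating:
  assumes K: "knot_diagram D" and f: "f \<in> alternating D"
  shows "card (alternating D) = 2"
proof -
  obtain a0 where a0: "a0 \<in> arcs D" and conn: "\<And>a. a \<in> arcs D \<Longrightarrow> (a0, a) \<in> eqv (strand_steps D)"
    using knot_connected[OF K] by blast
  have D: "link_diagram D" using K by (simp add: knot_diagram_def)
  define other where "other = (\<lambda>x. if x = L1 then LX else L1)"
  have other: "x \<noteq> y \<longleftrightarrow> y = other x" for x y by (cases x; cases y) (auto simp: other_def)
  let ?g = "\<lambda>a\<in>arcs D. other (f a)"
  have g: "?g \<in> alternating D"
  proof -
    have "other x = other y \<longleftrightarrow> x = y" for x y by (cases x; cases y) (auto simp: other_def)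
    then show ?thesis using f arc_in_arcs[OF D] by (simp add: alternating_def)
  qed
  have "h = f \<or> h = ?g" if h: "h \<in> alternating D" for h
  proof -
    have "eqv (strand_steps D) \<subseteq> {(a, b). (h a = f a) = (h b = f b)}"
    proof (rule eqv_least)
      show "strand_steps D \<subseteq> {(a, b). (h a = f a) = (h b = f b)}"
      proof clarify
        fix a b assume "(a, b) \<in> strand_steps D"
        then have "h b = other (h a)" "f b = other (f a)"
          using strand_step_alternating h f other by blast+
        then show "(h a = f a) = (h b = f b)" by (cases "h a"; cases "f a") (auto simp: other_def)
      qed
    qed (auto simp: equiv_def refl_on_def sym_def trans_def)
    then have same: "(h a0 = f a0) = (h a = f a)" if "a \<in> arcs D" for a
      using conn[OF that] by auto
    show ?thesis
    proof (cases "h a0 = f a0")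
      case True
      have "h = f" by (rule PiE_ext[of h "arcs D" "\<lambda>_. UNIV"]) (use h f same True in \<open>auto simp: alternating_def\<close>)
      then show ?thesis by simp
    next
      case False
      have "h = ?g"
      proof (rule PiE_ext[of h "arcs D" "\<lambda>_. UNIV"])
        fix a assume "a \<in> arcs D"
        then show "h a = ?g a" using same[of a] False other[of "f a" "h a"] by simp
      qed (use h g in \<open>auto simp: alternating_def\<close>)
      then show ?thesis by simp
    qed
  qed
  then have "alternating D = {f, ?g}" using f g by blast
  moreover have "f a0 \<noteq> ?g a0" using a0 other[of "f a0" "other (f a0)"] by simp
  then have "f \<noteq> ?g" by metis
  ultimately show ?thesis by simp
qed

text \<open>
  The condition on the subsets \<open>S\<close> says that \<open>g\<close> acts transitively, so \<open>A\<close> is one cycle of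
  \<open>g\<close>. Its length being even, the parity of the position in the cycle is a well-defined
  alternating property.
\<close>

lemma parity_of_cycle:
  fixes g :: "'a \<Rightarrow> 'a"
  assumes fin: "finite A" and bij: "bij_betw g A A" and ev: "even (card A)"
    and conn: "\<And>S. S \<subseteq> A \<Longrightarrow> S \<noteq> {} \<Longrightarrow> (\<And>a. a \<in> A \<Longrightarrow> a \<in> S \<longleftrightarrow> g a \<in> S) \<Longrightarrow> S = A"
  obtains P where "\<And>a. a \<in> A \<Longrightarrow> P (g a) \<longleftrightarrow> \<not> P a"
proof (cases "A = {}")
  case False
  then obtain a0 where a0: "a0 \<in> A" by auto
  define e where "e k = (g ^^ k) a0" for k
  have e_Suc: "e (Suc k) = g (e k)" and e_0: "e 0 = a0" for k by (simp_all add: e_def)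
  have e_A: "e k \<in> A" for k
    by (induction k) (use a0 bij in \<open>auto simp: e_Suc e_0 bij_betw_def\<close>)
  have inj: "inj_on (g ^^ k) A" for k
    using bij_betw_funpow[OF bij, of k] by (simp add: bij_betw_def)
  have "\<not> inj e"
  proof
    assume "inj e"
    then have "infinite (range e)" by (simp add: finite_image_iff)
    moreover have "range e \<subseteq> A" using e_A by auto
    ultimately show False using fin finite_subset by blast
  qed
  then obtain i j where ij: "i < j" "e i = e j" unfolding inj_def by (metis linorder_neqE_nat)
  have e_add: "e (m + k) = (g ^^ m) (e k)" for m k by (simp add: e_def funpow_add)
  have "(g ^^ i) (e (j - i)) = (g ^^ i) a0"
    using ij e_add[of i "j - i"] by (simp add: e_def)
  then have "e (j - i) = a0" using inj[of i] e_A a0 by (auto simp: inj_on_def)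
  then have ex: "\<exists>m. 0 < m \<and> e m = a0" using ij by (intro exI[of _ "j - i"]) simp
  \<comment> \<open>The length of the cycle through \<open>a0\<close>.\<close>
  define N where "N = (LEAST m. 0 < m \<and> e m = a0)"
  have N: "0 < N" "e N = a0" unfolding N_def using LeastI_ex[OF ex] by auto
  have N_least: "e m \<noteq> a0" if "0 < m" "m < N" for m
    using not_less_Least[of m "\<lambda>m. 0 < m \<and> e m = a0"] that unfolding N_def by blast
  have inj_e: "inj_on e {..<N}"
  proof (rule linorder_inj_onI)
    fix x y assume xy: "x < y" "x \<in> {..<N}" "y \<in> {..<N}"
    show "e x \<noteq> e y"
    proof
      assume eq: "e x = e y"
      have "e (N - y + x) = e (N - y + y)" unfolding e_add eq ..
      then have ret: "e (N - y + x) = a0" using xy N by simp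
      have "0 < N - y + x" "N - y + x < N" using xy by auto
      from N_least[OF this] ret show False by (rule notE)
    qed
  qed auto
  let ?S = "e ` {..<N}"
  have "?S = A"
  proof (rule conn)
    show "?S \<subseteq> A" using e_A by auto
    show "?S \<noteq> {}" using N by auto
    fix a assume a: "a \<in> A"
    show "a \<in> ?S \<longleftrightarrow> g a \<in> ?S"
    proof
      assume "a \<in> ?S"
      then obtain k where k: "k < N" "a = e k" by auto
      have "g a = (if Suc k < N then e (Suc k) else e 0)"
      proof (cases "Suc k < N")
        case False
        then have "Suc k = N" using k by simp
        then show ?thesis using N k e_Suc[of k] by (simp add: e_0)
      qed (simp add: k e_Suc)
      then show "g a \<in> ?S" using N by auto
    next
      assume "g a \<in> ?S"
      then obtain k where k: "k < N" "g a = e k" by auto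
      then have "\<exists>m<N. e (Suc m) = g a"
      proof (cases k)
        case 0
        then show ?thesis using N e_0 k by (intro exI[of _ "N - 1"]) simp
      next
        case (Suc m)
        then show ?thesis using k by (intro exI[of _ m]) simp
      qed
      then obtain m where "m < N" "g (e m) = g a" using e_Suc by auto
      then have "e m = a" using bij e_A a by (auto simp: bij_betw_def inj_on_def)
      then show "a \<in> ?S" using \<open>m < N\<close> by auto
    qed
  qed
  then have "even N" using ev card_image[OF inj_e] by simp
  define idx where "idx = inv_into {..<N} e"
  have idx: "idx (e k) = k" if "k < N" for k
    unfolding idx_def using inv_into_f_f[OF inj_e] that by simp
  have "odd (idx (g a)) \<longleftrightarrow> \<not> odd (idx a)" if a: "a \<in> A" for a
  proof -
    obtain k where k: "k < N" "a = e k" using a \<open>?S = A\<close> by auto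
    show ?thesis
    proof (cases "Suc k < N")
      case True
      then show ?thesis using k idx[of k] idx[of "Suc k"] by (simp add: e_Suc)
    next
      case False
      then have "Suc k = N" using k by simp
      then have "g a = e 0" using N k e_Suc[of k] by (simp add: e_0)
      then show ?thesis using idx[of 0] idx[of k] k N \<open>Suc k = N\<close> \<open>even N\<close> by auto
    qed
  qed
  then show thesis by (rule that)
qed (use that in auto)


text \<open>
  Following the strand through a crossing permutes the arcs. For a knot with \<open>n\<close> crossings,
  \<open>n > 0\<close>, this permutation is a single cycle of length \<open>2n\<close>.
\<close>

lemma ex_alternating:
  assumes K: "knot_diagram D"
  shows "\<exists>f. f \<in> alternating D"
proof (cases "ncross D = 0")
  case True
  then have "(\<lambda>a\<in>arcs D. L1) \<in> alternating D" by (auto simp: alternating_def)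
  then show ?thesis by blast
next
  case False
  have D: "link_diagram D" using K by (simp add: knot_diagram_def)
  have inj: "inj_on (slot_arc D) (in_slots D)" "inj_on (slot_arc D) (out_slots D)"
    and im: "slot_arc D ` in_slots D = slot_arc D ` out_slots D" and finA: "finite (arcs D)"
    and slot_arcs: "slot_arc D ` slots D \<subseteq> arcs D"
    using D by (auto simp: link_diagram_def)
  let ?A = "slot_arc D ` in_slots D"
  define opp where "opp = (\<lambda>(r :: nat, p :: nat). (r, (p + 2) mod 4))"
  define slot where "slot = inv_into (in_slots D) (slot_arc D)"
  define nxt where "nxt = slot_arc D \<circ> opp \<circ> slot"
  have sub: "?A \<subseteq> arcs D" using slot_arcs in_out_slots(1)[of D] by auto
  have b1: "bij_betw slot ?A (in_slots D)"
    unfolding slot_def by (rule bij_betw_inv_into) (simp add: bij_betw_def inj(1))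
  have b2: "bij_betw opp (in_slots D) (out_slots D)"
    by (rule bij_betw_byWitness[where f' = opp])
      (auto simp: opp_def in_slots_def out_slots_def split: if_splits)
  have b3: "bij_betw (slot_arc D) (out_slots D) ?A" using inj(2) im by (simp add: bij_betw_def)
  have bij: "bij_betw nxt ?A ?A"
    unfolding nxt_def by (rule bij_betw_trans[OF b1], rule bij_betw_trans[OF b2 b3])
  have nxt: "nxt (arc D r p) = arc D r ((p + 2) mod 4)" if "(r, p) \<in> in_slots D" for r p
  proof -
    have "slot (slot_arc D (r, p)) = (r, p)" unfolding slot_def by (rule inv_into_f_f[OF inj(1) that])
    then show ?thesis by (simp add: nxt_def opp_def slot_arc_def)
  qed
  have step: "(a \<in> ?A \<and> b = nxt a) \<or> (b \<in> ?A \<and> a = nxt b)" if ab: "(a, b) \<in> strand_steps D" for a b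
  proof -
    have in_A: "arc D r p \<in> ?A" if "(r, p) \<in> in_slots D" for r p
      using imageI[OF that, of "slot_arc D"] by (simp add: slot_arc_def)
    obtain r p p' where r: "r < ncross D" "p = 0 \<and> p' = 2 \<or> p = 1 \<and> p' = 3" "a = arc D r p" "b = arc D r p'"
      using ab unfolding strand_steps_def by blast
    have "(r, p) \<in> in_slots D \<and> p' = (p + 2) mod 4 \<or> (r, p') \<in> in_slots D \<and> p = (p' + 2) mod 4"
      using r(1,2) by (cases "positive D r") (auto simp: in_slots_def)
    then show ?thesis using in_A nxt r(3,4) by metis
  qed
  obtain a0 where a0: "a0 \<in> arcs D" and conn: "\<And>a. a \<in> arcs D \<Longrightarrow> (a0, a) \<in> eqv (strand_steps D)"
    using knot_connected[OF K] by blast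
  have whole: "S = arcs D"
    if S: "S \<subseteq> ?A" "S \<noteq> {}" "\<And>a. a \<in> ?A \<Longrightarrow> a \<in> S \<longleftrightarrow> nxt a \<in> S" for S
  proof -
    have "eqv (strand_steps D) \<subseteq> {(a, b). a \<in> S \<longleftrightarrow> b \<in> S}"
      by (rule eqv_least) (use step S(3) in blast, auto simp: equiv_def refl_on_def sym_def trans_def)
    then have "a0 \<in> S \<longleftrightarrow> a \<in> S" if "a \<in> arcs D" for a using conn[OF that] by auto
    then show ?thesis using S(1,2) sub by blast
  qed
  have "(0, 0) \<in> in_slots D" using False by (auto simp: in_slots_def)
  then have "?A \<noteq> {}" by blast
  moreover have nxt_A: "nxt a \<in> ?A" if "a \<in> ?A" for a using bij_betwE[OF bij] that by blast
  ultimately have A: "?A = arcs D" by (intro whole) simp_all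
  have "card ?A = 2 * ncross D" using card_image[OF inj(1)] card_in_slots[of D] by simp
  then have ev: "even (card ?A)" by simp
  have finA': "finite ?A" using sub finA by (rule finite_subset)
  have whole': "S = ?A" if "S \<subseteq> ?A" "S \<noteq> {}" "\<And>a. a \<in> ?A \<Longrightarrow> a \<in> S \<longleftrightarrow> nxt a \<in> S" for S
    unfolding A by (rule whole[OF that])
  obtain P where P: "\<And>a. a \<in> ?A \<Longrightarrow> P (nxt a) \<longleftrightarrow> \<not> P a"
    using parity_of_cycle[OF finA' bij ev whole'] by blast
  define f where "f = (\<lambda>a\<in>arcs D. if P a then L1 else LX)"
  have step_f: "f a \<noteq> f b" if ab: "(a, b) \<in> strand_steps D" for a b
  proof -
    have "f (nxt c) \<noteq> f c" if "c \<in> ?A" for c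
    proof -
      have "c \<in> arcs D" "nxt c \<in> arcs D" using that nxt_A[OF that] sub by auto
      then show ?thesis using P[OF that] by (simp add: f_def)
    qed
    then show ?thesis using step[OF ab] by metis
  qed
  have "f (arc D r 2) \<noteq> f (arc D r 0) \<and> f (arc D r 1) \<noteq> f (arc D r 3)" if "r < ncross D" for r
  proof -
    have "(arc D r 0, arc D r 2) \<in> strand_steps D" "(arc D r 1, arc D r 3) \<in> strand_steps D"
      using that unfolding strand_steps_def by blast+
    then show ?thesis using step_f by metis
  qed
  then have "f \<in> alternating D" unfolding alternating_def by (simp add: f_def)
  then show ?thesis by blast
qed

text \<open>
  For the unnormalized Jones polynomial of a knot this is the value 2 at \<open>q = 1\<close>.
\<close>

theorem state_sum_knot:
  assumes "knot_diagram D"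
  shows "(\<Sum>s\<in>states D. parity_sign (hdeg D s)) = 2"
proof -
  have "link_diagram D" using assms by (simp add: knot_diagram_def)
  moreover obtain f where "f \<in> alternating D" using ex_alternating[OF assms] by blast
  ultimately show ?thesis using state_sum_alternating card_alternating[OF assms] by simp
qed

section \<open>Laurent polynomials in u = t q^2\<close>

lemma tq_mult: "tq i j * tq i' j' = tq (i + i') (j + j')"
  by (simp add: tq_def mult_single)

lemma tq_0: "tq 0 0 = 1"
  by (simp add: tq_def flip: zero_prod_def)

lemma subst_tq2_superset:
  assumes "finite K" "Poly_Mapping.keys P \<subseteq> K"
  shows "subst_tq2 P = (\<Sum>k\<in>K. of_int (Poly_Mapping.lookup P k) * tq k (2 * k))"
  unfolding subst_tq2_def by (rule sum.mono_neutral_left) (use assms in \<open>auto simp: in_keys_iff\<close>)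

lemma subst_tq2_add: "subst_tq2 (P + Q) = subst_tq2 P + subst_tq2 Q"
proof -
  let ?K = "Poly_Mapping.keys P \<union> Poly_Mapping.keys Q"
  have "Poly_Mapping.keys (P + Q) \<subseteq> ?K" by (rule Poly_Mapping.keys_add)
  then show ?thesis
    by (simp add: subst_tq2_superset[of ?K] lookup_add distrib_right sum.distrib)
qed

lemma subst_tq2_single: "subst_tq2 (Poly_Mapping.single k c) = of_int c * tq k (2 * k)"
  by (subst subst_tq2_superset[of "{k}"]) auto

text \<open>
  A set rather than a divisibility relation, since the quotient has to be a Laurent polynomial
  in \<open>u\<close> and not just in \<open>t\<close> and \<open>q\<close>.
\<close>

definition multiples_of_1_plus_u :: "laurent_tq set" where
  "multiples_of_1_plus_u = range (\<lambda>P. (1 + tq 1 2) * subst_tq2 P)"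

lemma multiples_of_1_plus_u_0: "0 \<in> multiples_of_1_plus_u"
  unfolding multiples_of_1_plus_u_def by (rule image_eqI[of _ _ 0]) (simp_all add: subst_tq2_def)

lemma multiples_of_1_plus_u_add: "x \<in> multiples_of_1_plus_u \<Longrightarrow> y \<in> multiples_of_1_plus_u \<Longrightarrow> x + y \<in> multiples_of_1_plus_u"
  unfolding multiples_of_1_plus_u_def by (auto simp: subst_tq2_add[symmetric] distrib_left[symmetric])

lemma multiples_of_1_plus_u_single: "of_int c * (tq k (2 * k) + tq (k + 1) (2 * (k + 1))) \<in> multiples_of_1_plus_u"
  unfolding multiples_of_1_plus_u_def
  by (rule image_eqI[of _ _ "Poly_Mapping.single k c"])
    (simp_all add: subst_tq2_single distrib_left distrib_right tq_mult mult.left_commute ac_simps)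

text \<open>
  Modulo \<open>1 + u\<close> the variable \<open>u\<close> is congruent to -1. The induction runs in both directions
  from exponent 0, as negative exponents occur.
\<close>

lemma multiples_of_1_plus_u_power: "of_int c * (tq k (2 * k) - of_int (parity_sign k)) \<in> multiples_of_1_plus_u"
proof (induction k arbitrary: c rule: int_induct[where k = 0])
  case base
  then show ?case by (simp add: tq_0 parity_sign_def multiples_of_1_plus_u_0)
next
  case (step1 i)
  have "of_int c * (tq (i + 1) (2 * (i + 1)) - of_int (parity_sign (i + 1)))
    = of_int c * (tq i (2 * i) + tq (i + 1) (2 * (i + 1))) + of_int (- c) * (tq i (2 * i) - of_int (parity_sign i))"
    unfolding parity_sign_add_1 by (simp add: algebra_simps)
  then show ?case using multiples_of_1_plus_u_add[OF multiples_of_1_plus_u_single step1.IH] by metis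
next
  case (step2 i)
  have "parity_sign (i - 1) = - parity_sign i" by (simp add: parity_sign_def)
  then have "of_int c * (tq (i - 1) (2 * (i - 1)) - of_int (parity_sign (i - 1)))
    = of_int c * (tq (i - 1) (2 * (i - 1)) + tq (i - 1 + 1) (2 * (i - 1 + 1))) + of_int (- c) * (tq i (2 * i) - of_int (parity_sign i))"
    by (simp add: algebra_simps)
  then show ?case using multiples_of_1_plus_u_add[OF multiples_of_1_plus_u_single step2.IH] by metis
qed

lemma ex_quotient_by_1_plus_u:
  assumes "finite I" "(\<Sum>i\<in>I. parity_sign i * a i) = 1"
  shows "\<exists>P. (\<Sum>i\<in>I. of_int (a i) * tq i (2 * i)) = 1 + (1 + tq 1 2) * subst_tq2 P"
proof -
  have "(\<Sum>i\<in>I. of_int (a i) * (tq i (2 * i) - of_int (parity_sign i))) \<in> multiples_of_1_plus_u"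
    using assms(1) by (induction I) (auto intro: multiples_of_1_plus_u_0 multiples_of_1_plus_u_add multiples_of_1_plus_u_power)
  moreover have "(\<Sum>i\<in>I. of_int (a i) * (tq i (2 * i) - of_int (parity_sign i)))
      = (\<Sum>i\<in>I. of_int (a i) * tq i (2 * i)) - of_int (\<Sum>i\<in>I. parity_sign i * a i)"
    by (simp add: right_diff_distrib sum_subtractf mult.commute)
  ultimately have "(\<Sum>i\<in>I. of_int (a i) * tq i (2 * i)) - 1 \<in> multiples_of_1_plus_u" using assms(2) by simp
  then obtain P where "(\<Sum>i\<in>I. of_int (a i) * tq i (2 * i)) - 1 = (1 + tq 1 2) * subst_tq2 P"
    unfolding multiples_of_1_plus_u_def by blast
  then show ?thesis by (intro exI[of _ P]) (simp add: diff_eq_eq add.commute)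
qed

theorem theorem5p2:
  fixes D :: link_diagram and s :: int
  assumes "knot_diagram D"
    and "KH_concentrated D s"
  shows "\<exists>P :: int \<Rightarrow>\<^sub>0 int.
    Kh D = tq 0 (s - 1) * (1 + tq 0 2) * (1 + (1 + tq 1 2) * subst_tq2 P)"
proof -
  have D: "link_diagram D" using assms(1) by (simp add: knot_diagram_def)
  obtain p where p: "p \<in> arcs D" using knot_connected[OF assms(1)] by blast
  let ?I = "{- int (ncross D)..int (ncross D)}" and ?J = "qdeg D ` states D"
  define a where "a i = dim_KH D i (s - 1 + 2 * i)" for i
  have thin: "dim_KH D i (s + 1 + 2 * i) = a i" for i
    unfolding a_def by (rule dim_KH_thin[OF D p assms(2)])
  have zero: "dim_KH D i j = 0" if "j \<noteq> s - 1 + 2 * i" "j \<noteq> s + 1 + 2 * i" for i j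
    by (rule dim_KH_eq_0[OF D assms(2)]) (use that in auto)
  \<comment> \<open>Each of the two diagonals contributes \<open>a i\<close>.\<close>
  have row: "(\<Sum>j\<in>?J. parity_sign i * int (dim_KH D i j)) = 2 * (parity_sign i * int (a i))" for i
  proof -
    have "(\<Sum>j\<in>?J. parity_sign i * int (dim_KH D i j)) = (\<Sum>j\<in>{s - 1 + 2 * i, s + 1 + 2 * i}. parity_sign i * int (dim_KH D i j))"
      by (rule sum.mono_neutral_cong) (use zero dim_KH_nonzero[OF D] finite_states[OF D] in auto)
    then show ?thesis by (simp add: thin a_def[symmetric])
  qed
  have "2 * (\<Sum>i\<in>?I. parity_sign i * int (a i)) = 2"
    using euler_characteristic[OF D] unfolding row state_sum_knot[OF assms(1)] by (simp add: sum_distrib_left)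
  then have "(\<Sum>i\<in>?I. parity_sign i * int (a i)) = 1" by simp
  then obtain P where P: "(\<Sum>i\<in>?I. of_int (int (a i)) * tq i (2 * i)) = 1 + (1 + tq 1 2) * subst_tq2 P"
    using ex_quotient_by_1_plus_u[of ?I "\<lambda>i. int (a i)"] by auto
  let ?g = "\<lambda>(i, j). tq i j * of_nat (dim_KH D i j)"
  let ?S = "SIGMA i:?I. {s - 1 + 2 * i, s + 1 + 2 * i}"
  have "Kh D = (\<Sum>x\<in>?S. ?g x)"
    unfolding Kh_def
  proof (rule Sum_any.expand_superset)
    show "{x. ?g x \<noteq> 0} \<subseteq> ?S"
    proof
      fix x assume x: "x \<in> {x. ?g x \<noteq> 0}"
      obtain i j where ij: "x = (i, j)" by (cases x)
      have "dim_KH D i j \<noteq> 0"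
      proof
        assume "dim_KH D i j = 0"
        then show False using x by (simp add: ij)
      qed
      then have "i \<in> ?I" "j = s - 1 + 2 * i \<or> j = s + 1 + 2 * i"
        using zero dim_KH_nonzero(1)[OF D] by metis+
      then show "x \<in> ?S" by (simp add: ij)
    qed
  qed auto
  also have "\<dots> = (\<Sum>i\<in>?I. \<Sum>j\<in>{s - 1 + 2 * i, s + 1 + 2 * i}. tq i j * of_nat (dim_KH D i j))"
    by (rule sum.Sigma[symmetric]) auto
  also have "\<dots> = (\<Sum>i\<in>?I. tq 0 (s - 1) * (1 + tq 0 2) * (of_int (int (a i)) * tq i (2 * i)))"
  proof (rule sum.cong[OF refl])
    fix i
    have "tq 0 (s - 1) * (1 + tq 0 2) * tq i (2 * i) = tq i (s - 1 + 2 * i) + tq i (s + 1 + 2 * i)"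
      by (simp add: distrib_left distrib_right tq_mult) (simp add: add.commute)
    moreover have "(\<Sum>j\<in>{s - 1 + 2 * i, s + 1 + 2 * i}. tq i j * of_nat (dim_KH D i j))
        = (tq i (s - 1 + 2 * i) + tq i (s + 1 + 2 * i)) * of_nat (a i)"
      by (simp add: thin a_def[symmetric] distrib_right)
    ultimately show "(\<Sum>j\<in>{s - 1 + 2 * i, s + 1 + 2 * i}. tq i j * of_nat (dim_KH D i j))
      = tq 0 (s - 1) * (1 + tq 0 2) * (of_int (int (a i)) * tq i (2 * i))"
      by (simp add: ac_simps)
  qed
  also have "\<dots> = tq 0 (s - 1) * (1 + tq 0 2) * (1 + (1 + tq 1 2) * subst_tq2 P)"
    unfolding sum_distrib_left[symmetric] P ..
  finally show ?thesis by blast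
qed

end
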